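(* Let $\nu>0$, let $\lambda\neq0$ and $\varsigma\ge0$ be constants, and let $\rho:\mathbb{R}\to\mathbb{R}$ be globally Lipschitz continuous with $|\rho(x)|^2=\lambda^2(\varsigma^2+x^2)$ for all $x\in\mathbb{R}$. Let $\mu=\delta_0$ be the Dirac delta measure with unit mass at zero, and let $u$ be the random field solution of $\left(\partial_t-\frac{\nu}{2}\partial_x^2\right)u=\rho(u)\dot W$ on $\mathbb{R}_+^*\times\mathbb{R}$, $u(0,\cdot)=\mu$. Then for all $t>0$ and $x,y\in\mathbb{R}$, $$\mathbb{E}[u(t,x)u(t,y)]=G_\nu(t,x)G_\nu(t,y)-\varsigma^2\,\mathrm{erfc}\left(\frac{|x-y|}{2\sqrt{\nu t}}\right)+\left(\frac{\lambda^2}{4\nu}G_{\nu/2}\left(t,\frac{x+y}{2}\right)+\varsigma^2\right)\exp\left(\frac{\lambda^4t-2\lambda^2|x-y|}{4\nu}\right)\mathrm{erfc}\left(\frac{|x-y|-\lambda^2t}{2\sqrt{\nu t}}\right).$$ In addition, when $y=x$, $\mathbb{E}[|u(t,x)|^2]=\frac{1}{\lambda^2}\mathcal K(t,x)+\varsigma^2\mathcal H(t)$.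
   Context: $\mathbb{R}_+^*=\,]0,+\infty[$. $G_\nu(t,x)=\frac{1}{\sqrt{2\pi\nu t}}\exp\{-\frac{|x|^2}{2\nu t}\}$ for $t>0$, and $G_\nu(t,\cdot)\equiv0$ for $t\le 0$. $\mathrm{erfc}(x)=1-\frac{2}{\sqrt\pi}\int_0^xe^{-y^2}\mathrm{d}y$; $\Phi(x)=\int_{-\infty}^x\frac{e^{-y^2/2}}{\sqrt{2\pi}}\mathrm{d}y$; $$\mathcal K(t,x)=G_{\nu/2}(t,x)\Big(\frac{\lambda^2}{\sqrt{4\pi\nu t}}+\frac{\lambda^4}{2\nu}e^{\frac{\lambda^4t}{4\nu}}\Phi\Big(\lambda^2\sqrt{\tfrac{t}{2\nu}}\Big)\Big),\qquad\mathcal H(t)=2e^{\frac{\lambda^4t}{4\nu}}\Phi\Big(\lambda^2\sqrt{\tfrac{t}{2\nu}}\Big)-1.$$ $\dot W$ is a space-time white noise on $\mathbb{R}_+\times\mathbb{R}$ defined on a probability space $(\Omega,\mathcal F,P)$, with $(\mathcal F_t)$ its natural filtration augmented by the $P$-null sets and made right-continuous. Stochastic integrals are in the sense of Walsh. $\|\cdot\|_2$ is the $L^2(\Omega)$-norm, and $(f\star g)(t,x)=\int_0^t\mathrm{d}s\int_{\mathbb{R}}f(s,y)g(t-s,x-y)\,\mathrm{d}y$. Put $J_0(t,x)=\int_{\mathbb{R}}G_\nu(t,x-y)\mu(\mathrm{d}y)$ and $I(t,x)=\iint_{[0,t]\times\mathbb{R}}G_\nu(t-s,x-y)\rho(u(s,y))\dot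 W(\mathrm{d}s,\mathrm{d}y)$. A random field solution is $u=(u(t,x):(t,x)\in\mathbb{R}_+^*\times\mathbb{R})$ such that: (a) $u(t,x)$ is $\mathcal F_t$-measurable for all $(t,x)$; (b) $u$ is jointly measurable with respect to $\mathcal B(\mathbb{R}_+^*\times\mathbb{R})\times\mathcal F$; (c) $(G_\nu^2\star\|\rho(u)\|_2^2)(t,x)<+\infty$ for all $(t,x)\in\mathbb{R}_+^*\times\mathbb{R}$, and $(t,x)\mapsto I(t,x)$ is continuous from $\mathbb{R}_+^*\times\mathbb{R}$ into $L^2(\Omega)$; (d) for all $(t,x)\in\mathbb{R}_+^*\times\mathbb{R}$, $u(t,x)=J_0(t,x)+I(t,x)$ almost surely. Under the stated hypotheses it exists and is unique up to versions. *)

theory Defs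
  imports "HOL-Probability.Probability"
begin

definition heat_kernel :: "real \<Rightarrow> real \<Rightarrow> real \<Rightarrow> real" where
  "heat_kernel \<nu> t x =
     (if t > 0 then 1 / sqrt (2 * pi * \<nu> * t) * exp (- (\<bar>x\<bar>\<^sup>2 / (2 * \<nu> * t))) else 0)"

(* The interval integral is oriented, so the formula is also the right one for x < 0. *)
definition erfc :: "real \<Rightarrow> real" where
  "erfc x = 1 - 2 / sqrt pi * (LBINT y=0..x. exp (- y\<^sup>2))"

definition Phi :: "real \<Rightarrow> real" where
  "Phi x = (LBINT y:{..x}. exp (- (y\<^sup>2 / 2)) / sqrt (2 * pi))"

definition H_fun :: "real \<Rightarrow> real \<Rightarrow> real \<Rightarrow> real" where
  "H_fun \<nu> l t = 2 * exp (l ^ 4 * t / (4 * \<nu>)) * Phi (l\<^sup>2 * sqrt (t / (2 * \<nu>))) - 1"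

definition K_fun :: "real \<Rightarrow> real \<Rightarrow> real \<Rightarrow> real \<Rightarrow> real" where
  "K_fun \<nu> l t x = heat_kernel (\<nu> / 2) t x *
     (l\<^sup>2 / sqrt (4 * pi * \<nu> * t)
      + l ^ 4 / (2 * \<nu>) * exp (l ^ 4 * t / (4 * \<nu>)) * Phi (l\<^sup>2 * sqrt (t / (2 * \<nu>))))"

definition L2_norm_sq :: "'a measure \<Rightarrow> ('a \<Rightarrow> real) \<Rightarrow> ennreal" where
  "L2_norm_sq M X = (\<integral>\<^sup>+\<omega>. ennreal ((X \<omega>)\<^sup>2) \<partial>M)"

text \<open>The space-time convolution, for functions with values in \<open>[0, \<infinity>]\<close>.\<close>
definition st_conv ::
  "(real \<Rightarrow> real \<Rightarrow> ennreal) \<Rightarrow> (real \<Rightarrow> real \<Rightarrow> ennreal) \<Rightarrow> real \<Rightarrow> real \<Rightarrow> ennreal" where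
  "st_conv f g t x = (\<integral>\<^sup>+s\<in>{0..t}. (\<integral>\<^sup>+y. f s y * g (t - s) (x - y) \<partial>lborel) \<partial>lborel)"


subsection \<open>Space-time white noise\<close>

definition noise_sets :: "(real \<times> real) set set" where
  "noise_sets = {A \<in> sets borel. A \<subseteq> {0..} \<times> UNIV \<and> emeasure lborel A < \<infinity>}"

definition finite_measure_sets :: "real set set" where
  "finite_measure_sets = {A \<in> sets borel. emeasure lborel A < \<infinity>}"

text \<open>Centred Gaussian random variables; the degenerate one is included.\<close>
definition centred_gaussian :: "'a measure \<Rightarrow> ('a \<Rightarrow> real) \<Rightarrow> bool" where
  "centred_gaussian M X \<longleftrightarrow> X \<in> borel_measurable M \<and>
     ((AE \<omega> in M. X \<omega> = 0) \<or> (\<exists>s>0. distributed M lborel X (normal_density 0 s)))"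

text \<open>A space-time white noise is a centred Gaussian family (every finite linear combination is
  Gaussian), indexed by the Borel sets of finite measure, whose covariance is the Lebesgue
  measure of the intersection.\<close>
definition white_noise :: "'a measure \<Rightarrow> ((real \<times> real) set \<Rightarrow> 'a \<Rightarrow> real) \<Rightarrow> bool" where
  "white_noise M W \<longleftrightarrow>
     (\<forall>S c. finite S \<and> S \<subseteq> noise_sets \<longrightarrow> centred_gaussian M (\<lambda>\<omega>. \<Sum>A\<in>S. c A * W A \<omega>)) \<and>
     (\<forall>A\<in>noise_sets. \<forall>B\<in>noise_sets.
        integral\<^sup>L M (\<lambda>\<omega>. W A \<omega> * W B \<omega>) = measure lborel (A \<inter> B))"

text \<open>The martingale measure \<open>W\<^sub>t(A)\<close> associated with the noise.\<close>
definition noise_at :: "((real \<times> real) set \<Rightarrow> 'a \<Rightarrow> real) \<Rightarrow> real \<Rightarrow> real set \<Rightarrow> 'a \<Rightarrow> real" where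
  "noise_at W t A = W ({0..t} \<times> A)"

definition natural_filtration ::
  "'a measure \<Rightarrow> ((real \<times> real) set \<Rightarrow> 'a \<Rightarrow> real) \<Rightarrow> real \<Rightarrow> 'a measure" where
  "natural_filtration M W t = sigma (space M)
     ({noise_at W s A -` B \<inter> space M | s A B.
         0 \<le> s \<and> s \<le> t \<and> A \<in> finite_measure_sets \<and> B \<in> sets borel} \<union> null_sets M)"

(* The intersection is already a sigma-algebra; "sigma" only turns it into a measure space. *)
definition noise_filtration ::
  "'a measure \<Rightarrow> ((real \<times> real) set \<Rightarrow> 'a \<Rightarrow> real) \<Rightarrow> real \<Rightarrow> 'a measure" where
  "noise_filtration M W t = sigma (space M) (\<Inter>s\<in>{t<..}. sets (natural_filtration M W s))"


subsection \<open>The Walsh integral\<close>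

text \<open>A list of tuples \<open>(a, b, A, X)\<close> stands for the simple process that is the sum of
  the elementary processes \<open>X(\<omega>) 1\<^bsub>(a,b]\<^esub>(s) 1\<^bsub>A\<^esub>(y)\<close>.\<close>
type_synonym 'a simple_process = "(real \<times> real \<times> real set \<times> ('a \<Rightarrow> real)) list"

definition is_simple_process ::
  "'a measure \<Rightarrow> ((real \<times> real) set \<Rightarrow> 'a \<Rightarrow> real) \<Rightarrow> 'a simple_process \<Rightarrow> bool" where
  "is_simple_process M W p \<longleftrightarrow> (\<forall>(a, b, A, X)\<in>set p.
     0 \<le> a \<and> a < b \<and> A \<in> finite_measure_sets \<and>
     X \<in> borel_measurable (noise_filtration M W a) \<and> (\<exists>C. \<forall>\<omega>\<in>space M. \<bar>X \<omega>\<bar> \<le> C))"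

definition simple_value :: "'a simple_process \<Rightarrow> real \<Rightarrow> real \<Rightarrow> 'a \<Rightarrow> real" where
  "simple_value p s y \<omega> = (\<Sum>(a, b, A, X)\<leftarrow>p. X \<omega> * indicator {a<..b} s * indicator A y)"

definition simple_integral ::
  "((real \<times> real) set \<Rightarrow> 'a \<Rightarrow> real) \<Rightarrow> real \<Rightarrow> 'a simple_process \<Rightarrow> 'a \<Rightarrow> real" where
  "simple_integral W t p \<omega> =
     (\<Sum>(a, b, A, X)\<leftarrow>p. X \<omega> * (noise_at W (min t b) A \<omega> - noise_at W (min t a) A \<omega>))"

(* Random fields are only meaningful for positive times; the line s = 0 is Lebesgue null. *)
definition integrand_space :: "'a measure \<Rightarrow> real \<Rightarrow> ((real \<times> real) \<times> 'a) measure" where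
  "integrand_space M t = restrict_space lborel ({0<..t} \<times> UNIV) \<Otimes>\<^sub>M M"

text \<open>\<open>J\<close> is a version of the integral of \<open>f\<close> over \<open>[0,t] \<times> \<real>\<close>: the integrand is a limit of
  simple processes in \<open>L\<^sup>2([0,t] \<times> \<real> \<times> \<Omega>)\<close>, and \<open>J\<close> is the limit of their integrals in
  \<open>L\<^sup>2(\<Omega>)\<close>. By the isometry \<open>J\<close> is unique up to null sets.\<close>
definition has_walsh_integral ::
  "'a measure \<Rightarrow> ((real \<times> real) set \<Rightarrow> 'a \<Rightarrow> real) \<Rightarrow> real \<Rightarrow>
     (real \<Rightarrow> real \<Rightarrow> 'a \<Rightarrow> real) \<Rightarrow> ('a \<Rightarrow> real) \<Rightarrow> bool" where
  "has_walsh_integral M W t f J \<longleftrightarrow>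
     (\<lambda>((s, y), \<omega>). f s y \<omega>) \<in> borel_measurable (integrand_space M t) \<and>
     J \<in> borel_measurable M \<and>
     (\<exists>p. (\<forall>n::nat. is_simple_process M W (p n)) \<and>
       (\<lambda>n. L2_norm_sq (integrand_space M t)
              (\<lambda>((s, y), \<omega>). simple_value (p n) s y \<omega> - f s y \<omega>)) \<longlonglongrightarrow> 0 \<and>
       (\<lambda>n. L2_norm_sq M (\<lambda>\<omega>. simple_integral W t (p n) \<omega> - J \<omega>)) \<longlonglongrightarrow> 0)"


subsection \<open>Random field solutions of the stochastic heat equation\<close>

definition J0 :: "real \<Rightarrow> real measure \<Rightarrow> real \<Rightarrow> real \<Rightarrow> real" where
  "J0 \<nu> \<mu> t x = (LINT y|\<mu>. heat_kernel \<nu> t (x - y))"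

text \<open>Only the values \<open>u t x\<close> with \<open>t > 0\<close> matter. The field \<open>I\<close> is the stochastic integral
  of \<open>G(t - s, x - y) \<rho>(u(s,y))\<close>, which is defined up to versions; its existence is part of the
  meaning of the equation, and the other conditions do not depend on the version chosen.\<close>
definition random_field_solution ::
  "'a measure \<Rightarrow> ((real \<times> real) set \<Rightarrow> 'a \<Rightarrow> real) \<Rightarrow> real \<Rightarrow> (real \<Rightarrow> real) \<Rightarrow> real measure \<Rightarrow>
     (real \<Rightarrow> real \<Rightarrow> 'a \<Rightarrow> real) \<Rightarrow> bool" where
  "random_field_solution M W \<nu> \<rho> \<mu> u \<longleftrightarrow>
     (\<forall>t>0. \<forall>x. u t x \<in> borel_measurable (noise_filtration M W t)) \<and>
     (\<lambda>((t, x), \<omega>). u t x \<omega>) \<in>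
       borel_measurable (restrict_space borel ({0<..} \<times> UNIV) \<Otimes>\<^sub>M M) \<and>
     (\<forall>t>0. \<forall>x. st_conv (\<lambda>s y. ennreal ((heat_kernel \<nu> s y)\<^sup>2))
                         (\<lambda>s y. L2_norm_sq M (\<lambda>\<omega>. \<rho> (u s y \<omega>))) t x < \<infinity>) \<and>
     (\<exists>I. (\<forall>t>0. \<forall>x. has_walsh_integral M W t
               (\<lambda>s y \<omega>. heat_kernel \<nu> (t - s) (x - y) * \<rho> (u s y \<omega>)) (I t x)) \<and>
          (\<forall>t>0. \<forall>x. ((\<lambda>(t', x'). L2_norm_sq M (\<lambda>\<omega>. I t' x' \<omega> - I t x \<omega>)) \<longlongrightarrow> 0)
                         (at (t, x) within {0<..} \<times> UNIV)) \<and>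
          (\<forall>t>0. \<forall>x. AE \<omega> in M. u t x \<omega> = J0 \<nu> \<mu> t x + I t x \<omega>))"

end

theory Submission
  imports Defs
begin

text \<open>Let \<open>a = l\<^sup>2\<close> and write \<open>v(s,z) = E[u(s,z)\<^sup>2]\<close>. Because the stochastic integral has mean zero and the
Walsh isometry holds, the mild form of the equation gives
\<open>E[u(t,x) u(t,y)] = G(t,x) G(t,y) + a \<integral>\<integral> G(t-s,x-z) G(t-s,y-z) (\<sigma>\<^sup>2 + v(s,z)) dz ds\<close>, a closed linear
equation for \<open>v\<close> when \<open>x = y\<close>. Only \<open>\<rho>\<^sup>2\<close> enters, which is why a quadratic \<open>\<rho>\<^sup>2\<close> leads to an
explicit answer.

The space variable can be eliminated. A product of two heat kernels splits as
\<open>G\<^bsub>\<nu>\<^esub>(r,x) G\<^bsub>\<nu>\<^esub>(r,y) = G\<^bsub>\<nu>/2\<^esub>(r,(x+y)/2) G\<^bsub>2\<nu>\<^esub>(r,x-y)\<close> (\<open>heat_kernel_product\<close>). Fix \<open>T\<close> and \<open>X\<close>, and average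
\<open>\<sigma>\<^sup>2 + v(s,\<cdot>)\<close> against the backward kernel \<open>G\<^bsub>\<nu>/2\<^esub>(T-s,X-\<cdot>)\<close>; call the result \<open>w(s)\<close>
(\<open>kernel_average\<close>). By the semigroup property of \<open>G\<^bsub>\<nu>/2\<^esub>\<close> the equation for \<open>v\<close> becomes a scalar
Volterra equation on \<open>(0,T)\<close>, \<open>w = \<sigma>\<^sup>2 + (p/a) b + b * w\<close> with \<open>p = G\<^bsub>\<nu>/2\<^esub>(T,X)\<close> and the weakly
singular kernel \<open>b(t) = a G\<^bsub>2\<nu>\<^esub>(t,0)\<close>, and for \<open>X = (x+y)/2\<close> the covariance of the two stochastic
integrals at time \<open>T\<close> is \<open>(g * w)(T)\<close> with \<open>g(t) = a G\<^bsub>2\<nu>\<^esub>(t,x-y)\<close>.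

The Volterra equation is solved in closed form. The basic identity is that \<open>g * b\<close> is a multiple
\<open>\<kappa> = a\<^sup>2/(4\<nu>)\<close> of an \<open>erfc\<close> (\<open>conv_pulse_pulse\<close>); at \<open>x = y\<close> it says \<open>b * b = \<kappa>\<close>, so that one
iteration of the equation turns it into a linear integral equation with constant kernel, whose
integrable solutions are unique (\<open>linear_volterra_unique\<close>). The same uniqueness statement identifies
\<open>exp \<cdot> erfc\<close>, the function in the final formula, with a convolution against \<open>g\<close>
(\<open>erfc_exp_resolvent\<close>), and \<open>volterra_moment\<close> combines the two. The integrability of \<open>w\<close> on \<open>(0,T)\<close>
comes from the isometry as well, because \<open>(b * w)(T)\<close> is the second moment of the stochastic
integral at \<open>(T,X)\<close>.

The probabilistic input is the isometry, and it rests on the independence of the noise after time \<open>s\<close>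
from the augmented filtration up to time \<open>s\<close>. Independence from the generating variables comes from
the factorization of joint characteristic functions; since only the one-dimensional uniqueness
theorem for characteristic functions is used, the generating variables are converted one at a time from
exponentials to indicators (\<open>fourier_zero_imp_indicator_zero\<close>, \<open>cyl_fourier\<close>). Passing to the
right-continuous filtration costs a small delay of the increment, which is removed by an
\<open>L\<^sup>2\<close> limit.\<close>

section \<open>The complementary error function\<close>

lemma has_real_derivative_erfc:
  "(erfc has_real_derivative - (2 / sqrt pi * exp (- x\<^sup>2))) (at x)"
proof -
  let ?a = "- \<bar>x\<bar> - 1" and ?b = "\<bar>x\<bar> + 1"
  have "((\<lambda>u. LBINT y=0..u. exp (- y\<^sup>2)) has_vector_derivative exp (- x\<^sup>2))
     (at x within {?a..?b})"
    unfolding zero_ereal_def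
    by (rule interval_integral_FTC2) (auto intro!: continuous_intros)
  moreover have "at x within {?a..?b} = at x"
    by (rule at_within_interior) (auto simp: interior_cbox)
  ultimately have "((\<lambda>u. LBINT y=0..u. exp (- y\<^sup>2)) has_real_derivative exp (- x\<^sup>2)) (at x)"
    by (simp add: has_real_derivative_iff_has_vector_derivative)
  from DERIV_diff[OF DERIV_const[of 1] DERIV_cmult[OF this, of "2 / sqrt pi"]]
  show ?thesis unfolding erfc_def[abs_def] by simp
qed

lemma erfc_0 [simp]: "erfc 0 = 1"
  by (simp add: erfc_def zero_ereal_def[symmetric])

lemma erfc_minus: "erfc (- x) = 2 - erfc x"
proof -
  have "((\<lambda>x. erfc (- x) + erfc x) has_real_derivative 0) (at x)" for x
    by (auto intro!: derivative_eq_intros has_real_derivative_erfc[THEN DERIV_chain2])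
  then have "erfc (- x) + erfc x = erfc (- 0) + erfc 0"
    by (intro DERIV_isconst_all[where f="\<lambda>x. erfc (- x) + erfc x"]) simp
  then show ?thesis by simp
qed

lemma tendsto_erfc_at_top: "(erfc \<longlongrightarrow> 0) at_top"
proof -
  have si: "set_integrable lborel {0..} (\<lambda>x::real. exp (- x\<^sup>2))"
    and v: "(LBINT x:{0::real..}. exp (- x\<^sup>2)) = sqrt pi / 2"
    using gaussian_moment_0 by (auto simp: set_integrable_def set_lebesgue_integral_def has_bochner_integral_iff)
  have "((\<lambda>b::real. LBINT x:{0..b}. exp (- x\<^sup>2)) \<longlongrightarrow> (LBINT x:{0..}. exp (- x\<^sup>2))) at_top"
    using tendsto_set_lebesgue_integral_at_top[OF _ si] by simp
  moreover have "\<forall>\<^sub>F b::real in at_top. (LBINT x:{0..b}. exp (- x\<^sup>2)) = (LBINT x=0..b. exp (- x\<^sup>2))"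
    using eventually_ge_at_top[of "0::real"]
    by eventually_elim (auto simp: interval_integral_Icc zero_ereal_def)
  ultimately have "((\<lambda>b::real. LBINT x=0..b. exp (- x\<^sup>2)) \<longlongrightarrow> sqrt pi / 2) at_top"
    unfolding v by (rule Lim_transform_eventually)
  then have "((\<lambda>b::real. 1 - 2 / sqrt pi * (LBINT x=0..b. exp (- x\<^sup>2))) \<longlongrightarrow> 1 - 2 / sqrt pi * (sqrt pi / 2)) at_top"
    by (intro tendsto_intros)
  then show ?thesis by (simp add: erfc_def[abs_def])
qed

lemma isCont_erfc: "isCont erfc x"
  using has_real_derivative_erfc DERIV_isCont by blast

lemma borel_measurable_erfc [measurable]: "erfc \<in> borel_measurable borel"
  by (intro borel_measurable_continuous_onI continuous_at_imp_continuous_on ballI isCont_erfc)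

lemma erfc_antimono: "x \<le> y \<Longrightarrow> erfc y \<le> erfc x"
  by (rule DERIV_nonpos_imp_nonincreasing) (auto intro!: exI has_real_derivative_erfc)

lemma erfc_nonneg [simp]: "0 \<le> erfc x"
proof (rule tendsto_upperbound[OF tendsto_erfc_at_top])
  show "\<forall>\<^sub>F y in at_top. erfc y \<le> erfc x"
    using eventually_ge_at_top[of x] by eventually_elim (rule erfc_antimono)
qed simp

lemma erfc_le_2: "erfc x \<le> 2"
  using erfc_minus[of "-x"] erfc_nonneg[of "-x"] by simp

text \<open>The improper fundamental theorem of calculus for nonnegative integrands: the integrands below are
singular at one or both end points of a bounded interval, so only limits of the antiderivative exist.\<close>

lemma nn_integral_FTC_Ioo:
  fixes f F :: "real \<Rightarrow> real"
  assumes "a < b"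
    and F: "\<And>x. a < x \<Longrightarrow> x < b \<Longrightarrow> (F has_real_derivative f x) (at x)"
    and f: "\<And>x. a < x \<Longrightarrow> x < b \<Longrightarrow> isCont f x"
    and nonneg: "\<And>x. a < x \<Longrightarrow> x < b \<Longrightarrow> 0 \<le> f x"
    and A: "(F \<longlongrightarrow> A) (at_right a)" and B: "(F \<longlongrightarrow> B) (at_left b)"
  shows "(\<integral>\<^sup>+x. ennreal (f x) * indicator {a<..<b} x \<partial>lborel) = ennreal (B - A)" and "A \<le> B"
proof -
  have *: "set_integrable lborel (einterval a b) f" "(LBINT x=a..b. f x) = B - A"
    by (rule interval_integral_FTC_nonneg[where F=F];
        use assms in \<open>auto simp: ereal_tendsto_simps\<close>)+
  have "(\<integral>\<^sup>+x. ennreal (f x) * indicator {a<..<b} x \<partial>lborel) =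
      (\<integral>\<^sup>+x. ennreal (indicator {a<..<b} x *\<^sub>R f x) \<partial>lborel)"
    by (intro nn_integral_cong) (auto simp: indicator_def)
  also have "\<dots> = ennreal (LBINT x:{a<..<b}. f x)"
    unfolding set_lebesgue_integral_def
    by (rule nn_integral_eq_integral) (use *(1) nonneg in \<open>auto simp: set_integrable_def indicator_def\<close>)
  also have "(LBINT x:{a<..<b}. f x) = B - A"
    using *(2) \<open>a < b\<close> by (simp add: interval_lebesgue_integral_def)
  finally show "(\<integral>\<^sup>+x. ennreal (f x) * indicator {a<..<b} x \<partial>lborel) = ennreal (B - A)" .
  have "0 \<le> (LBINT x:{a<..<b}. f x)"
    unfolding set_lebesgue_integral_def
    by (rule Bochner_Integration.integral_nonneg) (use nonneg in \<open>auto simp: indicator_def\<close>)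
  with \<open>(LBINT x:{a<..<b}. f x) = B - A\<close> show "A \<le> B" by simp
qed

text \<open>Both sides have the same derivative and tend to \<open>0\<close> at \<open>-\<infinity>\<close>.\<close>

lemma Phi_eq_erfc: "Phi x = erfc (- (x / sqrt 2)) / 2"
proof -
  let ?f = "\<lambda>y::real. exp (- (y\<^sup>2 / 2)) / sqrt (2 * pi)"
  let ?F = "\<lambda>y. erfc (- (y / sqrt 2)) / 2"
  have D: "(?F has_real_derivative ?f y) (at y)" for y
    by (auto intro!: derivative_eq_intros has_real_derivative_erfc[THEN DERIV_chain2]
        simp: power_divide real_sqrt_mult field_simps)
  have "(LBINT y=-\<infinity>..x. ?f y) = ?F x - 0"
  proof (rule interval_integral_FTC_nonneg(2)[where F="?F"])
    have "filterlim (\<lambda>y::real. - (y / sqrt 2)) at_top at_bot"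
      by (auto simp: filterlim_uminus_at_bot filterlim_at_bot_mirror
          intro!: filterlim_tendsto_pos_mult_at_top[OF tendsto_const, of "1 / sqrt 2", simplified] filterlim_ident)
    from filterlim_compose[OF tendsto_erfc_at_top this]
    show "((?F \<circ> real_of_ereal) \<longlongrightarrow> 0) (at_right (-\<infinity>))"
      by (auto simp: ereal_tendsto_simps intro!: tendsto_eq_intros)
    show "((?F \<circ> real_of_ereal) \<longlongrightarrow> ?F x) (at_left (ereal x))"
      using D[THEN DERIV_isCont, of x] unfolding ereal_tendsto_simps isCont_def
      by (rule filterlim_mono) (auto simp: at_le)
  qed (use D in \<open>auto intro!: continuous_intros\<close>)
  moreover have "(LBINT y=-\<infinity>..x. ?f y) = (LBINT y:{..x}. ?f y)"
  proof -
    have "AE y in lborel. indicator {..<x} y *\<^sub>R ?f y = indicator {..x} y *\<^sub>R ?f y"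
      using AE_lborel_singleton[of x] by eventually_elim (auto simp: indicator_def)
    then have "(LBINT y:{..<x}. ?f y) = (LBINT y:{..x}. ?f y)"
      unfolding set_lebesgue_integral_def by (intro integral_cong_AE) auto
    moreover have "einterval (-\<infinity>) (ereal x) = {..<x}"
      by (auto simp: einterval_def)
    ultimately show ?thesis
      by (simp add: interval_lebesgue_integral_def)
  qed
  ultimately show ?thesis by (simp add: Phi_def)
qed


section \<open>Convolution in time and a linear Volterra equation\<close>

text \<open>Convolution over the whole line. A function of time is extended by \<open>0\<close> to \<open>t \<le> 0\<close>, and the integral is
then the usual one over \<open>(0,t)\<close>, while associativity and commutativity hold without
restriction on supports. Convolution with \<open>indicator {0<..}\<close> is integration from \<open>0\<close>.\<close>

definition conv :: "(real \<Rightarrow> ennreal) \<Rightarrow> (real \<Rightarrow> ennreal) \<Rightarrow> real \<Rightarrow> ennreal" where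
  "conv f g t = (\<integral>\<^sup>+s. f (t - s) * g s \<partial>lborel)"

lemma borel_measurable_conv [measurable]:
  assumes [measurable]: "f \<in> borel_measurable borel" "g \<in> borel_measurable borel"
  shows "conv f g \<in> borel_measurable borel"
  unfolding conv_def[abs_def] by measurable

lemma conv_commute:
  assumes [measurable]: "f \<in> borel_measurable borel" "g \<in> borel_measurable borel"
  shows "conv f g = conv g f"
proof
  fix t
  have "conv f g t = (\<integral>\<^sup>+s. f (t - (t + (-1) * s)) * g (t + (-1) * s) \<partial>lborel)"
    unfolding conv_def by (subst nn_integral_real_affine[where c="-1" and t=t]) auto
  then show "conv f g t = conv g f t" by (simp add: conv_def mult.commute)
qed

lemma conv_assoc:
  assumes [measurable]: "f \<in> borel_measurable borel" "g \<in> borel_measurable borel"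
    "h \<in> borel_measurable borel"
  shows "conv (conv f g) h = conv f (conv g h)"
proof
  fix t
  have "conv (conv f g) h t = (\<integral>\<^sup>+s. \<integral>\<^sup>+r. f (t - s - r) * g r * h s \<partial>lborel \<partial>lborel)"
    unfolding conv_def by (simp add: nn_integral_multc)
  also have "\<dots> = (\<integral>\<^sup>+s. \<integral>\<^sup>+r. f (t - r) * g (r - s) * h s \<partial>lborel \<partial>lborel)"
  proof (rule nn_integral_cong)
    fix s
    show "(\<integral>\<^sup>+r. f (t - s - r) * g r * h s \<partial>lborel) = (\<integral>\<^sup>+r. f (t - r) * g (r - s) * h s \<partial>lborel)"
      by (subst nn_integral_real_affine[where c=1 and t="-s"]) (auto simp: algebra_simps)
  qed
  also have "\<dots> = (\<integral>\<^sup>+r. \<integral>\<^sup>+s. f (t - r) * g (r - s) * h s \<partial>lborel \<partial>lborel)"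
    by (rule lborel_pair.Fubini') measurable
  also have "\<dots> = conv f (conv g h) t"
    unfolding conv_def by (simp add: nn_integral_cmult mult.assoc)
  finally show "conv (conv f g) h t = conv f (conv g h) t" .
qed

lemma conv_add_right:
  assumes [measurable]: "f \<in> borel_measurable borel" "g \<in> borel_measurable borel"
    "h \<in> borel_measurable borel"
  shows "conv f (\<lambda>s. g s + h s) t = conv f g t + conv f h t"
  unfolding conv_def by (simp add: distrib_left nn_integral_add)

lemma conv_cmult_right:
  assumes [measurable]: "f \<in> borel_measurable borel" "g \<in> borel_measurable borel"
  shows "conv f (\<lambda>s. c * g s) t = c * conv f g t"
  unfolding conv_def by (subst nn_integral_cmult[symmetric]) (auto simp: ac_simps)

lemma conv_nonpos:
  assumes "\<And>s. s \<le> 0 \<Longrightarrow> f s = 0" "\<And>s. s \<le> 0 \<Longrightarrow> g s = 0" "t \<le> 0"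
  shows "conv f g t = 0"
proof -
  have "f (t - s) * g s = 0" for s
    using assms by (cases "s \<le> 0") auto
  then show ?thesis unfolding conv_def by (simp only: nn_integral_const mult_zero_left)
qed

lemma nn_integral_power_Ioo:
  assumes "0 < t" "0 \<le> B"
  shows "(\<integral>\<^sup>+s. ennreal (B * s ^ n) * indicator {0<..<t} s \<partial>lborel) = ennreal (B * t ^ Suc n / Suc n)"
proof -
  have "(\<integral>\<^sup>+s. ennreal (B * s ^ n) * indicator {0<..<t} s \<partial>lborel)
      = ennreal (B * t ^ Suc n / Suc n - 0)"
    using assms
    by (intro nn_integral_FTC_Ioo(1)[where F="\<lambda>s. B * s ^ Suc n / Suc n"])
      (auto intro!: derivative_eq_intros tendsto_eq_intros simp del: power_Suc)
  then show ?thesis by simp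
qed

text \<open>Gronwall's argument, in a form that allows the forcing term \<open>c\<close> to be infinite at some points. With
\<open>D(t)\<close> the difference of the integrals of \<open>f\<close> and \<open>g\<close> over \<open>(0,t)\<close>, the equations give
\<open>\<bar>D(t)\<bar> \<le> k \<integral>\<^sub>0\<^sup>t \<bar>D\<bar>\<close>, and iterating a constant bound \<open>B\<close> gives \<open>\<bar>D(t)\<bar> \<le> B (k t)\<^sup>n / n!\<close>.\<close>

lemma linear_volterra_unique:
  fixes f g c :: "real \<Rightarrow> ennreal" and k :: real
  assumes [measurable]: "f \<in> borel_measurable borel" "g \<in> borel_measurable borel"
    and k: "0 \<le> k"
    and f: "\<And>t. 0 < t \<Longrightarrow> t < T \<Longrightarrow> f t = c t + ennreal k * (\<integral>\<^sup>+s\<in>{0<..<t}. f s \<partial>lborel)"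
    and g: "\<And>t. 0 < t \<Longrightarrow> t < T \<Longrightarrow> g t = c t + ennreal k * (\<integral>\<^sup>+s\<in>{0<..<t}. g s \<partial>lborel)"
    and fT: "(\<integral>\<^sup>+s\<in>{0<..<T}. f s \<partial>lborel) < \<infinity>" and gT: "(\<integral>\<^sup>+s\<in>{0<..<T}. g s \<partial>lborel) < \<infinity>"
    and t: "0 < t" "t < T"
  shows "f t = g t"
proof -
  define P where "P f t = (\<integral>\<^sup>+s\<in>{0<..<t}. f s \<partial>lborel)" for f :: "real \<Rightarrow> ennreal" and t
  have P_mono: "P u s \<le> P u T" if "s < T" for u s
    unfolding P_def using that by (intro nn_integral_mono) (auto simp: indicator_def)
  have Pf: "P f s < \<infinity>" "P g s < \<infinity>" if "s < T" for s
    using P_mono[OF that, of f] P_mono[OF that, of g] fT gT unfolding P_def by auto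
  define D where "D s = enn2real (P f s) - enn2real (P g s)" for s
  \<comment> \<open>where \<open>c\<close> is infinite, both real parts are \<open>0\<close> by convention\<close>
  have fg: "\<bar>enn2real (f s) - enn2real (g s)\<bar> \<le> k * \<bar>D s\<bar>" if s: "0 < s" "s < T" for s
  proof (cases "c s = \<infinity>")
    case True
    then have "f s = \<infinity>" "g s = \<infinity>" using f[OF s] g[OF s] by auto
    then show ?thesis using k by simp
  next
    case False
    have "enn2real (f s) = enn2real (c s) + k * enn2real (P f s)"
      using f[OF s] Pf[OF s(2)] False k unfolding P_def[symmetric]
      by (simp add: enn2real_plus less_top ennreal_mult_less_top enn2real_mult)
    moreover have "enn2real (g s) = enn2real (c s) + k * enn2real (P g s)"
      using g[OF s] Pf[OF s(2)] False k unfolding P_def[symmetric]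
      by (simp add: enn2real_plus less_top ennreal_mult_less_top enn2real_mult)
    ultimately have "enn2real (f s) - enn2real (g s) = k * D s"
      by (simp add: D_def algebra_simps)
    then show ?thesis using k by (simp add: abs_mult)
  qed
  have int: "integrable lborel (\<lambda>s. enn2real (u s * indicator {0<..<s'} s))"
      "integral\<^sup>L lborel (\<lambda>s. enn2real (u s * indicator {0<..<s'} s)) = enn2real (P u s')"
    if [measurable]: "u \<in> borel_measurable borel" and "P u s' < \<infinity>" for u s'
  proof -
    have "AE s in lborel. u s * indicator {0<..<s'} s \<noteq> \<infinity>"
      using that(2) unfolding P_def by (intro nn_integral_PInf_AE) auto
    then have eq: "(\<integral>\<^sup>+s. ennreal (enn2real (u s * indicator {0<..<s'} s)) \<partial>lborel) = P u s'"
      unfolding P_def by (intro nn_integral_cong_AE) (auto simp: less_top)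
    show "integrable lborel (\<lambda>s. enn2real (u s * indicator {0<..<s'} s))"
      using that eq by (intro integrableI_nonneg) auto
    show "integral\<^sup>L lborel (\<lambda>s. enn2real (u s * indicator {0<..<s'} s)) = enn2real (P u s')"
      using eq by (subst integral_eq_nn_integral) auto
  qed
  have step: "ennreal \<bar>D s'\<bar> \<le> (\<integral>\<^sup>+s\<in>{0<..<s'}. ennreal (k * \<bar>D s\<bar>) \<partial>lborel)"
    if s': "0 < s'" "s' < T" for s'
  proof -
    have "D s' = integral\<^sup>L lborel (\<lambda>s. enn2real (f s * indicator {0<..<s'} s) - enn2real (g s * indicator {0<..<s'} s))"
      unfolding D_def using int[of f s'] int[of g s'] Pf[OF s'(2)]
      by simp
    then have "ennreal \<bar>D s'\<bar> = ennreal (norm (integral\<^sup>L lborel (\<lambda>s. enn2real (f s * indicator {0<..<s'} s) - enn2real (g s * indicator {0<..<s'} s))))"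
      by simp
    also have "\<dots> \<le> (\<integral>\<^sup>+s. norm (enn2real (f s * indicator {0<..<s'} s) - enn2real (g s * indicator {0<..<s'} s)) \<partial>lborel)"
      using int[of f s'] int[of g s'] Pf[OF s'(2)] by (intro integral_norm_bound_ennreal) auto
    also have "\<dots> \<le> (\<integral>\<^sup>+s\<in>{0<..<s'}. ennreal (k * \<bar>D s\<bar>) \<partial>lborel)"
      using fg s' by (intro nn_integral_mono) (auto simp: indicator_def intro!: ennreal_leI)
    finally show ?thesis .
  qed
  define B where "B = enn2real (P f T) + enn2real (P g T)"
  have B0: "0 \<le> B" by (simp add: B_def)
  have bound: "\<bar>D s\<bar> \<le> B * k ^ n / fact n * s ^ n" if "0 < s" "s < T" for s n
    using that
  proof (induction n arbitrary: s)
    case 0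
    have "enn2real (P f s) \<le> enn2real (P f T)" "enn2real (P g s) \<le> enn2real (P g T)"
      using 0 P_mono fT gT unfolding P_def[symmetric] by (auto intro!: enn2real_mono)
    then show ?case using enn2real_nonneg[of "P f s"] enn2real_nonneg[of "P g s"]
      by (simp add: D_def B_def abs_le_iff del: enn2real_nonneg)
  next
    case (Suc n)
    have "ennreal \<bar>D s\<bar> \<le> (\<integral>\<^sup>+r\<in>{0<..<s}. ennreal (k * \<bar>D r\<bar>) \<partial>lborel)"
      using step Suc.prems .
    also have "\<dots> \<le> (\<integral>\<^sup>+r\<in>{0<..<s}. ennreal ((B * k ^ Suc n / fact n) * r ^ n) \<partial>lborel)"
    proof (rule nn_integral_mono)
      fix r
      show "ennreal (k * \<bar>D r\<bar>) * indicator {0<..<s} r \<le> ennreal ((B * k ^ Suc n / fact n) * r ^ n) * indicator {0<..<s} r"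
      proof (cases "r \<in> {0<..<s}")
        case True
        then have "k * \<bar>D r\<bar> \<le> k * (B * k ^ n / fact n * r ^ n)"
          using k Suc.prems by (intro mult_left_mono Suc.IH) auto
        then show ?thesis using True by (auto intro!: ennreal_leI simp: ac_simps)
      qed auto
    qed
    also have "\<dots> = ennreal ((B * k ^ Suc n / fact n) * s ^ Suc n / Suc n)"
      using Suc.prems B0 k by (intro nn_integral_power_Ioo) auto
    also have "(B * k ^ Suc n / fact n) * s ^ Suc n / Suc n = B * k ^ Suc n / fact (Suc n) * s ^ Suc n"
      by (simp add: field_simps)
    finally show ?case using B0 k Suc.prems by (subst (asm) ennreal_le_iff) auto
  qed
  have "(\<lambda>n. B * ((k * t) ^ n / fact n)) \<longlonglongrightarrow> B * 0"
    by (intro tendsto_intros) (use summable_LIMSEQ_zero[OF summable_exp[of "k * t"]] in \<open>simp add: field_simps\<close>)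
  then have "\<bar>D t\<bar> \<le> 0"
    using bound[OF t] by (intro tendsto_lowerbound[of "\<lambda>n. B * ((k * t) ^ n / fact n)"])
      (auto simp: field_simps power_mult_distrib)
  then have "ennreal (enn2real (P f t)) = ennreal (enn2real (P g t))"
    by (simp add: D_def)
  then have "P f t = P g t"
    using Pf[OF t(2)] by (metis ennreal_enn2real infinity_ennreal_def)
  then show ?thesis using f[OF t] g[OF t] by (simp add: P_def)
qed

lemma conv_step:
  assumes "\<And>s. s \<le> 0 \<Longrightarrow> f s = 0"
  shows "conv (indicator {0<..}) f t = (\<integral>\<^sup>+s\<in>{0<..<t}. f s \<partial>lborel)"
  unfolding conv_def
proof (rule nn_integral_cong)
  fix s
  show "indicator {0<..} (t - s) * f s = f s * indicator {0<..<t} s"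
    using assms[of s] by (cases "s \<le> 0") (auto simp: indicator_def)
qed


section \<open>The heat kernel\<close>

lemma heat_kernel_nonneg [simp]: "0 < \<nu> \<Longrightarrow> 0 \<le> heat_kernel \<nu> t x"
  by (simp add: heat_kernel_def)

lemma heat_kernel_nonpos_time [simp]: "t \<le> 0 \<Longrightarrow> heat_kernel \<nu> t x = 0"
  by (simp add: heat_kernel_def)

lemma borel_measurable_heat_kernel [measurable (raw)]:
  assumes [measurable]: "f \<in> borel_measurable M" "g \<in> borel_measurable M"
  shows "(\<lambda>x. heat_kernel \<nu> (f x) (g x)) \<in> borel_measurable M"
  unfolding heat_kernel_def by measurable

lemma heat_kernel_abs: "heat_kernel \<nu> t \<bar>x\<bar> = heat_kernel \<nu> t x"
  by (simp add: heat_kernel_def)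

lemma heat_kernel_eq_normal_density:
  assumes "0 < \<nu>" "0 < t"
  shows "heat_kernel \<nu> t x = normal_density 0 (sqrt (\<nu> * t)) x"
  using assms by (simp add: heat_kernel_def normal_density_def mult.assoc)

text \<open>The kernel of the difference variable, written so that the time dependence \<open>r\<^sup>-\<^sup>1\<^sup>/\<^sup>2 exp(- c\<^sup>2/r)\<close> with
\<open>c = x / (2 sqrt \<nu>)\<close> is visible.\<close>

lemma heat_kernel_double:
  assumes "0 < \<nu>" "0 < r"
  shows "heat_kernel (2 * \<nu>) r x = 1 / (2 * sqrt pi * sqrt \<nu>) / sqrt r * exp (- (x / (2 * sqrt \<nu>))\<^sup>2 / r)"
proof -
  have "2 * pi * (2 * \<nu>) * r = 2\<^sup>2 * (pi * (\<nu> * r))" by simp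
  then have "sqrt (2 * pi * (2 * \<nu>) * r) = 2 * (sqrt pi * (sqrt \<nu> * sqrt r))"
    by (simp only: real_sqrt_mult real_sqrt_abs abs_numeral)
  moreover have "(x / (2 * sqrt \<nu>))\<^sup>2 / r = \<bar>x\<bar>\<^sup>2 / (2 * (2 * \<nu>) * r)"
    using assms by (simp add: power_divide power_mult_distrib)
  ultimately show ?thesis
    using assms by (simp add: heat_kernel_def)
qed

text \<open>The map \<open>(x, y) \<mapsto> ((x+y)/2, x-y)\<close> diagonalizes the quadratic form: the midpoint diffuses with
half the variance and the difference with twice the variance.\<close>

lemma heat_kernel_product:
  assumes \<nu>: "0 < \<nu>"
  shows "heat_kernel \<nu> t x * heat_kernel \<nu> t y = heat_kernel (\<nu> / 2) t ((x + y) / 2) * heat_kernel (2 * \<nu>) t (x - y)"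
proof (cases "0 < t")
  case True
  have sq: "sqrt (2 * pi * \<nu> * t) * sqrt (2 * pi * \<nu> * t) = sqrt (2 * pi * (\<nu> / 2) * t) * sqrt (2 * pi * (2 * \<nu>) * t)"
    unfolding real_sqrt_mult[symmetric] by (rule arg_cong[where f=sqrt]) simp
  have "x\<^sup>2 / (2 * \<nu> * t) + y\<^sup>2 / (2 * \<nu> * t) = ((x + y) / 2)\<^sup>2 / (2 * (\<nu> / 2) * t) + (x - y)\<^sup>2 / (2 * (2 * \<nu>) * t)"
  proof -
    have "((x + y) / 2)\<^sup>2 / (2 * (\<nu> / 2) * t) + (x - y)\<^sup>2 / (2 * (2 * \<nu>) * t) = ((x + y)\<^sup>2 + (x - y)\<^sup>2) / (4 * \<nu> * t)"
    proof -
      have "((x + y) / 2)\<^sup>2 = (x + y)\<^sup>2 / 4" unfolding power_divide by simp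
      then show ?thesis by (simp only:) (simp add: add_divide_distrib)
    qed
    also have "(x + y)\<^sup>2 + (x - y)\<^sup>2 = 2 * (x\<^sup>2 + y\<^sup>2)" by (simp add: power2_sum power2_diff)
    finally show ?thesis using \<nu> True by (simp add: add_divide_distrib)
  qed
  then have ex: "exp (- (x\<^sup>2 / (2 * \<nu> * t))) * exp (- (y\<^sup>2 / (2 * \<nu> * t))) =
      exp (- (((x + y) / 2)\<^sup>2 / (2 * (\<nu> / 2) * t))) * exp (- ((x - y)\<^sup>2 / (2 * (2 * \<nu>) * t)))"
    unfolding exp_add[symmetric] by simp
  have "heat_kernel \<nu> t x * heat_kernel \<nu> t y = 1 / (sqrt (2 * pi * \<nu> * t) * sqrt (2 * pi * \<nu> * t)) *
      (exp (- (x\<^sup>2 / (2 * \<nu> * t))) * exp (- (y\<^sup>2 / (2 * \<nu> * t))))"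
    unfolding heat_kernel_def power2_abs using True by simp
  also have "\<dots> = heat_kernel (\<nu> / 2) t ((x + y) / 2) * heat_kernel (2 * \<nu>) t (x - y)"
    unfolding ex sq heat_kernel_def power2_abs using True by simp
  finally show ?thesis .
qed simp

lemma heat_kernel_semigroup:
  assumes \<nu>: "0 < \<nu>" and t: "0 < t" and s: "0 < s"
  shows "(\<integral>\<^sup>+z. ennreal (heat_kernel \<nu> t (x - z)) * ennreal (heat_kernel \<nu> s (z - y)) \<partial>lborel) =
    ennreal (heat_kernel \<nu> (t + s) (x - y))"
proof -
  have "(\<integral>\<^sup>+z. ennreal (heat_kernel \<nu> t (x - z)) * ennreal (heat_kernel \<nu> s (z - y)) \<partial>lborel) =
    (\<integral>\<^sup>+z. ennreal (heat_kernel \<nu> t ((x - y) - z)) * ennreal (heat_kernel \<nu> s z) \<partial>lborel)"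
    by (subst nn_integral_real_affine[where c=1 and t=y]) (auto simp: algebra_simps)
  also have "\<dots> = (\<integral>\<^sup>+z. ennreal (normal_density 0 (sqrt (\<nu> * t)) ((x - y) - z) * normal_density 0 (sqrt (\<nu> * s)) z) \<partial>lborel)"
    using assms by (simp add: heat_kernel_eq_normal_density ennreal_mult)
  also have "\<dots> = ennreal (normal_density 0 (sqrt ((sqrt (\<nu> * t))\<^sup>2 + (sqrt (\<nu> * s))\<^sup>2)) (x - y))"
    using conv_normal_density_zero_mean[of "sqrt (\<nu> * t)" "sqrt (\<nu> * s)", THEN fun_cong, of "x - y"] assms by simp
  also have "sqrt ((sqrt (\<nu> * t))\<^sup>2 + (sqrt (\<nu> * s))\<^sup>2) = sqrt (\<nu> * (t + s))"
    using assms by (simp add: distrib_left)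
  finally show ?thesis using assms by (simp add: heat_kernel_eq_normal_density)
qed

lemma heat_kernel_mass:
  assumes \<nu>: "0 < \<nu>" and t: "0 < t"
  shows "(\<integral>\<^sup>+z. ennreal (heat_kernel \<nu> t (x - z)) \<partial>lborel) = 1"
proof -
  have pos: "0 < sqrt (\<nu> * t)" using assms by simp
  have "(\<integral>\<^sup>+z. ennreal (heat_kernel \<nu> t (x - z)) \<partial>lborel) = (\<integral>\<^sup>+z. ennreal (heat_kernel \<nu> t z) \<partial>lborel)"
    by (subst nn_integral_real_affine[where c="-1" and t=x]) auto
  also have "\<dots> = ennreal (\<integral>z. normal_density 0 (sqrt (\<nu> * t)) z \<partial>lborel)"
    using assms by (simp add: heat_kernel_eq_normal_density nn_integral_eq_integral[OF integrable_normal_density[OF pos]])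
  also have "\<dots> = 1" using integral_normal_density[OF pos] by simp
  finally show ?thesis .
qed

lemma J0_dirac: "J0 \<nu> (return borel 0) t x = heat_kernel \<nu> t x"
  unfolding J0_def by (subst integral_return) auto


section \<open>The resolvent of the heat kernel on the diagonal\<close>

text \<open>In the variable \<open>y = z sqrt (1/r - 1/t)\<close>, which runs from \<open>\<infinity>\<close> to \<open>0\<close> as \<open>r\<close> runs from \<open>0\<close> to \<open>t\<close>, the integrand
becomes a multiple of \<open>exp(- y\<^sup>2)\<close>. An antiderivative is therefore a multiple of \<open>erfc y\<close>.\<close>

lemma nn_integral_gaussian_inverse_time:
  assumes t: "0 < t" and z: "0 < z"
  shows "(\<integral>\<^sup>+r\<in>{0<..<t}. ennreal (2 * z / r * exp (- z\<^sup>2 / r) / sqrt (r * (t - r))) \<partial>lborel)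
    = ennreal (2 * sqrt pi / sqrt t * exp (- z\<^sup>2 / t))"
proof -
  let ?C = "2 * sqrt pi / sqrt t * exp (- z\<^sup>2 / t)"
  let ?y = "\<lambda>r. z * sqrt (1 / r - 1 / t)"
  let ?F = "\<lambda>r. ?C * erfc (?y r)"
  have "(\<integral>\<^sup>+r\<in>{0<..<t}. ennreal (2 * z / r * exp (- z\<^sup>2 / r) / sqrt (r * (t - r))) \<partial>lborel)
    = ennreal (?C - 0)"
  proof (rule nn_integral_FTC_Ioo(1)[where F = ?F])
    fix r assume r: "0 < r" "r < t"
    have pos: "0 < 1 / r - 1 / t" using r t by (simp add: field_simps)
    have "(?F has_real_derivative ?C * (- (2 / sqrt pi * exp (- (?y r)\<^sup>2)) *
        (z * (- 1 / r\<^sup>2 * (inverse (sqrt (1 / r - 1 / t)) / 2))))) (at r)"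
      using pos r
      by (auto intro!: derivative_eq_intros has_real_derivative_erfc[THEN DERIV_chain2]
          simp: power2_eq_square field_simps)
    also have "(?y r)\<^sup>2 = z\<^sup>2 / r - z\<^sup>2 / t"
      using pos by (simp add: power_mult_distrib algebra_simps)
    also have "sqrt (1 / r - 1 / t) = sqrt (r * (t - r)) / (r * sqrt t)"
    proof -
      have "1 / r - 1 / t = (r * (t - r)) / (r\<^sup>2 * t)"
        using r t by (simp add: field_simps power2_eq_square)
      then show ?thesis using r by (simp add: real_sqrt_mult real_sqrt_divide)
    qed
    also have "?C * (- (2 / sqrt pi * exp (- (z\<^sup>2 / r - z\<^sup>2 / t))) *
        (z * (- 1 / r\<^sup>2 * (inverse (sqrt (r * (t - r)) / (r * sqrt t)) / 2))))
      = 2 * z / r * (exp (- z\<^sup>2 / t) * exp (- (z\<^sup>2 / r - z\<^sup>2 / t))) / sqrt (r * (t - r))"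
      using r t by (simp add: field_simps power2_eq_square)
    also have "exp (- z\<^sup>2 / t) * exp (- (z\<^sup>2 / r - z\<^sup>2 / t)) = exp (- z\<^sup>2 / r)"
      by (simp add: exp_add[symmetric])
    finally show "(?F has_real_derivative 2 * z / r * exp (- z\<^sup>2 / r) / sqrt (r * (t - r))) (at r)" .
    show "isCont (\<lambda>r. 2 * z / r * exp (- z\<^sup>2 / r) / sqrt (r * (t - r))) r"
      using r by (auto intro!: continuous_intros)
    show "0 \<le> 2 * z / r * exp (- z\<^sup>2 / r) / sqrt (r * (t - r))"
      using r z by simp
  next
    have "filterlim (\<lambda>r::real. 1 / r - 1 / t) at_top (at_right 0)"
      using filterlim_tendsto_add_at_top[OF tendsto_const[of "- 1 / t"] filterlim_inverse_at_top_right]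
      by (simp add: field_simps inverse_eq_divide)
    then have "filterlim (\<lambda>r. sqrt (1 / r - 1 / t)) at_top (at_right 0)"
      by (rule filterlim_compose[OF sqrt_at_top])
    then have "filterlim ?y at_top (at_right 0)"
      by (rule filterlim_tendsto_pos_mult_at_top[OF tendsto_const z])
    then have "((\<lambda>r. erfc (?y r)) \<longlongrightarrow> 0) (at_right 0)"
      by (rule filterlim_compose[OF tendsto_erfc_at_top])
    then show "(?F \<longlongrightarrow> 0) (at_right 0)"
      using t by (auto intro!: tendsto_eq_intros)
    have "((\<lambda>r. erfc (?y r)) \<longlongrightarrow> erfc (?y t)) (at_left t)"
      using t by (intro isCont_tendsto_compose[OF isCont_erfc] tendsto_intros) auto
    then show "(?F \<longlongrightarrow> ?C) (at_left t)"
      using t by (auto intro!: tendsto_eq_intros)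
  qed (use t in auto)
  then show ?thesis by simp
qed

text \<open>Write \<open>exp(- c\<^sup>2/r)\<close> as the tail integral of \<open>(2 z / r) exp(- z\<^sup>2/r)\<close> over \<open>z \<ge> c\<close> and exchange the
integrals. The inner integral over \<open>r\<close> is the previous lemma, and what remains is a Gaussian tail. For
\<open>c = 0\<close> this is the total mass \<open>\<pi>\<close> of the arcsine law.\<close>

lemma nn_integral_exp_arcsine:
  assumes t: "0 < t" and c: "0 \<le> c"
  shows "(\<integral>\<^sup>+r\<in>{0<..<t}. ennreal (exp (- c\<^sup>2 / r) / sqrt (r * (t - r))) \<partial>lborel)
    = ennreal (pi * erfc (c / sqrt t))"
proof -
  let ?k = "\<lambda>z r. 2 * z / r * exp (- z\<^sup>2 / r)"
  have tail: "(\<integral>\<^sup>+z\<in>{c..}. ennreal (?k z r) \<partial>lborel) = ennreal (exp (- c\<^sup>2 / r))" if r: "0 < r" for r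
  proof -
    have lim: "((\<lambda>z. - exp (- z\<^sup>2 / r)) \<longlongrightarrow> - 0) at_top"
    proof (intro tendsto_intros)
      have "filterlim (\<lambda>z::real. (1 / r) * z\<^sup>2) at_top at_top"
        using r by (intro filterlim_tendsto_pos_mult_at_top[OF tendsto_const] filterlim_pow_at_top filterlim_ident) auto
      then have "filterlim (\<lambda>z::real. - ((1 / r) * z\<^sup>2)) at_bot at_top"
        by (simp add: filterlim_uminus_at_top)
      from filterlim_compose[OF exp_at_bot this]
      show "((\<lambda>z. exp (- z\<^sup>2 / r)) \<longlongrightarrow> 0) at_top" by simp
    qed
    have "(\<integral>\<^sup>+z\<in>{c..}. ennreal (?k z r) \<partial>lborel) = ennreal (- 0 - (- exp (- c\<^sup>2 / r)))"
      using r c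
      by (intro nn_integral_FTC_atLeast[where F="\<lambda>z. - exp (- z\<^sup>2 / r)"] lim)
        (auto intro!: derivative_eq_intros)
    then show ?thesis by simp
  qed
  have "(\<integral>\<^sup>+r\<in>{0<..<t}. ennreal (exp (- c\<^sup>2 / r) / sqrt (r * (t - r))) \<partial>lborel)
    = (\<integral>\<^sup>+r. (\<integral>\<^sup>+z\<in>{c..}. ennreal (?k z r) \<partial>lborel) * (ennreal (1 / sqrt (r * (t - r))) * indicator {0<..<t} r) \<partial>lborel)"
  proof (rule nn_integral_cong)
    fix r
    show "ennreal (exp (- c\<^sup>2 / r) / sqrt (r * (t - r))) * indicator {0<..<t} r =
      (\<integral>\<^sup>+z\<in>{c..}. ennreal (?k z r) \<partial>lborel) * (ennreal (1 / sqrt (r * (t - r))) * indicator {0<..<t} r)"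
      using tail[of r] by (cases "r \<in> {0<..<t}") (auto simp: ennreal_mult'[symmetric])
  qed
  also have "\<dots> = (\<integral>\<^sup>+r. (\<integral>\<^sup>+z. ennreal (?k z r) * indicator {c..} z * (ennreal (1 / sqrt (r * (t - r))) * indicator {0<..<t} r) \<partial>lborel) \<partial>lborel)"
    by (subst nn_integral_multc) auto
  also have "\<dots> = (\<integral>\<^sup>+z. (\<integral>\<^sup>+r. ennreal (?k z r) * indicator {c..} z * (ennreal (1 / sqrt (r * (t - r))) * indicator {0<..<t} r) \<partial>lborel) \<partial>lborel)"
    by (rule lborel_pair.Fubini') measurable
  also have "\<dots> = (\<integral>\<^sup>+z. (\<integral>\<^sup>+r\<in>{0<..<t}. ennreal (?k z r / sqrt (r * (t - r))) \<partial>lborel) * indicator {c..} z \<partial>lborel)"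
  proof (rule nn_integral_cong)
    fix z
    have "(\<integral>\<^sup>+r. ennreal (?k z r) * indicator {c..} z * (ennreal (1 / sqrt (r * (t - r))) * indicator {0<..<t} r) \<partial>lborel)
      = (\<integral>\<^sup>+r. ennreal (?k z r / sqrt (r * (t - r))) * indicator {0<..<t} r * indicator {c..} z \<partial>lborel)"
      using c by (intro nn_integral_cong) (auto simp: indicator_def ennreal_mult'[symmetric])
    then show "(\<integral>\<^sup>+r. ennreal (?k z r) * indicator {c..} z * (ennreal (1 / sqrt (r * (t - r))) * indicator {0<..<t} r) \<partial>lborel)
      = (\<integral>\<^sup>+r\<in>{0<..<t}. ennreal (?k z r / sqrt (r * (t - r))) \<partial>lborel) * indicator {c..} z"
      by (simp add: nn_integral_multc)
  qed
  also have "\<dots> = (\<integral>\<^sup>+z\<in>{c..}. ennreal (2 * sqrt pi / sqrt t * exp (- z\<^sup>2 / t)) \<partial>lborel)"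
  \<comment> \<open>the inner integral is known only for \<open>z > 0\<close>; this excludes \<open>z = 0\<close> when \<open>c = 0\<close>\<close>
  proof (intro nn_integral_cong_AE)
    have "AE z::real in lborel. z \<noteq> 0" by (rule AE_lborel_singleton)
    then show "AE z in lborel. (\<integral>\<^sup>+r\<in>{0<..<t}. ennreal (?k z r / sqrt (r * (t - r))) \<partial>lborel) * indicator {c..} z
       = ennreal (2 * sqrt pi / sqrt t * exp (- z\<^sup>2 / t)) * indicator {c..} z"
    proof eventually_elim
      case (elim z)
      show ?case
      proof (cases "c \<le> z")
        case True
        then have "0 < z" using c elim by simp
        from nn_integral_gaussian_inverse_time[OF t this] show ?thesis by simp
      qed simp
    qed
  qed
  also have "\<dots> = ennreal (- pi * 0 - (- pi * erfc (c / sqrt t)))"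
  proof (rule nn_integral_FTC_atLeast)
    fix x
    have "((\<lambda>z. - pi * erfc (z / sqrt t)) has_real_derivative
       - pi * (- (2 / sqrt pi * exp (- (x / sqrt t)\<^sup>2)) * (1 / sqrt t))) (at x)"
      by (intro DERIV_cmult DERIV_chain2[OF has_real_derivative_erfc] DERIV_cdivide DERIV_ident)
    also have "- pi * (- (2 / sqrt pi * exp (- (x / sqrt t)\<^sup>2)) * (1 / sqrt t)) =
      (pi / sqrt pi) * 2 / sqrt t * exp (- (x / sqrt t)\<^sup>2)" by (simp add: field_simps)
    also have "pi / sqrt pi = sqrt pi" by (simp add: real_div_sqrt)
    finally show "((\<lambda>z. - pi * erfc (z / sqrt t)) has_real_derivative 2 * sqrt pi / sqrt t * exp (- x\<^sup>2 / t)) (at x)"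
      using t by (simp add: power_divide ac_simps)
  next
    have "filterlim (\<lambda>z. z * (1 / sqrt t)) at_top at_top"
      using t by (intro filterlim_at_top_mult_tendsto_pos[OF tendsto_const] filterlim_ident) auto
    from filterlim_compose[OF tendsto_erfc_at_top this]
    show "((\<lambda>z. - pi * erfc (z / sqrt t)) \<longlongrightarrow> - pi * 0) at_top"
      by (intro tendsto_intros) simp
  qed (use t in auto)
  finally show ?thesis by simp
qed

text \<open>The exponential rate of the second moment; it is \<open>l\<^sup>4 / (4 \<nu>)\<close> for \<open>a = l\<^sup>2\<close>.\<close>

definition growth_rate :: "real \<Rightarrow> real \<Rightarrow> real" where "growth_rate \<nu> a = a\<^sup>2 / (4 * \<nu>)"

text \<open>The response, seen at two points at distance \<open>d\<close>, to a unit of noise intensity released a time \<open>t\<close> ago.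
The argument \<open>d = 0\<close> gives the kernel of the Volterra equation.\<close>

definition pulse :: "real \<Rightarrow> real \<Rightarrow> real \<Rightarrow> real \<Rightarrow> ennreal" where
  "pulse \<nu> a d t = ennreal (a * heat_kernel (2 * \<nu>) t d)"

text \<open>The exponential times \<open>erfc\<close> in the final formula. As a function of \<open>d > 0\<close> it solves the heat equation with
diffusivity \<open>\<nu>\<close>, and at \<open>d = 0\<close> it equals \<open>2 exp(\<kappa> t) \<Phi>(sqrt (2 \<kappa> t))\<close> with \<open>\<kappa> = growth_rate \<nu> a\<close>.\<close>

definition erfc_exp :: "real \<Rightarrow> real \<Rightarrow> real \<Rightarrow> real \<Rightarrow> real" where
  "erfc_exp \<nu> a d t = exp ((a\<^sup>2 * t - 2 * a * d) / (4 * \<nu>)) * erfc ((d - a * t) / (2 * sqrt (\<nu> * t)))"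

lemma borel_measurable_pulse [measurable]: "pulse \<nu> a d \<in> borel_measurable borel"
  unfolding pulse_def[abs_def] by measurable

lemma borel_measurable_erfc_exp [measurable]: "erfc_exp \<nu> a d \<in> borel_measurable borel"
  unfolding erfc_exp_def[abs_def] by measurable

lemma growth_rate_nonneg: "0 < \<nu> \<Longrightarrow> 0 \<le> growth_rate \<nu> a" by (simp add: growth_rate_def)

lemma erfc_exp_nonneg: "0 \<le> erfc_exp \<nu> a d t" by (simp add: erfc_exp_def)

lemma pulse_nonpos [simp]: "t \<le> 0 \<Longrightarrow> pulse \<nu> a d t = 0" by (simp add: pulse_def)

text \<open>Up to constants the convolution of the two kernels is the integral in \<open>nn_integral_exp_arcsine\<close> with
\<open>c = d / (2 sqrt \<nu>)\<close>. For \<open>d = 0\<close> it says that \<open>pulse \<nu> a 0\<close> is a convolution square root of a constant.\<close>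

lemma conv_pulse_pulse:
  assumes nu: "0 < \<nu>" and a: "0 < a" and d: "0 \<le> d"
  shows "conv (pulse \<nu> a d) (pulse \<nu> a 0) t =
    ennreal (growth_rate \<nu> a) * (ennreal (erfc (d / (2 * sqrt (\<nu> * t)))) * indicator {0<..} t)"
proof (cases "0 < t")
  case True
  let ?c = "d / (2 * sqrt \<nu>)"
  have c: "0 \<le> ?c" using d nu by simp
  define C where "C = 2 * sqrt pi * sqrt \<nu>"
  have C: "C\<^sup>2 = 4 * pi * \<nu>" using nu by (simp add: C_def power_mult_distrib)
  have hk: "a * heat_kernel (2 * \<nu>) r x = a / C / sqrt r * exp (- (x / (2 * sqrt \<nu>))\<^sup>2 / r)" if "0 < r" for r x
    using heat_kernel_double[OF nu that] by (simp add: C_def)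
  have "conv (pulse \<nu> a d) (pulse \<nu> a 0) t = conv (pulse \<nu> a 0) (pulse \<nu> a d) t"
    by (subst conv_commute) auto
  also have "\<dots> = (\<integral>\<^sup>+r. ennreal (growth_rate \<nu> a) / ennreal pi * (ennreal (exp (- ?c\<^sup>2 / r) / sqrt (r * (t - r))) * indicator {0<..<t} r) \<partial>lborel)"
    unfolding conv_def
  proof (rule nn_integral_cong)
    fix r
    show "pulse \<nu> a 0 (t - r) * pulse \<nu> a d r = ennreal (growth_rate \<nu> a) / ennreal pi * (ennreal (exp (- ?c\<^sup>2 / r) / sqrt (r * (t - r))) * indicator {0<..<t} r)"
    proof (cases "r \<in> {0<..<t}")
      case r: True
      have "a * heat_kernel (2 * \<nu>) (t - r) 0 * (a * heat_kernel (2 * \<nu>) r d) =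
        growth_rate \<nu> a / pi * (exp (- ?c\<^sup>2 / r) / sqrt (r * (t - r)))"
      proof -
        have "growth_rate \<nu> a / pi = a / C * (a / C)"
          using C by (simp add: growth_rate_def power2_eq_square)
        moreover have "p / sqrt y * (p / sqrt x * X) = p * p * (X / sqrt (x * y))" for p x y X :: real
          by (simp add: real_sqrt_mult ac_simps)
        moreover have "a * heat_kernel (2 * \<nu>) (t - r) 0 = a / C / sqrt (t - r)"
          using hk[of "t - r" 0] r by simp
        moreover have "a * heat_kernel (2 * \<nu>) r d = a / C / sqrt r * exp (- ?c\<^sup>2 / r)"
          using hk[of r d] r by simp
        ultimately show ?thesis by metis
      qed
      then show ?thesis using r a nu growth_rate_nonneg[OF nu]
        by (simp add: pulse_def ennreal_mult'[symmetric] divide_ennreal)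
    qed (auto simp: pulse_def)
  qed
  also have "\<dots> = ennreal (growth_rate \<nu> a) / ennreal pi * ennreal (pi * erfc (?c / sqrt t))"
    by (subst nn_integral_cmult, measurable) (simp only: nn_integral_exp_arcsine[OF True c])
  also have "\<dots> = ennreal (growth_rate \<nu> a) * ennreal (erfc (d / (2 * sqrt (\<nu> * t))))"
    using growth_rate_nonneg[OF nu] by (simp add: divide_ennreal ennreal_mult'[symmetric] real_sqrt_mult field_simps)
  finally show ?thesis using True by simp
next
  case False
  have "conv (pulse \<nu> a d) (pulse \<nu> a 0) t = 0"
    using False by (intro conv_nonpos) auto
  then show ?thesis using False by simp
qed

text \<open>Completing the square shows that the exponential times the Gaussian \<open>exp(- r\<^sup>2)\<close> from the first \<open>erfc\<close> is the
Gaussian \<open>exp(- q\<^sup>2)\<close> from the second. The two terms with the singular derivative \<open>q'\<close> then cancel, and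
the difference of the inner derivatives, of order \<open>t\<^sup>-\<^sup>1\<^sup>/\<^sup>2\<close>, leaves a multiple of the heat kernel.\<close>

lemma erfc_exp_minus_erfc_has_derivative:
  assumes nu: "0 < \<nu>" and s: "0 < s"
  shows "((\<lambda>t. erfc_exp \<nu> a d t - erfc (d / (2 * sqrt (\<nu> * t)))) has_real_derivative
    (growth_rate \<nu> a * erfc_exp \<nu> a d s + a * heat_kernel (2 * \<nu>) s d)) (at s)"
proof -
  let ?q = "\<lambda>s. d / (2 * sqrt (\<nu> * s))"
  let ?r = "\<lambda>s. (d - a * s) / (2 * sqrt (\<nu> * s))"
  let ?X = "\<lambda>s. exp ((a\<^sup>2 * s - 2 * a * d) / (4 * \<nu>))"
  have r: "?r s = ?q s - a / (2 * sqrt \<nu>) * sqrt s" if "0 < s" for s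
    using that nu by (simp add: real_sqrt_mult field_simps)
  define q' where "q' = d / (2 * sqrt \<nu>) * - (inverse (sqrt s) * (inverse (sqrt s) / 2) * inverse (sqrt s))"
  have "((\<lambda>s. d / (2 * sqrt \<nu>) * inverse (sqrt s)) has_real_derivative q') (at s)"
    unfolding q'_def using s by (intro DERIV_cmult DERIV_inverse' DERIV_real_sqrt) auto
  then have Dq: "(?q has_real_derivative q') (at s)"
    by (simp add: real_sqrt_mult field_simps)
  have Dr: "(?r has_real_derivative q' - a / (2 * sqrt \<nu>) * (inverse (sqrt s) / 2)) (at s)"
  proof (rule DERIV_cong_ev[THEN iffD1, OF refl _ refl])
    show "((\<lambda>s. ?q s - a / (2 * sqrt \<nu>) * sqrt s) has_real_derivative q' - a / (2 * sqrt \<nu>) * (inverse (sqrt s) / 2)) (at s)"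
      using s by (intro DERIV_diff Dq DERIV_cmult DERIV_real_sqrt)
    show "\<forall>\<^sub>F s in nhds s. ?q s - a / (2 * sqrt \<nu>) * sqrt s = ?r s"
      using eventually_nhds_in_open[of "{0<..}" s, simplified, OF s]
      by eventually_elim (rule r[symmetric])
  qed
  have DX: "(?X has_real_derivative growth_rate \<nu> a * ?X s) (at s)"
    using nu by (auto intro!: derivative_eq_intros simp: growth_rate_def)
  let ?g = "2 / sqrt pi * exp (- (?q s)\<^sup>2)"
  have X: "?X s * (2 / sqrt pi * exp (- (?r s)\<^sup>2)) = ?g"
  proof -
    have "(a\<^sup>2 * s - 2 * a * d) / (4 * \<nu>) - (?r s)\<^sup>2 = - (?q s)\<^sup>2"
    proof -
      have "(a * s)\<^sup>2 - 2 * (a * s) * d = (a\<^sup>2 * s - 2 * a * d) * s"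
        by (simp add: power2_eq_square algebra_simps)
      then have "(a\<^sup>2 * s - 2 * a * d) / (4 * \<nu>) = ((a * s)\<^sup>2 - 2 * (a * s) * d) / (4 * \<nu> * s)"
        using s by simp
      moreover have "(?r s)\<^sup>2 = (d - a * s)\<^sup>2 / (4 * \<nu> * s)" "(?q s)\<^sup>2 = d\<^sup>2 / (4 * \<nu> * s)"
        using s nu by (simp_all add: power_divide power_mult_distrib)
      moreover have "(a * s)\<^sup>2 - 2 * (a * s) * d - (d - a * s)\<^sup>2 = - d\<^sup>2"
        by (simp add: power2_eq_square algebra_simps)
      ultimately show ?thesis
        by (metis diff_divide_distrib minus_divide_left)
    qed
    then have "?X s * exp (- (?r s)\<^sup>2) = exp (- (?q s)\<^sup>2)"
      by (simp add: exp_add[symmetric])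
    then show ?thesis by (simp add: ac_simps)
  qed
  have "((\<lambda>t. erfc_exp \<nu> a d t - erfc (d / (2 * sqrt (\<nu> * t)))) has_real_derivative (growth_rate \<nu> a * ?X s * erfc (?r s) +
     (- (2 / sqrt pi * exp (- (?r s)\<^sup>2)) * (q' - a / (2 * sqrt \<nu>) * (inverse (sqrt s) / 2))) * ?X s)
     - (- ?g * q')) (at s)"
    unfolding erfc_exp_def
    by (rule DERIV_diff DERIV_mult DX DERIV_chain2[OF has_real_derivative_erfc] Dr Dq)+
  also have "(growth_rate \<nu> a * ?X s * erfc (?r s) +
     (- (2 / sqrt pi * exp (- (?r s)\<^sup>2)) * (q' - a / (2 * sqrt \<nu>) * (inverse (sqrt s) / 2))) * ?X s)
     - (- ?g * q') = growth_rate \<nu> a * erfc_exp \<nu> a d s - (?X s * (2 / sqrt pi * exp (- (?r s)\<^sup>2))) * (q' - a / (2 * sqrt \<nu>) * (inverse (sqrt s) / 2)) + ?g * q'"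
    by (simp add: erfc_exp_def algebra_simps)
  also have "\<dots> = growth_rate \<nu> a * erfc_exp \<nu> a d s + ?g * (a / (2 * sqrt \<nu>) * (inverse (sqrt s) / 2))"
  proof -
    have "E - G * (q - b) + G * q = E + G * b" for E G q b :: real
      by (simp add: algebra_simps)
    then show ?thesis unfolding X .
  qed
  also have "?g * (a / (2 * sqrt \<nu>) * (inverse (sqrt s) / 2)) = a * heat_kernel (2 * \<nu>) s d"
  proof -
    have q: "- (?q s)\<^sup>2 = - (d / (2 * sqrt \<nu>))\<^sup>2 / s"
      using s nu by (simp add: power_divide power_mult_distrib)
    have "(2 / p * G) * (a / (2 * n) * (inverse r / 2)) = a * (1 / (2 * p * n) / r * G)"
      for p n r G :: real
      by (simp add: field_simps)
    then show ?thesis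
      unfolding heat_kernel_double[OF nu s] q .
  qed
  finally show ?thesis .
qed

text \<open>For \<open>d > 0\<close> both \<open>erfc\<close> terms vanish in the limit; for \<open>d = 0\<close> both tend to \<open>1\<close>. Only their difference
has a limit independent of the case.\<close>

lemma tendsto_erfc_exp_minus_erfc_0:
  assumes nu: "0 < \<nu>" and d: "0 \<le> d"
  shows "((\<lambda>t. erfc_exp \<nu> a d t - erfc (d / (2 * sqrt (\<nu> * t)))) \<longlongrightarrow> 0) (at_right 0)"
proof -
  have sq0: "((\<lambda>t. sqrt (\<nu> * t)) \<longlongrightarrow> 0) (at_right 0)"
    by (auto intro!: tendsto_eq_intros)
  have ex: "((\<lambda>t. exp ((a\<^sup>2 * t - 2 * a * d) / (4 * \<nu>))) \<longlongrightarrow> exp ((a\<^sup>2 * 0 - 2 * a * d) / (4 * \<nu>))) (at_right 0)"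
    using nu by (intro tendsto_intros) auto
  have q: "((\<lambda>t. - (a / (2 * \<nu>)) * sqrt (\<nu> * t)) \<longlongrightarrow> - (a / (2 * \<nu>)) * 0) (at_right 0)"
    by (intro tendsto_intros sq0)
  have r: "(d - a * t) / (2 * sqrt (\<nu> * t)) = - (a / (2 * \<nu>)) * sqrt (\<nu> * t) + d / (2 * sqrt (\<nu> * t))" if "0 < t" for t
    using that nu by (simp add: field_simps real_sqrt_mult)
  have ev: "\<forall>\<^sub>F t in at_right 0. - (a / (2 * \<nu>)) * sqrt (\<nu> * t) + d / (2 * sqrt (\<nu> * t)) = (d - a * t) / (2 * sqrt (\<nu> * t))"
    using r by (auto simp: eventually_at_right_less eventually_at_filter)
  show ?thesis
  proof (cases "d = 0")
    case True
    have "((\<lambda>t. (d - a * t) / (2 * sqrt (\<nu> * t))) \<longlongrightarrow> 0) (at_right 0)"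
      by (rule Lim_transform_eventually[OF _ ev]) (use q True in simp)
    from isCont_tendsto_compose[OF isCont_erfc this] tendsto_mult[OF ex this]
    have "((\<lambda>t. erfc ((d - a * t) / (2 * sqrt (\<nu> * t)))) \<longlongrightarrow> 1) (at_right 0)" by simp
    from tendsto_diff[OF tendsto_mult[OF ex this] tendsto_const[of 1]]
    show ?thesis using True by (simp add: erfc_exp_def)
  next
    case False
    then have "0 < d / 2" using d by simp
    have "filterlim (\<lambda>t. sqrt (\<nu> * t)) (at_right 0) (at_right 0)"
      unfolding filterlim_at using sq0 nu by (auto simp: eventually_at_filter)
    then have "filterlim (\<lambda>t. inverse (sqrt (\<nu> * t))) at_top (at_right 0)"
      by (rule filterlim_compose[OF filterlim_inverse_at_top_right])
    then have "filterlim (\<lambda>t. d / 2 * inverse (sqrt (\<nu> * t))) at_top (at_right 0)"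
      by (rule filterlim_tendsto_pos_mult_at_top[OF tendsto_const \<open>0 < d / 2\<close>])
    then have top: "filterlim (\<lambda>t. d / (2 * sqrt (\<nu> * t))) at_top (at_right 0)"
      by (simp add: field_simps)
    have "filterlim (\<lambda>t. - (a / (2 * \<nu>)) * sqrt (\<nu> * t) + d / (2 * sqrt (\<nu> * t))) at_top (at_right 0)"
      by (rule filterlim_tendsto_add_at_top[OF q top])
    then have "filterlim (\<lambda>t. (d - a * t) / (2 * sqrt (\<nu> * t))) at_top (at_right 0)"
      by (rule filterlim_mono_eventually) (use ev in auto)
    note 1 = tendsto_mult[OF ex filterlim_compose[OF tendsto_erfc_at_top this]]
    note 2 = filterlim_compose[OF tendsto_erfc_at_top top]
    from tendsto_diff[OF 1 2] show ?thesis by (simp add: erfc_exp_def)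
  qed
qed

text \<open>The preceding derivative integrated from \<open>0\<close>.\<close>

lemma erfc_exp_integral_equation:
  assumes nu: "0 < \<nu>" and a: "0 < a" and d: "0 \<le> d" and t: "0 < t"
  shows "ennreal (erfc_exp \<nu> a d t) = ennreal (erfc (d / (2 * sqrt (\<nu> * t)))) +
    (\<integral>\<^sup>+s\<in>{0<..<t}. ennreal (growth_rate \<nu> a * erfc_exp \<nu> a d s + a * heat_kernel (2 * \<nu>) s d) \<partial>lborel)"
proof -
  let ?F = "\<lambda>t. erfc_exp \<nu> a d t - erfc (d / (2 * sqrt (\<nu> * t)))"
  note D = erfc_exp_minus_erfc_has_derivative[OF nu]
  note lim0 = tendsto_erfc_exp_minus_erfc_0[OF nu d]
  have cont: "isCont (\<lambda>s. growth_rate \<nu> a * erfc_exp \<nu> a d s + a * heat_kernel (2 * \<nu>) s d) s" if "0 < s" for s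
  proof -
    have "isCont (\<lambda>s. growth_rate \<nu> a * erfc_exp \<nu> a d s + a * (1 / sqrt (2 * pi * (2 * \<nu>) * s) * exp (- (\<bar>d\<bar>\<^sup>2 / (2 * (2 * \<nu>) * s))))) s"
      unfolding erfc_exp_def using that nu
      by (auto intro!: continuous_intros isCont_o2[OF _ isCont_erfc])
    moreover have "\<forall>\<^sub>F s in nhds s. growth_rate \<nu> a * erfc_exp \<nu> a d s + a * (1 / sqrt (2 * pi * (2 * \<nu>) * s) * exp (- (\<bar>d\<bar>\<^sup>2 / (2 * (2 * \<nu>) * s)))) = growth_rate \<nu> a * erfc_exp \<nu> a d s + a * heat_kernel (2 * \<nu>) s d"
      using eventually_nhds_in_open[of "{0<..}" s] that by (auto elim!: eventually_mono simp: heat_kernel_def)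
    ultimately show ?thesis by (subst (asm) isCont_cong)
  qed
  have "(?F \<longlongrightarrow> ?F t) (at_left t)"
    using DERIV_isCont[OF D[OF t]] unfolding isCont_def by (rule filterlim_mono) (auto simp: at_le)
  note FTC = nn_integral_FTC_Ioo[where F="?F", OF t D cont _ lim0 this]
  have nn: "0 \<le> growth_rate \<nu> a * erfc_exp \<nu> a d s + a * heat_kernel (2 * \<nu>) s d" for s
    using a nu growth_rate_nonneg[OF nu] erfc_exp_nonneg by simp
  have "(\<integral>\<^sup>+s\<in>{0<..<t}. ennreal (growth_rate \<nu> a * erfc_exp \<nu> a d s + a * heat_kernel (2 * \<nu>) s d) \<partial>lborel) = ennreal (?F t - 0)"
    by (rule FTC(1)) (use nn in auto)
  moreover have "0 \<le> ?F t"
    by (rule FTC(2)) (use nn in auto)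
  ultimately show ?thesis by (simp add: ennreal_plus[symmetric] del: ennreal_plus)
qed

lemma conv_cong_before:
  assumes f: "\<And>s. s \<le> 0 \<Longrightarrow> f s = 0" and eq: "\<And>s. s < t \<Longrightarrow> g s = h s"
  shows "conv f g t = conv f h t"
  unfolding conv_def
proof (rule nn_integral_cong)
  fix s
  show "f (t - s) * g s = f (t - s) * h s"
    using f[of "t - s"] eq[of s] by (cases "s < t") auto
qed

definition erfc_exp0 :: "real \<Rightarrow> real \<Rightarrow> real \<Rightarrow> ennreal" where
  "erfc_exp0 \<nu> a t = ennreal (erfc_exp \<nu> a 0 t) * indicator {0<..} t"

lemma borel_measurable_erfc_exp0 [measurable]: "erfc_exp0 \<nu> a \<in> borel_measurable borel"
  unfolding erfc_exp0_def[abs_def] by measurable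

lemma conv_step_affine:
  assumes [measurable]: "f \<in> borel_measurable borel"
  shows "conv (indicator {0<..}) (\<lambda>s. ennreal (growth_rate \<nu> a) * f s + pulse \<nu> a d s) t =
    ennreal (growth_rate \<nu> a) * conv (indicator {0<..}) f t + conv (indicator {0<..}) (pulse \<nu> a d) t"
  by (subst conv_add_right) (auto simp: conv_cmult_right)

text \<open>Write \<open>E\<^sub>d\<close> and \<open>e\<^sub>d\<close> for the functions of time on the left and in the first term on the right, \<open>g\<close> for
\<open>pulse \<nu> a d\<close>, \<open>b\<close> for \<open>pulse \<nu> a 0\<close> and \<open>\<theta>\<close> for \<open>indicator {0<..}\<close>. The integral equation above reads
\<open>E\<^sub>d = e\<^sub>d + \<theta> * (\<kappa> E\<^sub>d + g)\<close>. Convolving its case \<open>d = 0\<close> with \<open>g\<close> and inserting \<open>g * b = \<kappa> e\<^sub>d\<close> shows that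
\<open>e\<^sub>d + g * E\<^sub>0\<close> satisfies the same equation, so the two agree by uniqueness. For \<open>d = 0\<close> the result is
\<open>E\<^sub>0 = 1 + b * E\<^sub>0\<close>, the resolvent equation of \<open>b\<close>.\<close>

lemma erfc_exp_resolvent:
  assumes nu: "0 < \<nu>" and a: "0 < a" and d: "0 \<le> d" and t: "0 < t"
  shows "ennreal (erfc_exp \<nu> a d t) =
    ennreal (erfc (d / (2 * sqrt (\<nu> * t)))) + conv (pulse \<nu> a d) (erfc_exp0 \<nu> a) t"
proof -
  let ?th = "indicator {0<..} :: real \<Rightarrow> ennreal"
  let ?k = "ennreal (growth_rate \<nu> a)"
  define E where "E d t = ennreal (erfc_exp \<nu> a d t) * ?th t" for d t
  define e where "e d t = ennreal (erfc (d / (2 * sqrt (\<nu> * t)))) * ?th t" for d t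
  have [measurable]: "E d \<in> borel_measurable borel" "e d \<in> borel_measurable borel" for d
    unfolding E_def[abs_def] e_def[abs_def] by measurable
  have E_eq: "E d = (\<lambda>t. e d t + conv ?th (\<lambda>s. ?k * E d s + pulse \<nu> a d s) t)" if "0 \<le> d" for d
  proof
    fix t
    have "conv ?th (\<lambda>s. ?k * E d s + pulse \<nu> a d s) t = (\<integral>\<^sup>+s\<in>{0<..<t}. (?k * E d s + pulse \<nu> a d s) \<partial>lborel)"
      by (intro conv_step) (auto simp: E_def)
    also have "\<dots> = (\<integral>\<^sup>+s\<in>{0<..<t}. ennreal (growth_rate \<nu> a * erfc_exp \<nu> a d s + a * heat_kernel (2 * \<nu>) s d) \<partial>lborel)"
      using nu a growth_rate_nonneg[OF nu] erfc_exp_nonneg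
      by (intro nn_integral_cong) (auto simp: E_def pulse_def indicator_def ennreal_mult')
    finally show "E d t = e d t + conv ?th (\<lambda>s. ?k * E d s + pulse \<nu> a d s) t"
      using erfc_exp_integral_equation[OF nu a that, of t]
      by (cases "0 < t") (auto simp: E_def e_def)
  qed
  have e0: "e 0 = ?th" by (auto simp: e_def)
  have conv_e: "conv (pulse \<nu> a d) (pulse \<nu> a 0) = (\<lambda>t. ?k * e d t)"
    using conv_pulse_pulse[OF nu a d] by (auto simp: e_def)
  define Z where "Z = conv (pulse \<nu> a d) (E 0)"
  have [measurable]: "Z \<in> borel_measurable borel" unfolding Z_def by measurable
  have Z: "Z t = conv ?th (\<lambda>s. ?k * (e d s + Z s) + pulse \<nu> a d s) t" for t
  proof -
    have "Z t = conv (pulse \<nu> a d) ?th t + conv (pulse \<nu> a d) (conv ?th (\<lambda>s. ?k * E 0 s + pulse \<nu> a 0 s)) t"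
    proof -
      have "Z t = conv (pulse \<nu> a d) (\<lambda>t. e 0 t + conv ?th (\<lambda>s. ?k * E 0 s + pulse \<nu> a 0 s) t) t"
        unfolding Z_def by (rule arg_cong[OF E_eq[OF order_refl], of "\<lambda>f. conv (pulse \<nu> a d) f t"])
      then show ?thesis unfolding e0 by (subst (asm) conv_add_right) auto
    qed
    also have "conv (pulse \<nu> a d) (conv ?th (\<lambda>s. ?k * E 0 s + pulse \<nu> a 0 s)) =
        conv ?th (conv (pulse \<nu> a d) (\<lambda>s. ?k * E 0 s + pulse \<nu> a 0 s))"
      by (subst (1 2) conv_assoc[symmetric]) (auto simp: conv_commute[of "pulse \<nu> a d" ?th])
    also have "conv (pulse \<nu> a d) (\<lambda>s. ?k * E 0 s + pulse \<nu> a 0 s) = (\<lambda>s. ?k * (e d s + Z s))"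
      by (rule ext) (subst conv_add_right; auto simp: conv_cmult_right conv_e Z_def[symmetric] distrib_left add.commute)
    also have "conv (pulse \<nu> a d) ?th = conv ?th (pulse \<nu> a d)"
      by (rule conv_commute) auto
    finally show ?thesis
      by (subst conv_add_right) (auto simp: add.commute)
  qed
  \<comment> \<open>the common forcing term of the two equations\<close>
  let ?c = "\<lambda>t. e d t + conv ?th (pulse \<nu> a d) t"
  have 1: "E d t = ?c t + ?k * (\<integral>\<^sup>+s\<in>{0<..<t}. E d s \<partial>lborel)" for t
  proof -
    have "E d t = e d t + (?k * conv ?th (E d) t + conv ?th (pulse \<nu> a d) t)"
      by (subst E_eq[OF d]) (simp add: conv_step_affine)
    moreover have "conv ?th (E d) t = (\<integral>\<^sup>+s\<in>{0<..<t}. E d s \<partial>lborel)"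
      by (intro conv_step) (auto simp: E_def)
    ultimately show ?thesis by (simp add: ac_simps)
  qed
  have Z0: "Z s = 0" if "s \<le> 0" for s
    unfolding Z_def using that by (intro conv_nonpos) (auto simp: E_def)
  have 2: "e d t + Z t = ?c t + ?k * (\<integral>\<^sup>+s\<in>{0<..<t}. e d s + Z s \<partial>lborel)" for t
  proof -
    have "Z t = ?k * conv ?th (\<lambda>s. e d s + Z s) t + conv ?th (pulse \<nu> a d) t"
      by (subst Z) (simp add: conv_step_affine)
    moreover have "conv ?th (\<lambda>s. e d s + Z s) t = (\<integral>\<^sup>+s\<in>{0<..<t}. e d s + Z s \<partial>lborel)"
      by (intro conv_step) (auto simp: Z0 e_def)
    ultimately show ?thesis by (simp add: ac_simps)
  qed
  \<comment> \<open>any time beyond \<open>t\<close> serves as the horizon for the uniqueness statement\<close>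
  have T: "0 < t + 1" using t by simp
  have bounded: "E 0 s \<le> ennreal (2 * exp (growth_rate \<nu> a * (t + 1)))" if "0 < s" "s \<le> t + 1" for s
  proof -
    have "growth_rate \<nu> a * s \<le> growth_rate \<nu> a * (t + 1)"
      using that growth_rate_nonneg[OF nu] by (intro mult_left_mono) auto
    then have "exp (a\<^sup>2 * s / (4 * \<nu>)) * erfc ((0 - a * s) / (2 * sqrt (\<nu> * s))) \<le> exp (growth_rate \<nu> a * (t + 1)) * 2"
      by (intro mult_mono erfc_le_2) (auto simp: growth_rate_def)
    then show ?thesis using that by (simp add: E_def erfc_exp_def ennreal_leI mult.commute)
  qed
  have fin_step: "conv ?th (pulse \<nu> a d) (t + 1) < \<infinity>"
  proof -
    have "conv ?th (pulse \<nu> a d) (t + 1) \<le> E d (t + 1)"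
      by (subst 1) (simp add: add.assoc add_increasing)
    also have "\<dots> < \<infinity>" by (simp add: E_def ennreal_mult_less_top indicator_def)
    finally show ?thesis .
  qed
  have fin_Z: "Z (t + 1) < \<infinity>"
  proof -
    let ?C = "ennreal (2 * exp (growth_rate \<nu> a * (t + 1)))"
    have "Z (t + 1) = conv (E 0) (pulse \<nu> a d) (t + 1)"
      unfolding Z_def by (rule conv_commute[THEN fun_cong]) auto
    also have "\<dots> \<le> (\<integral>\<^sup>+r. ?C * (?th (t + 1 - r) * pulse \<nu> a d r) \<partial>lborel)"
      unfolding conv_def
    proof (rule nn_integral_mono)
      fix r
      show "E 0 (t + 1 - r) * pulse \<nu> a d r \<le> ?C * (?th (t + 1 - r) * pulse \<nu> a d r)"
      proof (cases "0 < r \<and> r < t + 1")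
        case True
        then have "E 0 (t + 1 - r) \<le> ?C" by (intro bounded) auto
        then show ?thesis using True by (auto intro: mult_right_mono)
      qed (auto simp: E_def)
    qed
    also have "\<dots> = ?C * conv ?th (pulse \<nu> a d) (t + 1)"
      unfolding conv_def by (subst nn_integral_cmult) auto
    also have "\<dots> < \<infinity>" using fin_step by (simp add: ennreal_mult_less_top)
    finally show ?thesis .
  qed
  have kp: "0 < growth_rate \<nu> a" using nu a by (simp add: growth_rate_def)
  have fin1: "(\<integral>\<^sup>+s\<in>{0<..<t + 1}. E d s \<partial>lborel) < \<infinity>"
  proof -
    have "?k * (\<integral>\<^sup>+s\<in>{0<..<t + 1}. E d s \<partial>lborel) \<le> E d (t + 1)"
      by (subst (2) 1) (simp add: add_increasing)
    also have "\<dots> < \<infinity>" by (simp add: E_def ennreal_mult_less_top indicator_def)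
    finally show ?thesis using kp by (auto simp: ennreal_mult_less_top)
  qed
  have fin2: "(\<integral>\<^sup>+s\<in>{0<..<t + 1}. e d s + Z s \<partial>lborel) < \<infinity>"
  proof -
    have "?k * (\<integral>\<^sup>+s\<in>{0<..<t + 1}. e d s + Z s \<partial>lborel) \<le> e d (t + 1) + Z (t + 1)"
      unfolding 2[of "t + 1"] by (simp add: add_increasing)
    also have "\<dots> < \<infinity>" using fin_Z by (simp add: e_def ennreal_mult_less_top indicator_def)
    finally show ?thesis using kp by (auto simp: ennreal_mult_less_top)
  qed
  have "E d t = e d t + Z t"
    by (rule linear_volterra_unique[where c="?c" and T="t + 1", OF _ _ growth_rate_nonneg[OF nu] 1 2 fin1 fin2])
      (use t in auto)
  moreover have "E 0 = erfc_exp0 \<nu> a" by (auto simp: E_def erfc_exp0_def)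
  ultimately show ?thesis using t by (simp add: E_def e_def Z_def)
qed

text \<open>Substituting the equation into itself replaces the singular kernel \<open>b\<close> by the constant \<open>b * b\<close>.\<close>

lemma iterate_volterra:
  assumes nu: "0 < \<nu>" and a: "0 < a"
    and [measurable]: "w \<in> borel_measurable borel" "w0 \<in> borel_measurable borel"
    and w0: "\<And>s. s \<le> 0 \<Longrightarrow> w s = 0" "\<And>s. s \<le> 0 \<Longrightarrow> w0 s = 0"
    and eq: "\<And>t. 0 < t \<Longrightarrow> t < T \<Longrightarrow> w t = w0 t + conv (pulse \<nu> a 0) w t"
    and t: "0 < t" "t < T"
  shows "w t = (w0 t + conv (pulse \<nu> a 0) w0 t) + ennreal (growth_rate \<nu> a) * (\<integral>\<^sup>+s\<in>{0<..<t}. w s \<partial>lborel)"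
proof -
  let ?b = "pulse \<nu> a 0"
  have "conv ?b w t = conv ?b (\<lambda>s. w0 s + conv ?b w s) t"
  proof (rule conv_cong_before)
    fix s assume "s < t"
    show "w s = w0 s + conv ?b w s"
      using eq[of s] \<open>s < t\<close> t w0[of s] conv_nonpos[of ?b w s] w0 by (cases "0 < s") auto
  qed simp
  also have "\<dots> = conv ?b w0 t + conv (conv ?b ?b) w t"
    by (simp add: conv_add_right conv_assoc)
  also have "conv ?b ?b = (\<lambda>s. ennreal (growth_rate \<nu> a) * indicator {0<..} s)"
    by (rule ext) (simp add: conv_pulse_pulse[OF nu a])
  also have "conv \<dots> w t = ennreal (growth_rate \<nu> a) * conv w (indicator {0<..}) t"
    by (subst conv_commute) (auto simp: conv_cmult_right)
  also have "conv w (indicator {0<..}) = conv (indicator {0<..}) w"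
    by (rule conv_commute) auto
  also have "conv (indicator {0<..}) w t = (\<integral>\<^sup>+s\<in>{0<..<t}. w s \<partial>lborel)"
    using w0(1) by (rule conv_step)
  finally show ?thesis using eq[OF t] by (simp add: add.assoc)
qed

text \<open>The explicit function \<open>v = q (b + \<kappa> E\<^sub>0) + \<sigma>2 E\<^sub>0\<close>, with the notation of \<open>erfc_exp_resolvent\<close>, solves the
Volterra equation by \<open>b * b = \<kappa>\<close> and the resolvent equation. Uniqueness after one iteration gives
\<open>w = v\<close> on \<open>(0,T)\<close>, and \<open>(pulse \<nu> a d) * v\<close> is computed from the same two identities.\<close>

theorem volterra_moment:
  assumes nu: "0 < \<nu>" and a: "0 < a" and q: "0 \<le> q" and \<sigma>: "0 \<le> \<sigma>2" and d: "0 \<le> d" and T: "0 < T"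
    and w [measurable]: "w \<in> borel_measurable borel" and w0: "\<And>s. s \<le> 0 \<Longrightarrow> w s = 0"
    and eq: "\<And>t. 0 < t \<Longrightarrow> t < T \<Longrightarrow> w t = ennreal \<sigma>2 + ennreal q * pulse \<nu> a 0 t + conv (pulse \<nu> a 0) w t"
    and fin: "(\<integral>\<^sup>+s\<in>{0<..<T}. w s \<partial>lborel) < \<infinity>"
  shows "conv (pulse \<nu> a d) w T = ennreal (q * growth_rate \<nu> a * erfc_exp \<nu> a d T
     + \<sigma>2 * (erfc_exp \<nu> a d T - erfc (d / (2 * sqrt (\<nu> * T)))))"
proof -
  let ?h = "erfc_exp0 \<nu> a" and ?k = "ennreal (growth_rate \<nu> a)" and ?b = "pulse \<nu> a 0"
  let ?th = "indicator {0<..} :: real \<Rightarrow> ennreal"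
  let ?e = "\<lambda>d t. ennreal (erfc (d / (2 * sqrt (\<nu> * t)))) * ?th t"
  define v where "v s = ennreal q * ?b s + ennreal q * ?k * ?h s + ennreal \<sigma>2 * ?h s" for s
  have [measurable]: "v \<in> borel_measurable borel" unfolding v_def[abs_def] by measurable
  have v0: "v s = 0" if "s \<le> 0" for s using that by (simp add: v_def erfc_exp0_def)
  have cv: "conv (pulse \<nu> a d) v t = ennreal q * ?k * (?e d t + conv (pulse \<nu> a d) ?h t) + ennreal \<sigma>2 * conv (pulse \<nu> a d) ?h t" if "0 \<le> d" for d t
  proof -
    have "conv (pulse \<nu> a d) v t = ennreal q * (?k * ?e d t) + ennreal q * ?k * conv (pulse \<nu> a d) ?h t + ennreal \<sigma>2 * conv (pulse \<nu> a d) ?h t"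
      unfolding v_def[abs_def] conv_pulse_pulse[OF nu a that, symmetric]
      by (simp add: conv_add_right conv_cmult_right)
    then show ?thesis by (simp add: distrib_left mult.assoc)
  qed
  have h: "?h t = 1 + conv ?b ?h t" if "0 < t" for t
    using erfc_exp_resolvent[OF nu a order_refl that] that by (simp add: erfc_exp0_def)
  let ?w0 = "\<lambda>t. (ennreal \<sigma>2 + ennreal q * ?b t) * ?th t"
  have v_eq: "v t = ?w0 t + conv ?b v t" if "0 < t" for t
    using that by (subst cv) (simp_all add: v_def h[OF that] distrib_left ac_simps)
  have fin_v: "(\<integral>\<^sup>+s\<in>{0<..<T}. v s \<partial>lborel) < \<infinity>"
  proof -
    have kp: "0 < growth_rate \<nu> a" using nu a by (simp add: growth_rate_def)
    \<comment> \<open>\<open>v\<close> is dominated by a multiple of the integrand in \<open>erfc_exp_integral_equation\<close> with \<open>d = 0\<close>\<close>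
    let ?C = "q + \<sigma>2 / growth_rate \<nu> a"
    let ?F = "\<lambda>s. growth_rate \<nu> a * erfc_exp \<nu> a 0 s + a * heat_kernel (2 * \<nu>) s 0"
    have F: "0 \<le> ?F s" for s using kp a nu erfc_exp_nonneg by simp
    have "(\<integral>\<^sup>+s\<in>{0<..<T}. v s \<partial>lborel) \<le> (\<integral>\<^sup>+s. ennreal ?C * (ennreal (?F s) * indicator {0<..<T} s) \<partial>lborel)"
    proof (rule nn_integral_mono)
      fix s
      show "v s * indicator {0<..<T} s \<le> ennreal ?C * (ennreal (?F s) * indicator {0<..<T} s)"
      proof (cases "s \<in> {0<..<T}")
        case True
        let ?B = "a * heat_kernel (2 * \<nu>) s 0" and ?H = "erfc_exp \<nu> a 0 s"
        have B: "0 \<le> ?B" "0 \<le> ?H" using a nu erfc_exp_nonneg by auto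
        have "v s = ennreal (q * ?B + q * growth_rate \<nu> a * ?H + \<sigma>2 * ?H)"
          using True q \<sigma> kp B by (simp add: v_def pulse_def erfc_exp0_def ennreal_mult)
        also have "q * ?B + q * growth_rate \<nu> a * ?H + \<sigma>2 * ?H = ?C * ?F s - \<sigma>2 / growth_rate \<nu> a * ?B"
          using kp by (simp add: field_simps)
        also have "ennreal \<dots> \<le> ennreal (?C * ?F s)"
          using kp \<sigma> B by (intro ennreal_leI) simp
        also have "\<dots> = ennreal ?C * ennreal (?F s)"
          using kp \<sigma> q F by (intro ennreal_mult) auto
        finally show ?thesis using True by simp
      qed simp
    qed
    also have "\<dots> = ennreal ?C * (\<integral>\<^sup>+s\<in>{0<..<T}. ennreal (?F s) \<partial>lborel)"
      by (rule nn_integral_cmult) measurable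
    also have "\<dots> < \<infinity>"
    proof -
      have "(\<integral>\<^sup>+s\<in>{0<..<T}. ennreal (?F s) \<partial>lborel) \<le> ennreal (erfc_exp \<nu> a 0 T)"
        by (subst erfc_exp_integral_equation[OF nu a order_refl T]) (simp add: add_increasing)
      then show ?thesis by (auto simp: ennreal_mult_less_top intro: le_less_trans)
    qed
    finally show ?thesis .
  qed
  have wv: "w t = v t" if t: "0 < t" "t < T" for t
  proof (rule linear_volterra_unique[where T=T and k="growth_rate \<nu> a" and c="\<lambda>t. ?w0 t + conv ?b ?w0 t", OF _ _ growth_rate_nonneg[OF nu] _ _ fin fin_v t])
    show "w t = ?w0 t + conv ?b ?w0 t + ?k * (\<integral>\<^sup>+s\<in>{0<..<t}. w s \<partial>lborel)" if "0 < t" "t < T" for t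
      by (rule iterate_volterra[OF nu a _ _ w0 _ _ that]) (auto simp: eq)
    show "v t = ?w0 t + conv ?b ?w0 t + ?k * (\<integral>\<^sup>+s\<in>{0<..<t}. v s \<partial>lborel)" if "0 < t" "t < T" for t
      by (rule iterate_volterra[OF nu a _ _ v0 _ _ that]) (auto simp: v_eq)
  qed auto
  have "conv (pulse \<nu> a d) w T = conv (pulse \<nu> a d) v T"
  proof (rule conv_cong_before)
    fix s assume "s < T"
    then show "w s = v s" using wv[of s] w0[of s] v0[of s] by (cases "0 < s") auto
  qed simp
  also have "\<dots> = ennreal q * ?k * ennreal (erfc_exp \<nu> a d T) + ennreal \<sigma>2 * conv (pulse \<nu> a d) ?h T"
    using T by (simp add: cv[OF d] erfc_exp_resolvent[OF nu a d T])
  also have "conv (pulse \<nu> a d) ?h T = ennreal (erfc_exp \<nu> a d T - erfc (d / (2 * sqrt (\<nu> * T))))"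
    using erfc_exp_resolvent[OF nu a d T] by (simp add: ennreal_minus[symmetric])
  also have "ennreal q * ?k * ennreal (erfc_exp \<nu> a d T) + ennreal \<sigma>2 * \<dots> =
     ennreal (q * growth_rate \<nu> a * erfc_exp \<nu> a d T + \<sigma>2 * (erfc_exp \<nu> a d T - erfc (d / (2 * sqrt (\<nu> * T)))))"
  proof -
    have "ennreal (erfc (d / (2 * sqrt (\<nu> * T)))) \<le> ennreal (erfc_exp \<nu> a d T)"
      by (subst erfc_exp_resolvent[OF nu a d T]) (simp add: add_increasing2)
    then have "0 \<le> erfc_exp \<nu> a d T - erfc (d / (2 * sqrt (\<nu> * T)))"
      by (simp add: erfc_exp_nonneg)
    then show ?thesis
      using q \<sigma> growth_rate_nonneg[OF nu] erfc_exp_nonneg by (simp add: ennreal_mult)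
  qed
  finally show ?thesis .
qed


section \<open>Square integrable functions\<close>

text \<open>Real-valued membership in \<open>L\<^sup>2\<close>; \<open>L2_norm_sq\<close> is the corresponding norm with values in \<open>[0,\<infinity>]\<close>.\<close>

definition square_integrable :: "'a measure \<Rightarrow> ('a \<Rightarrow> real) \<Rightarrow> bool" where
  "square_integrable M f \<longleftrightarrow> f \<in> borel_measurable M \<and> integrable M (\<lambda>x. (f x)\<^sup>2)"

lemma square_integrable_measurable: "square_integrable M f \<Longrightarrow> f \<in> borel_measurable M"
  by (simp add: square_integrable_def)

lemma square_integrable_power2: "square_integrable M f \<Longrightarrow> integrable M (\<lambda>x. (f x)\<^sup>2)"
  by (simp add: square_integrable_def)

lemma square_integrable_mult:
  assumes f: "square_integrable M f" and g: "square_integrable M g"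
  shows "integrable M (\<lambda>x. f x * g x)"
proof (rule Bochner_Integration.integrable_bound)
  have [measurable]: "f \<in> borel_measurable M" "g \<in> borel_measurable M"
    using f g by (auto dest: square_integrable_measurable)
  show "(\<lambda>x. f x * g x) \<in> borel_measurable M" by measurable
  show "integrable M (\<lambda>x. (f x)\<^sup>2 + (g x)\<^sup>2)"
    using f g by (auto simp: square_integrable_def)
  have "\<bar>f x * g x\<bar> \<le> (f x)\<^sup>2 + (g x)\<^sup>2" for x
  proof -
    have "2 * (\<bar>f x\<bar> * \<bar>g x\<bar>) \<le> (f x)\<^sup>2 + (g x)\<^sup>2"
      using sum_squares_bound[of "\<bar>f x\<bar>" "\<bar>g x\<bar>"] by (simp add: mult.assoc)
    moreover have "0 \<le> \<bar>f x\<bar> * \<bar>g x\<bar>" by simp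
    ultimately show ?thesis unfolding abs_mult by linarith
  qed
  then show "AE x in M. norm (f x * g x) \<le> norm ((f x)\<^sup>2 + (g x)\<^sup>2)" by auto
qed

lemma square_integrable_cmult: "square_integrable M f \<Longrightarrow> square_integrable M (\<lambda>x. c * f x)"
  by (auto simp: square_integrable_def power_mult_distrib)

lemma square_integrable_add:
  assumes f: "square_integrable M f" and g: "square_integrable M g"
  shows "square_integrable M (\<lambda>x. f x + g x)"
  unfolding square_integrable_def power2_sum
  using square_integrable_mult[OF f g] f g by (auto simp: square_integrable_def mult.assoc)

lemma square_integrable_diff:
  assumes f: "square_integrable M f" and g: "square_integrable M g"
  shows "square_integrable M (\<lambda>x. f x - g x)"
  using square_integrable_add[OF f square_integrable_cmult[OF g, of "-1"]] by simp

lemma square_integrable_zero [simp]: "square_integrable M (\<lambda>x. 0)"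
  by (simp add: square_integrable_def)

lemma square_integrable_sum:
  assumes "\<And>i. i \<in> S \<Longrightarrow> square_integrable M (f i)"
  shows "square_integrable M (\<lambda>x. \<Sum>i\<in>S. f i x)"
  using assms by (induction S rule: infinite_finite_induct) (simp_all add: square_integrable_add)

lemma square_integrable_sum_list:
  assumes "\<And>i. i \<in> set S \<Longrightarrow> square_integrable M (f i)"
  shows "square_integrable M (\<lambda>x. \<Sum>i\<leftarrow>S. f i x)"
  using assms by (induction S) (simp_all add: square_integrable_add)

lemma Cauchy_Schwarz_integral:
  assumes f: "square_integrable M f" and g: "square_integrable M g"
  shows "(\<integral>x. f x * g x \<partial>M)\<^sup>2 \<le> (\<integral>x. (f x)\<^sup>2 \<partial>M) * (\<integral>x. (g x)\<^sup>2 \<partial>M)"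
proof -
  let ?A = "\<integral>x. (f x)\<^sup>2 \<partial>M" and ?B = "\<integral>x. f x * g x \<partial>M" and ?C = "\<integral>x. (g x)\<^sup>2 \<partial>M"
  have quad: "0 \<le> ?A + 2 * t * ?B + t\<^sup>2 * ?C" for t
  proof -
    have "0 \<le> (\<integral>x. (f x + t * g x)\<^sup>2 \<partial>M)" by simp
    also have "(\<integral>x. (f x + t * g x)\<^sup>2 \<partial>M) = (\<integral>x. (f x)\<^sup>2 + 2 * t * (f x * g x) + t\<^sup>2 * (g x)\<^sup>2 \<partial>M)"
      by (intro Bochner_Integration.integral_cong) (auto simp: power2_eq_square algebra_simps)
    also have "\<dots> = ?A + 2 * t * ?B + t\<^sup>2 * ?C"
      using square_integrable_power2[OF f] square_integrable_power2[OF g] square_integrable_mult[OF f g] by simp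
    finally show ?thesis .
  qed
  have C: "0 \<le> ?C" by simp
  show ?thesis
  proof (cases "?C = 0")
    case True
    have "?B = 0"
    proof (rule ccontr)
      assume B: "?B \<noteq> 0"
      \<comment> \<open>here the quadratic is affine in \<open>t\<close>, and this choice makes it equal to \<open>-1\<close>\<close>
      have "0 \<le> ?A + 2 * (- (?A + 1) / (2 * ?B)) * ?B"
        using quad[of "- (?A + 1) / (2 * ?B)"] True by simp
      then show False using B by (simp add: field_simps)
    qed
    then show ?thesis by simp
  next
    case False
    with C have C: "0 < ?C" by linarith
    have "0 \<le> ?A + 2 * (- ?B / ?C) * ?B + (- ?B / ?C)\<^sup>2 * ?C" by (rule quad)
    also have "\<dots> = ?A - ?B\<^sup>2 / ?C" using C by (simp add: power2_eq_square field_simps)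
    finally show ?thesis using C by (simp add: field_simps)
  qed
qed

lemma tendsto_L2_inner:
  assumes f: "\<And>n. square_integrable M (fs n)" "square_integrable M f"
    and g: "\<And>n. square_integrable M (gs n)" "square_integrable M g"
    and lf: "(\<lambda>n. \<integral>x. (fs n x - f x)\<^sup>2 \<partial>M) \<longlonglongrightarrow> 0" and lg: "(\<lambda>n. \<integral>x. (gs n x - g x)\<^sup>2 \<partial>M) \<longlonglongrightarrow> 0"
  shows "(\<lambda>n. \<integral>x. fs n x * gs n x \<partial>M) \<longlonglongrightarrow> (\<integral>x. f x * g x \<partial>M)"
proof -
  define F where "F n x = fs n x - f x" for n x
  define G where "G n x = gs n x - g x" for n x
  have F: "square_integrable M (F n)" and G: "square_integrable M (G n)" for n
    using square_integrable_diff[OF f(1)[of n] f(2)] square_integrable_diff[OF g(1)[of n] g(2)]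
    by (simp_all add: F_def[abs_def] G_def[abs_def])
  have small: "(\<lambda>n. \<integral>x. u n x * v n x \<partial>M) \<longlonglongrightarrow> 0"
    if u: "\<And>n. square_integrable M (u n)" and v: "\<And>n. square_integrable M (v n)"
      and l: "(\<lambda>n. (\<integral>x. (u n x)\<^sup>2 \<partial>M) * (\<integral>x. (v n x)\<^sup>2 \<partial>M)) \<longlonglongrightarrow> 0" for u v
  proof -
    have lim: "(\<lambda>n. sqrt ((\<integral>x. (u n x)\<^sup>2 \<partial>M) * (\<integral>x. (v n x)\<^sup>2 \<partial>M))) \<longlonglongrightarrow> 0"
      using tendsto_real_sqrt[OF l] by simp
    have bound: "norm (\<integral>x. u n x * v n x \<partial>M) \<le> sqrt ((\<integral>x. (u n x)\<^sup>2 \<partial>M) * (\<integral>x. (v n x)\<^sup>2 \<partial>M))" for n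
      using real_sqrt_le_mono[OF Cauchy_Schwarz_integral[OF u v, of n n]]
      unfolding real_sqrt_abs real_norm_def .
    show ?thesis
      by (rule Lim_null_comparison[OF always_eventually[OF allI[OF bound]] lim])
  qed
  have lF: "(\<lambda>n. \<integral>x. (F n x)\<^sup>2 \<partial>M) \<longlonglongrightarrow> 0" and lG: "(\<lambda>n. \<integral>x. (G n x)\<^sup>2 \<partial>M) \<longlonglongrightarrow> 0"
    unfolding F_def G_def by (rule lf, rule lg)
  have s1: "(\<lambda>n. \<integral>x. F n x * G n x \<partial>M) \<longlonglongrightarrow> 0"
    by (rule small[OF F G]) (use tendsto_mult[OF lF lG] in \<open>simp only: mult_zero_left\<close>)
  have s2: "(\<lambda>n. \<integral>x. f x * G n x \<partial>M) \<longlonglongrightarrow> 0"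
    by (rule small[where u="\<lambda>_. f", OF f(2) G]) (rule tendsto_mult_right_zero[OF lG])
  have s3: "(\<lambda>n. \<integral>x. F n x * g x \<partial>M) \<longlonglongrightarrow> 0"
    by (rule small[where v="\<lambda>_. g", OF F g(2)]) (rule tendsto_mult_left_zero[OF lF])
  have "(\<lambda>n. (\<integral>x. F n x * G n x \<partial>M) + (\<integral>x. f x * G n x \<partial>M) + (\<integral>x. F n x * g x \<partial>M) + (\<integral>x. f x * g x \<partial>M))
      \<longlonglongrightarrow> 0 + 0 + 0 + (\<integral>x. f x * g x \<partial>M)"
    by (rule tendsto_add[OF tendsto_add[OF tendsto_add[OF s1 s2] s3] tendsto_const])
  moreover have "(\<integral>x. fs n x * gs n x \<partial>M) = (\<integral>x. F n x * G n x \<partial>M) + (\<integral>x. f x * G n x \<partial>M) + (\<integral>x. F n x * g x \<partial>M) + (\<integral>x. f x * g x \<partial>M)" for n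
  proof -
    have "(\<integral>x. fs n x * gs n x \<partial>M) = (\<integral>x. F n x * G n x + f x * G n x + F n x * g x + f x * g x \<partial>M)"
      by (intro Bochner_Integration.integral_cong) (auto simp: F_def G_def algebra_simps)
    then show ?thesis
      using square_integrable_mult[OF F G, of n n] square_integrable_mult[OF f(2) G, of n] square_integrable_mult[OF F g(2), of n] square_integrable_mult[OF f(2) g(2)]
      by simp
  qed
  ultimately show ?thesis by simp
qed

lemma L2_norm_sq_eq: "square_integrable M f \<Longrightarrow> L2_norm_sq M f = ennreal (\<integral>x. (f x)\<^sup>2 \<partial>M)"
  unfolding L2_norm_sq_def by (intro nn_integral_eq_integral square_integrable_power2) auto

lemma square_integrableI:
  "f \<in> borel_measurable M \<Longrightarrow> L2_norm_sq M f < \<infinity> \<Longrightarrow> square_integrable M f"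
  unfolding square_integrable_def L2_norm_sq_def by (auto intro!: integrableI_nonneg)

lemma L2_limit:
  assumes f: "\<And>n. square_integrable M (fs n)" and [measurable]: "f \<in> borel_measurable M"
    and l: "(\<lambda>n. L2_norm_sq M (\<lambda>x. fs n x - f x)) \<longlonglongrightarrow> 0"
  shows "square_integrable M f" "(\<lambda>n. \<integral>x. (fs n x - f x)\<^sup>2 \<partial>M) \<longlonglongrightarrow> 0"
proof -
  have [measurable]: "fs n \<in> borel_measurable M" for n using f by (rule square_integrable_measurable)
  have "\<forall>\<^sub>F n in sequentially. L2_norm_sq M (\<lambda>x. fs n x - f x) < 1"
    using l by (rule order_tendstoD) simp
  then obtain n where "L2_norm_sq M (\<lambda>x. fs n x - f x) < 1"
    by (auto simp: eventually_sequentially)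
  then have "square_integrable M (\<lambda>x. fs n x - f x)"
    by (intro square_integrableI) (auto intro: less_trans)
  from square_integrable_diff[OF f[of n] this] show sf: "square_integrable M f" by simp
  have "L2_norm_sq M (\<lambda>x. fs n x - f x) = ennreal (\<integral>x. (fs n x - f x)\<^sup>2 \<partial>M)" for n
    by (intro L2_norm_sq_eq square_integrable_diff f sf)
  with l have "(\<lambda>n. ennreal (\<integral>x. (fs n x - f x)\<^sup>2 \<partial>M)) \<longlonglongrightarrow> ennreal 0" by simp
  then show "(\<lambda>n. \<integral>x. (fs n x - f x)\<^sup>2 \<partial>M) \<longlonglongrightarrow> 0"
    by (subst (asm) tendsto_ennreal_iff) auto
qed

text \<open>Bilinearity of the inner product for simple processes, which are lists with possible repetitions and
overlaps.\<close>

lemma integral_sum_list_mult: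
  assumes F: "\<And>e. e \<in> set p \<Longrightarrow> square_integrable M (F e)" and G: "\<And>e. e \<in> set q \<Longrightarrow> square_integrable M (G e)"
  shows "(\<integral>x. (\<Sum>e\<leftarrow>p. F e x) * (\<Sum>e\<leftarrow>q. G e x) \<partial>M) = (\<Sum>e\<leftarrow>p. \<Sum>e'\<leftarrow>q. \<integral>x. F e x * G e' x \<partial>M)"
  using F
proof (induction p)
  case (Cons e p)
  have *: "(\<integral>x. f x * (\<Sum>e\<leftarrow>q. G e x) \<partial>M) = (\<Sum>e'\<leftarrow>q. \<integral>x. f x * G e' x \<partial>M)"
    if f: "square_integrable M f" for f
    using G
  proof (induction q)
    case (Cons e q)
    have "square_integrable M (\<lambda>x. \<Sum>e\<leftarrow>q. G e x)" using Cons.prems by (intro square_integrable_sum_list) auto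
    then show ?case
      using Cons square_integrable_mult[OF f] by (simp add: distrib_left)
  qed simp
  have q: "square_integrable M (\<lambda>x. \<Sum>e\<leftarrow>q. G e x)" using G by (intro square_integrable_sum_list) auto
  have p: "square_integrable M (\<lambda>x. \<Sum>e\<leftarrow>p. F e x)" using Cons.prems by (intro square_integrable_sum_list) auto
  have e: "square_integrable M (F e)" using Cons.prems by auto
  show ?case
    using Cons *[OF e] square_integrable_mult[OF p q] square_integrable_mult[OF e q]
    by (simp add: distrib_right)
qed simp


section \<open>Fourier transforms and Gaussian random variables\<close>

context prob_space begin

lemma square_integrable_const: "square_integrable M (\<lambda>_. c)"
  by (simp add: square_integrable_def)

lemma square_integrable_integrable: "square_integrable M X \<Longrightarrow> integrable M X"
  using square_integrable_mult[of M X "\<lambda>_. 1"] square_integrable_const[of 1] by simp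

text \<open>After adding a constant, \<open>Z\<close> becomes a probability density, up to a factor. The distribution of \<open>Y\<close> under
that density has the same characteristic function as the original one, and Levy's
uniqueness theorem identifies the two.\<close>

lemma fourier_zero_imp_indicator_zero_real:
  fixes Z Y :: "'a \<Rightarrow> real"
  assumes [measurable]: "Z \<in> borel_measurable M" "Y \<in> borel_measurable M"
    and bd: "\<And>x. x \<in> space M \<Longrightarrow> \<bar>Z x\<bar> \<le> C"
    and zero: "\<And>c. (CLINT x|M. iexp (c * Y x) * complex_of_real (Z x)) = 0"
    and B [measurable]: "B \<in> sets borel"
  shows "(\<integral>x. indicator B (Y x) * Z x \<partial>M) = 0"
proof -
  define K where "K = \<bar>C\<bar> + 1"
  have "\<bar>Z x\<bar> \<le> K" if "x \<in> space M" for x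
    using bd[OF that] by (simp add: K_def)
  moreover have "0 < K" by (simp add: K_def)
  ultimately have K: "0 < K" "\<And>x. x \<in> space M \<Longrightarrow> \<bar>Z x\<bar> \<le> K" by auto
  have intZ: "integrable M Z" by (rule integrable_const_bound[where B=K]) (use K in auto)
  \<comment> \<open>the mean of \<open>Z\<close> is zero (take \<open>c = 0\<close>), so this density has total mass one\<close>
  let ?q = "\<lambda>x. (Z x + K) / K"
  have q: "\<And>x. x \<in> space M \<Longrightarrow> 0 \<le> ?q x" using K by (auto simp: abs_le_iff divide_simps) (smt (verit))
  have "complex_of_real (\<integral>x. Z x \<partial>M) = 0"
    using zero[of 0] by simp
  then have Z0: "(\<integral>x. Z x \<partial>M) = 0" by simp
  let ?P = "density M ?q"
  have "emeasure ?P (space ?P) = (\<integral>\<^sup>+x. ennreal (?q x) \<partial>M)"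
    by (simp add: emeasure_density cong: nn_integral_cong)
  also have "\<dots> = ennreal (\<integral>x. ?q x \<partial>M)"
    using intZ q by (intro nn_integral_eq_integral) auto
  also have "(\<integral>x. ?q x \<partial>M) = 1" using intZ Z0 K by (simp add: prob_space)
  finally interpret P: prob_space ?P by (intro prob_spaceI) simp
  let ?D = "distr M borel Y" and ?D' = "distr ?P borel Y"
  have qae: "AE x in M. 0 \<le> ?q x" using q by auto
  have "char ?D' = char ?D"
  proof
    fix c
    have "char ?D' c = (CLINT x|M. ?q x *\<^sub>R iexp (c * Y x))"
      unfolding char_def using qae by (subst integral_distr) (auto simp: integral_density)
    also have "\<dots> = (CLINT x|M. iexp (c * Y x) * complex_of_real (Z x) / complex_of_real K + iexp (c * Y x))"
      using K by (intro Bochner_Integration.integral_cong) (auto simp: scaleR_conv_of_real field_simps)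
    also have "\<dots> = (CLINT x|M. iexp (c * Y x) * complex_of_real (Z x)) / complex_of_real K + (CLINT x|M. iexp (c * Y x))"
    proof -
      have "integrable M (\<lambda>x. iexp (c * Y x) * complex_of_real (Z x))"
        by (rule integrable_const_bound[where B=K]) (use K in \<open>auto simp: norm_mult\<close>)
      moreover have "integrable M (\<lambda>x. iexp (c * Y x))"
        by (rule integrable_const_bound[where B=1]) auto
      ultimately show ?thesis by simp
    qed
    also have "\<dots> = char ?D c" unfolding zero char_def by (subst integral_distr) auto
    finally show "char ?D' c = char ?D c" .
  qed
  then have D: "?D' = ?D"
    by (intro Levy_uniqueness P.real_distribution_distr real_distribution_distr) auto
  have "(\<integral>x. (indicator B (Y x) :: real) \<partial>M) = (\<integral>x. indicator B x \<partial>?D)"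
    by (subst integral_distr) auto
  also have "\<dots> = (\<integral>x. ?q x * indicator B (Y x) \<partial>M)"
    unfolding D[symmetric] using qae by (subst integral_distr) (auto simp: integral_density)
  also have "\<dots> = (\<integral>x. indicator B (Y x) * Z x / K + indicator B (Y x) \<partial>M)"
    using K by (intro Bochner_Integration.integral_cong) (auto simp: field_simps)
  also have "\<dots> = (\<integral>x. indicator B (Y x) * Z x \<partial>M) / K + (\<integral>x. (indicator B (Y x) :: real) \<partial>M)"
  proof -
    have "integrable M (\<lambda>x. indicator B (Y x) * Z x)"
      by (rule integrable_const_bound[where B=K]) (use K in \<open>auto simp: indicator_def\<close>)
    moreover have "integrable M (\<lambda>x. indicator B (Y x) :: real)"
      by (rule integrable_const_bound[where B=1]) (auto simp: indicator_def)
    ultimately show ?thesis by simp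
  qed
  finally show ?thesis using K by simp
qed

lemma cnj_iexp: "cnj (iexp x) = iexp (- x)"
  unfolding cis_conv_exp[symmetric] cis_cnj ..

text \<open>The real and the imaginary part of \<open>Z\<close> inherit the hypothesis, because the complex conjugate of
\<open>exp(i c Y) Z\<close> is \<open>exp(- i c Y)\<close> times the conjugate of \<open>Z\<close>, and \<open>c\<close> is arbitrary.\<close>

lemma fourier_zero_imp_indicator_zero:
  fixes Z :: "'a \<Rightarrow> complex" and Y :: "'a \<Rightarrow> real"
  assumes [measurable]: "Z \<in> borel_measurable M" "Y \<in> borel_measurable M"
    and bd: "\<And>x. x \<in> space M \<Longrightarrow> norm (Z x) \<le> C"
    and zero: "\<And>c. (CLINT x|M. iexp (c * Y x) * Z x) = 0"
    and B [measurable]: "B \<in> sets borel"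
  shows "(CLINT x|M. indicator B (Y x) * Z x) = 0"
proof -
  have int: "integrable M (\<lambda>x. f x * V x)"
    if [measurable]: "f \<in> borel_measurable M" "V \<in> borel_measurable M"
      and "\<And>x. x \<in> space M \<Longrightarrow> norm (f x) \<le> 1" "\<And>x. x \<in> space M \<Longrightarrow> norm (V x) \<le> C" for f V :: "'a \<Rightarrow> complex"
  proof (rule integrable_const_bound[where B=C])
    have "norm (f x * V x) \<le> 1 * C" if "x \<in> space M" for x
      unfolding norm_mult using that by (intro mult_mono) (auto simp: \<open>\<And>x. x \<in> space M \<Longrightarrow> norm (f x) \<le> 1\<close> \<open>\<And>x. x \<in> space M \<Longrightarrow> norm (V x) \<le> C\<close>)
    then show "AE x in M. norm (f x * V x) \<le> C" by auto
  qed simp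
  have Re: "(\<integral>x. indicator B (Y x) * Re (V x) \<partial>M) = 0"
    if V [measurable]: "V \<in> borel_measurable M" and Vb: "\<And>x. x \<in> space M \<Longrightarrow> norm (V x) \<le> C"
      and V0: "\<And>c. (CLINT x|M. iexp (c * Y x) * V x) = 0" for V
  proof (rule fourier_zero_imp_indicator_zero_real[where C=C])
    fix c
    have [measurable]: "(\<lambda>x. cnj (V x)) \<in> borel_measurable M"
      by (rule measurable_compose[OF V borel_measurable_continuous_onI[of cnj]]) (auto intro!: continuous_intros)
    have "(CLINT x|M. iexp (c * Y x) * cnj (V x)) = (CLINT x|M. cnj (iexp (- c * Y x) * V x))"
      by (intro Bochner_Integration.integral_cong) (simp_all only: complex_cnj_mult cnj_iexp minus_mult_left[symmetric] minus_minus)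
    also have "\<dots> = cnj (CLINT x|M. iexp (- c * Y x) * V x)" by (rule Bochner_Integration.integral_cnj)
    also have "\<dots> = 0" by (simp only: V0 complex_cnj_zero)
    finally have cnj0: "(CLINT x|M. iexp (c * Y x) * cnj (V x)) = 0" .
    have "(CLINT x|M. iexp (c * Y x) * complex_of_real (Re (V x))) =
        (CLINT x|M. (iexp (c * Y x) * V x + iexp (c * Y x) * cnj (V x)) / 2)"
      by (intro Bochner_Integration.integral_cong) (auto simp: complex_add_cnj distrib_left[symmetric])
    also have "\<dots> = 0"
      using int[of "\<lambda>x. iexp (c * Y x)" V] int[of "\<lambda>x. iexp (c * Y x)" "\<lambda>x. cnj (V x)"] Vb V0[of c] cnj0
      by simp
    finally show "(CLINT x|M. iexp (c * Y x) * complex_of_real (Re (V x))) = 0" .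
  qed (auto intro: order_trans[OF abs_Re_le_cmod Vb])
  have zero': "(CLINT x|M. iexp (c * Y x) * (- \<i> * Z x)) = 0" for c
  proof -
    have "(CLINT x|M. iexp (c * Y x) * (- \<i> * Z x)) = (CLINT x|M. - \<i> * (iexp (c * Y x) * Z x))"
      by (intro Bochner_Integration.integral_cong) (auto simp: ac_simps)
    then show ?thesis unfolding integral_mult_right_zero zero by simp
  qed
  have re: "(\<integral>x. indicator B (Y x) * Re (Z x) \<partial>M) = 0"
    by (rule Re) (use bd zero in auto)
  have im: "(\<integral>x. indicator B (Y x) * Re (- \<i> * Z x) \<partial>M) = 0"
    by (rule Re[OF _ _ zero']) (use bd in \<open>auto simp: norm_mult\<close>)
  have i: "integrable M (\<lambda>x. indicator B (Y x) * Z x)"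
    using bd by (intro int) (auto simp: indicator_def)
  have "Re (indicator B (Y x) * Z x) = indicator B (Y x) * Re (Z x)"
    "Im (indicator B (Y x) * Z x) = indicator B (Y x) * Re (- \<i> * Z x)" for x
    by (auto simp: indicator_def)
  then show ?thesis
    using integral_Re[OF i] integral_Im[OF i] re im by (auto simp: complex_eq_iff)
qed


lemma centred_gaussian_moments:
  assumes X: "centred_gaussian M X"
  shows "square_integrable M X" "expectation X = 0"
    "(CLINT x|M. iexp (X x)) = complex_of_real (exp (- expectation (\<lambda>x. (X x)\<^sup>2) / 2))"
proof -
  have [measurable]: "X \<in> borel_measurable M" using X by (simp add: centred_gaussian_def)
  have "square_integrable M X \<and> expectation X = 0 \<and>
    (CLINT x|M. iexp (X x)) = complex_of_real (exp (- expectation (\<lambda>x. (X x)\<^sup>2) / 2))"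
  proof (cases "AE x in M. X x = 0")
    case True
    then have "AE x in M. (X x)\<^sup>2 = 0" "AE x in M. iexp (X x) = 1" by auto
    note ae = this
    have "expectation (\<lambda>x. (X x)\<^sup>2) = expectation (\<lambda>x. 0)" using ae by (intro integral_cong_AE) auto
    moreover have "expectation X = expectation (\<lambda>x. 0)" using True by (intro integral_cong_AE) auto
    moreover have "(CLINT x|M. iexp (X x)) = (CLINT x|M. 1)" using ae by (intro integral_cong_AE) auto
    moreover have "integrable M (\<lambda>x. (X x)\<^sup>2)" using ae by (subst integrable_cong_AE[where g="\<lambda>_. 0"]) auto
    ultimately show ?thesis by (simp add: square_integrable_def prob_space)
  next
    case False
    then obtain s where s: "0 < s" and D: "distributed M lborel X (normal_density 0 s)"
      using X by (auto simp: centred_gaussian_def)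
    have e: "expectation X = 0" using normal_distributed_expectation[OF s D] .
    have v: "expectation (\<lambda>x. (X x)\<^sup>2) = s\<^sup>2"
      using normal_distributed_variance[OF s D] e by simp
    have sq: "square_integrable M X"
      unfolding square_integrable_def
      using v s not_integrable_integral_eq[of M "\<lambda>x. (X x)\<^sup>2"] by auto
    have "distributed M lborel (\<lambda>x. (X x - 0) / s) std_normal_density"
      using D normal_standard_normal_convert[OF s, where X=X and \<mu>=0] by simp
    then have "distr M lborel (\<lambda>x. X x / s) = std_normal_distribution"
      by (simp add: distributed_distr_eq_density)
    then have d: "distr M borel (\<lambda>x. X x / s) = std_normal_distribution"
      by (subst distr_cong[of M M borel lborel, OF refl]) auto
    have "char (distr M borel (\<lambda>x. X x / s)) s = (CLINT x|M. iexp (X x))"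
      unfolding char_def using s by (subst integral_distr) auto
    then have "(CLINT x|M. iexp (X x)) = complex_of_real (exp (- s\<^sup>2 / 2))"
      unfolding d char_std_normal_distribution by simp
    then show ?thesis unfolding v using sq e by blast
  qed
  then show "square_integrable M X" "expectation X = 0"
    "(CLINT x|M. iexp (X x)) = complex_of_real (exp (- expectation (\<lambda>x. (X x)\<^sup>2) / 2))" by auto
qed

end


section \<open>Increments of the noise are independent of the past\<close>

locale white_noise_space = prob_space M for M :: "'a measure" +
  fixes W :: "(real \<times> real) set \<Rightarrow> 'a \<Rightarrow> real"
  assumes white_noise: "white_noise M W"

context white_noise_space begin

text \<open>The Gaussian space of the noise, without its limit points.\<close>

definition noise_span :: "('a \<Rightarrow> real) set" where
  "noise_span = {\<lambda>x. \<Sum>A\<in>S. c A * W A x | S c. finite S \<and> S \<subseteq> noise_sets}"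

lemma noise_span_W: "A \<in> noise_sets \<Longrightarrow> W A \<in> noise_span"
  unfolding noise_span_def by (intro CollectI exI[of _ "{A}"] exI[of _ "\<lambda>_. 1"]) auto

lemma noise_span_cmult:
  assumes "Y \<in> noise_span" shows "(\<lambda>x. k * Y x) \<in> noise_span"
proof -
  obtain S c where S: "finite S" "S \<subseteq> noise_sets" "Y = (\<lambda>x. \<Sum>A\<in>S. c A * W A x)"
    using assms by (auto simp: noise_span_def)
  then show ?thesis
    unfolding noise_span_def
    by (intro CollectI exI[of _ S] exI[of _ "\<lambda>A. k * c A"]) (auto simp: sum_distrib_left mult.assoc)
qed

lemma noise_span_add:
  assumes "Y \<in> noise_span" "Z \<in> noise_span" shows "(\<lambda>x. Y x + Z x) \<in> noise_span"
proof -
  obtain S c where S: "finite S" "S \<subseteq> noise_sets" "Y = (\<lambda>x. \<Sum>A\<in>S. c A * W A x)"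
    using assms(1) by (auto simp: noise_span_def)
  obtain S' c' where S': "finite S'" "S' \<subseteq> noise_sets" "Z = (\<lambda>x. \<Sum>A\<in>S'. c' A * W A x)"
    using assms(2) by (auto simp: noise_span_def)
  let ?c = "\<lambda>A. (if A \<in> S then c A else 0) + (if A \<in> S' then c' A else 0)"
  have "Y x + Z x = (\<Sum>A\<in>S \<union> S'. ?c A * W A x)" for x
  proof -
    have "(\<Sum>A\<in>S. c A * W A x) = (\<Sum>A\<in>S \<union> S'. (if A \<in> S then c A else 0) * W A x)"
      using S(1) S'(1) by (intro sum.mono_neutral_cong_left) auto
    moreover have "(\<Sum>A\<in>S'. c' A * W A x) = (\<Sum>A\<in>S \<union> S'. (if A \<in> S' then c' A else 0) * W A x)"
      using S(1) S'(1) by (intro sum.mono_neutral_cong_left) auto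
    ultimately show ?thesis
      unfolding S(3) S'(3) by (simp only: sum.distrib distrib_right)
  qed
  then have "(\<lambda>x. Y x + Z x) = (\<lambda>x. \<Sum>A\<in>S \<union> S'. ?c A * W A x)" by (rule ext)
  then show ?thesis
    unfolding noise_span_def using S S' by (intro CollectI exI[of _ "S \<union> S'"] exI[of _ ?c]) simp
qed

lemma noise_span_diff:
  assumes "Y \<in> noise_span" "Z \<in> noise_span" shows "(\<lambda>x. Y x - Z x) \<in> noise_span"
  using noise_span_add[OF assms(1) noise_span_cmult[OF assms(2), of "-1"]] by simp

lemma noise_span_gaussian: "Y \<in> noise_span \<Longrightarrow> centred_gaussian M Y"
  using white_noise unfolding white_noise_def noise_span_def by auto

lemmas noise_span_L2 = centred_gaussian_moments(1)[OF noise_span_gaussian]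

lemmas noise_span_mean = centred_gaussian_moments(2)[OF noise_span_gaussian]

lemmas noise_span_char = centred_gaussian_moments(3)[OF noise_span_gaussian]

lemmas noise_span_measurable = square_integrable_measurable[OF noise_span_L2]

text \<open>Variances of orthogonal elements add, and the characteristic function of a centred Gaussian variable is
determined by its variance.\<close>

lemma char_orthogonal:
  assumes Y: "Y \<in> noise_span" and N: "N \<in> noise_span" and o: "expectation (\<lambda>x. Y x * N x) = 0"
  shows "(CLINT x|M. iexp (Y x) * iexp (N x)) = (CLINT x|M. iexp (Y x)) * (CLINT x|M. iexp (N x))"
proof -
  have "expectation (\<lambda>x. (Y x + N x)\<^sup>2) = expectation (\<lambda>x. (Y x)\<^sup>2 + 2 * (Y x * N x) + (N x)\<^sup>2)"
    by (intro Bochner_Integration.integral_cong) (auto simp: power2_sum)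
  also have "\<dots> = expectation (\<lambda>x. (Y x)\<^sup>2) + expectation (\<lambda>x. (N x)\<^sup>2)"
    using square_integrable_mult[OF noise_span_L2[OF Y] noise_span_L2[OF N]] o
      square_integrable_power2[OF noise_span_L2[OF Y]] square_integrable_power2[OF noise_span_L2[OF N]]
    by simp
  finally have v: "expectation (\<lambda>x. (Y x + N x)\<^sup>2) = expectation (\<lambda>x. (Y x)\<^sup>2) + expectation (\<lambda>x. (N x)\<^sup>2)" .
  have "(CLINT x|M. iexp (Y x) * iexp (N x)) = (CLINT x|M. iexp (Y x + N x))"
    by (intro Bochner_Integration.integral_cong) (auto simp: exp_add distrib_left)
  also have "\<dots> = complex_of_real (exp (- (expectation (\<lambda>x. (Y x)\<^sup>2) + expectation (\<lambda>x. (N x)\<^sup>2)) / 2))"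
    using noise_span_char[OF noise_span_add[OF Y N]] v by simp
  also have "\<dots> = complex_of_real (exp (- expectation (\<lambda>x. (Y x)\<^sup>2) / 2) * exp (- expectation (\<lambda>x. (N x)\<^sup>2) / 2))"
    by (simp add: exp_add[symmetric] add_divide_distrib)
  finally show ?thesis
    unfolding noise_span_char[OF Y] noise_span_char[OF N] of_real_mult .
qed

text \<open>The indicator of a cylinder event, as a product.\<close>

definition cyl :: "(('a \<Rightarrow> real) \<times> real set) list \<Rightarrow> 'a \<Rightarrow> complex" where
  "cyl ps x = (\<Prod>(Y, B)\<leftarrow>ps. indicator B (Y x))"

lemma cyl_Cons: "cyl ((Y, B) # ps) x = indicator B (Y x) * cyl ps x"
  by (simp add: cyl_def)

lemma cyl_norm: "norm (cyl ps x) \<le> 1"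
  by (induction ps) (auto simp: cyl_def norm_mult indicator_def)

lemma cyl_measurable:
  assumes "\<And>Y B. (Y, B) \<in> set ps \<Longrightarrow> Y \<in> borel_measurable M \<and> B \<in> sets borel"
  shows "cyl ps \<in> borel_measurable M"
  using assms
proof (induction ps)
  case (Cons p ps)
  obtain Y B where p: "p = (Y, B)" by (cases p)
  have [measurable]: "Y \<in> borel_measurable M" "B \<in> sets borel" "cyl ps \<in> borel_measurable M"
    using Cons p by auto
  show ?case unfolding p cyl_Cons[abs_def] by measurable
qed (simp add: cyl_def[abs_def])

text \<open>By induction on the number of indicators. The term \<open>V\<close> keeps the exponentials that are not yet converted:
with the remaining factors collected in one bounded variable \<open>Z\<close>, the induction hypothesis says that
\<open>exp(i c Y) Z\<close> has mean zero for all \<open>c\<close>, and then an indicator of \<open>Y\<close> may replace the exponential.\<close>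

lemma cyl_fourier:
  assumes N: "N \<in> noise_span"
    and ps: "\<And>Y B. (Y, B) \<in> set ps \<Longrightarrow> Y \<in> noise_span \<and> B \<in> sets borel \<and> expectation (\<lambda>x. Y x * N x) = 0"
    and V: "V \<in> noise_span" "expectation (\<lambda>x. V x * N x) = 0"
  shows "(CLINT x|M. cyl ps x * (iexp (V x) * (iexp (N x) - (CLINT x|M. iexp (N x))))) = 0"
  using ps V
proof (induction ps arbitrary: V)
  case Nil
  have [measurable]: "V \<in> borel_measurable M" "N \<in> borel_measurable M"
    using noise_span_measurable Nil N by auto
  have i: "integrable M (\<lambda>x. iexp (V x) * iexp (N x))" "integrable M (\<lambda>x. iexp (V x))"
    by (rule integrable_const_bound[where B=1]; simp add: norm_mult)+
  have "(CLINT x|M. cyl [] x * (iexp (V x) * (iexp (N x) - (CLINT x|M. iexp (N x))))) =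
     (CLINT x|M. iexp (V x) * iexp (N x)) - (CLINT x|M. iexp (V x)) * (CLINT x|M. iexp (N x))"
    using i by (simp add: cyl_def right_diff_distrib)
  then show ?case using char_orthogonal[OF Nil(2) N Nil(3)] by simp
next
  case (Cons p ps)
  obtain Y B where p: "p = (Y, B)" by (cases p)
  have Y: "Y \<in> noise_span" "B \<in> sets borel" "expectation (\<lambda>x. Y x * N x) = 0"
    using Cons.prems(1)[of Y B] p by auto
  have ps: "\<And>Y B. (Y, B) \<in> set ps \<Longrightarrow> Y \<in> noise_span \<and> B \<in> sets borel \<and> expectation (\<lambda>x. Y x * N x) = 0"
    using Cons.prems(1) by auto
  have [measurable]: "Y \<in> borel_measurable M" "V \<in> borel_measurable M" "N \<in> borel_measurable M" "cyl ps \<in> borel_measurable M"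
    using noise_span_measurable Cons.prems N Y ps by (auto intro!: cyl_measurable)
  let ?\<phi> = "CLINT x|M. iexp (N x)"
  let ?Z = "\<lambda>x. cyl ps x * (iexp (V x) * (iexp (N x) - ?\<phi>))"
  have "(CLINT x|M. indicator B (Y x) * ?Z x) = 0"
  proof (rule fourier_zero_imp_indicator_zero[where C = "1 * (1 * (1 + norm ?\<phi>))"])
    fix x
    have "norm (iexp (N x) - ?\<phi>) \<le> norm (iexp (N x)) + norm ?\<phi>" by (rule norm_triangle_ineq4)
    then have "norm (iexp (N x) - ?\<phi>) \<le> 1 + norm ?\<phi>" by simp
    then show "norm (?Z x) \<le> 1 * (1 * (1 + norm ?\<phi>))"
      unfolding norm_mult by (intro mult_mono cyl_norm) auto
  next
    fix c
    let ?V = "\<lambda>x. c * Y x + V x"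
    have "expectation (\<lambda>x. ?V x * N x) = expectation (\<lambda>x. c * (Y x * N x) + V x * N x)"
      by (intro Bochner_Integration.integral_cong) (auto simp: algebra_simps)
    also have "\<dots> = 0"
      using Y Cons.prems(2,3) square_integrable_mult[OF noise_span_L2[OF Y(1)] noise_span_L2[OF N]]
        square_integrable_mult[OF noise_span_L2[OF Cons.prems(2)] noise_span_L2[OF N]] by simp
    finally have "(CLINT x|M. cyl ps x * (iexp (?V x) * (iexp (N x) - ?\<phi>))) = 0"
      using Cons.prems Y by (intro Cons.IH ps noise_span_add noise_span_cmult)
    moreover have "(\<lambda>x. iexp (c * Y x) * ?Z x) = (\<lambda>x. cyl ps x * (iexp (?V x) * (iexp (N x) - ?\<phi>)))"
      by (rule ext) (simp add: distrib_left exp_add)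
    ultimately show "(CLINT x|M. iexp (c * Y x) * ?Z x) = 0" by (simp only:)
  qed (use Y in measurable)
  then show ?case unfolding p cyl_Cons mult.assoc .
qed

lemma zero_noise_span: "(\<lambda>_. 0) \<in> noise_span"
  unfolding noise_span_def by (intro CollectI exI[of _ "{}"]) auto

text \<open>One last conversion, now of \<open>exp(i c N)\<close>, applied to the centred indicator of the cylinder event.\<close>

lemma cyl_indep:
  assumes N: "N \<in> noise_span"
    and ps: "\<And>Y B. (Y, B) \<in> set ps \<Longrightarrow> Y \<in> noise_span \<and> B \<in> sets borel \<and> expectation (\<lambda>x. Y x * N x) = 0"
    and B: "B \<in> sets borel"
  shows "prob ({x\<in>space M. \<forall>(Y, B)\<in>set ps. Y x \<in> B} \<inter> (N -` B \<inter> space M)) =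
    prob {x\<in>space M. \<forall>(Y, B)\<in>set ps. Y x \<in> B} * prob (N -` B \<inter> space M)"
proof -
  let ?F = "{x\<in>space M. \<forall>(Y, B)\<in>set ps. Y x \<in> B}"
  have [measurable]: "N \<in> borel_measurable M" "cyl ps \<in> borel_measurable M" "B \<in> sets borel"
    using noise_span_measurable N ps B by (auto intro!: cyl_measurable)
  have cyl: "cyl ps x = indicator ?F x" if "x \<in> space M" for x
    using that by (induction ps) (auto simp: cyl_def indicator_def)
  have "?F = cyl ps -` {1} \<inter> space M"
    using cyl by (auto simp: indicator_def split: if_splits)
  also have "\<dots> \<in> events" by measurable
  finally have F [measurable]: "?F \<in> events" .
  have cyl_int: "(CLINT x|M. cyl ps x * f x) = (CLINT x|M. indicator ?F x * f x)" for f
    using cyl by (intro Bochner_Integration.integral_cong) auto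
  let ?Z = "\<lambda>x. indicator ?F x - complex_of_real (prob ?F)"
  have intF: "(CLINT x|M. indicator ?F x) = complex_of_real (prob ?F)"
  proof -
    have "(CLINT x|M. indicator ?F x) = (CLINT x|M. complex_of_real (indicator ?F x))"
      by (intro Bochner_Integration.integral_cong) (auto simp: indicator_def)
    then show ?thesis by simp
  qed
  have "(CLINT x|M. indicator B (N x) * ?Z x) = 0"
  proof (rule fourier_zero_imp_indicator_zero[where C = "1 + 1"])
    fix c
    let ?N = "\<lambda>x. c * N x"
    have "(CLINT x|M. cyl ps x * (iexp 0 * (iexp (?N x) - (CLINT x|M. iexp (?N x))))) = 0"
    proof (rule cyl_fourier)
      fix Y B assume "(Y, B) \<in> set ps"
      then have "Y \<in> noise_span" "B \<in> sets borel" "expectation (\<lambda>x. Y x * N x) = 0" using ps by auto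
      moreover have "expectation (\<lambda>x. Y x * (c * N x)) = c * expectation (\<lambda>x. Y x * N x)"
        by (subst Bochner_Integration.integral_mult_right_zero[symmetric]) (simp add: ac_simps)
      ultimately show "Y \<in> noise_span \<and> B \<in> sets borel \<and> expectation (\<lambda>x. Y x * (c * N x)) = 0" by simp
    qed (use N in \<open>auto intro: noise_span_cmult zero_noise_span\<close>)
    then have 0: "(CLINT x|M. indicator ?F x * (iexp (?N x) - (CLINT x|M. iexp (?N x)))) = 0"
      unfolding cyl_int by simp
    have i: "integrable M (\<lambda>x. indicator ?F x * iexp (?N x))" "integrable M (\<lambda>x. indicator ?F x :: complex)"
      "integrable M (\<lambda>x. iexp (?N x))"
      by (rule integrable_const_bound[where B=1]; simp add: norm_mult indicator_def)+
    have "(CLINT x|M. indicator ?F x * iexp (?N x)) = complex_of_real (prob ?F) * (CLINT x|M. iexp (?N x))"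
      using 0 i intF by (simp add: right_diff_distrib)
    moreover have "(CLINT x|M. iexp (c * N x) * ?Z x) = (CLINT x|M. indicator ?F x * iexp (?N x) - complex_of_real (prob ?F) * iexp (?N x))"
      by (intro Bochner_Integration.integral_cong) (auto simp: algebra_simps)
    ultimately show "(CLINT x|M. iexp (c * N x) * ?Z x) = 0"
      using i by simp
  next
    fix x
    show "norm (?Z x) \<le> 1 + 1"
    proof (rule order_trans[OF norm_triangle_ineq4 add_mono])
      show "norm (indicator ?F x :: complex) \<le> 1" by (simp add: indicator_def)
      show "norm (complex_of_real (prob ?F)) \<le> 1" by simp
    qed
  qed simp_all
  moreover have "(CLINT x|M. indicator B (N x) * ?Z x) =
     complex_of_real (\<integral>x. indicator (?F \<inter> (N -` B \<inter> space M)) x - prob ?F * indicator (N -` B \<inter> space M) x \<partial>M)"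
    unfolding integral_complex_of_real[symmetric]
    by (intro Bochner_Integration.integral_cong) (auto simp: indicator_def)
  ultimately have "(\<integral>x. indicator (?F \<inter> (N -` B \<inter> space M)) x - prob ?F * indicator (N -` B \<inter> space M) x \<partial>M) = 0"
    by simp
  moreover have "(\<integral>x. indicator (G \<inter> H) x - p * indicator H x \<partial>M) = prob (G \<inter> H) - p * prob H"
    if [measurable]: "G \<in> events" "H \<in> events" for G H p
  proof -
    have "integrable M (indicator K :: 'a \<Rightarrow> real)" if [measurable]: "K \<in> events" for K
      by (rule integrable_const_bound[where B=1]) (auto simp: indicator_def)
    from this[of "G \<inter> H"] this[of H] show ?thesis by simp
  qed
  moreover have "N -` B \<inter> space M \<in> events" by measurable
  ultimately show ?thesis using F by fastforce
qed

text \<open>The sets of the martingale measure are time rectangles, so overlaps have product measure.\<close>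

lemma noise_at_set:
  assumes "0 \<le> s" "A \<in> finite_measure_sets"
  shows "{0..s} \<times> A \<in> noise_sets"
    and "0 \<le> s' \<Longrightarrow> A' \<in> finite_measure_sets \<Longrightarrow>
      measure lborel (({0..s} \<times> A) \<inter> ({0..s'} \<times> A')) = min s s' * measure lborel (A \<inter> A')"
proof -
  have [measurable]: "A \<in> sets borel" using assms by (simp add: finite_measure_sets_def)
  have em: "emeasure lborel ({0..r} \<times> B) = ennreal r * emeasure lborel B" if "0 \<le> r" "B \<in> sets borel" for r :: real and B :: "real set"
    using that unfolding lborel_prod[symmetric] by (subst lborel.emeasure_pair_measure_Times) auto
  show "{0..s} \<times> A \<in> noise_sets"
    using assms em[of s A] unfolding noise_sets_def finite_measure_sets_def
    by (auto simp: borel_prod[symmetric] ennreal_mult_less_top)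
  show "measure lborel (({0..s} \<times> A) \<inter> ({0..s'} \<times> A')) = min s s' * measure lborel (A \<inter> A')"
    if "0 \<le> s'" "A' \<in> finite_measure_sets"
  proof -
    have "({0..s} \<times> A) \<inter> ({0..s'} \<times> A') = {0..min s s'} \<times> (A \<inter> A')" by auto
    then show ?thesis
      using em[of "min s s'" "A \<inter> A'"] assms that
      by (simp add: measure_def finite_measure_sets_def enn2real_mult sets.Int)
  qed
qed

lemma noise_at_span: "0 \<le> s \<Longrightarrow> A \<in> finite_measure_sets \<Longrightarrow> noise_at W s A \<in> noise_span"
  unfolding noise_at_def using noise_at_set(1) by (intro noise_span_W)

lemma noise_at_cov:
  assumes "0 \<le> s" "A \<in> finite_measure_sets" "0 \<le> s'" "A' \<in> finite_measure_sets"
  shows "expectation (\<lambda>x. noise_at W s A x * noise_at W s' A' x) = min s s' * measure lborel (A \<inter> A')"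
  using white_noise noise_at_set[OF assms(1,2)] noise_at_set(1)[OF assms(3,4)] assms
  unfolding white_noise_def noise_at_def by simp

definition incr :: "real \<Rightarrow> real \<Rightarrow> real set \<Rightarrow> 'a \<Rightarrow> real" where
  "incr b c A x = noise_at W c A x - noise_at W b A x"

lemma incr_span: "0 \<le> b \<Longrightarrow> 0 \<le> c \<Longrightarrow> A \<in> finite_measure_sets \<Longrightarrow> incr b c A \<in> noise_span"
  unfolding incr_def[abs_def] by (intro noise_span_diff noise_at_span)

lemma noise_span_mult_integrable: "Y \<in> noise_span \<Longrightarrow> Z \<in> noise_span \<Longrightarrow> integrable M (\<lambda>x. Y x * Z x)"
  by (intro square_integrable_mult noise_span_L2)

lemma incr_cov:
  assumes "0 \<le> b" "0 \<le> c" "A \<in> finite_measure_sets" "0 \<le> b'" "0 \<le> c'" "A' \<in> finite_measure_sets"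
  shows "expectation (\<lambda>x. incr b c A x * incr b' c' A' x) =
    (min c c' - min c b' - min b c' + min b b') * measure lborel (A \<inter> A')"
proof -
  note i = noise_span_mult_integrable[OF noise_at_span noise_at_span]
  have "expectation (\<lambda>x. incr b c A x * incr b' c' A' x) =
    expectation (\<lambda>x. noise_at W c A x * noise_at W c' A' x - noise_at W c A x * noise_at W b' A' x
      - noise_at W b A x * noise_at W c' A' x + noise_at W b A x * noise_at W b' A' x)"
    by (intro Bochner_Integration.integral_cong) (auto simp: incr_def algebra_simps)
  also have "\<dots> = min c c' * measure lborel (A \<inter> A') - min c b' * measure lborel (A \<inter> A')
      - min b c' * measure lborel (A \<inter> A') + min b b' * measure lborel (A \<inter> A')"
    using assms by (simp add: i noise_at_cov)
  finally show ?thesis by (simp add: algebra_simps)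
qed

lemma natural_generators_sub:
  "{noise_at W s A -` B \<inter> space M | s A B.
      0 \<le> s \<and> s \<le> t \<and> A \<in> finite_measure_sets \<and> B \<in> sets borel} \<union> null_sets M \<subseteq> events"
proof -
  have "noise_at W s A -` B \<inter> space M \<in> events"
    if "0 \<le> s" "A \<in> finite_measure_sets" "B \<in> sets borel" for s A B
    using noise_span_measurable[OF noise_at_span[OF that(1,2)]] that(3) by (rule measurable_sets)
  then show ?thesis by auto
qed

lemma sets_natural: "sets (natural_filtration M W t) = sigma_sets (space M)
    ({noise_at W s A -` B \<inter> space M | s A B.
      0 \<le> s \<and> s \<le> t \<and> A \<in> finite_measure_sets \<and> B \<in> sets borel} \<union> null_sets M)"
  unfolding natural_filtration_def
  using natural_generators_sub[of t] sets.space_closed[of M] by (intro sets_measure_of) (auto 0 3)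

lemma space_natural [simp]: "space (natural_filtration M W t) = space M"
  by (simp add: natural_filtration_def space_measure_of_conv)

lemma space_noise_filtration [simp]: "space (noise_filtration M W t) = space M"
  by (simp add: noise_filtration_def space_measure_of_conv)

lemma sets_natural_events: "sets (natural_filtration M W t) \<subseteq> events"
  unfolding sets_natural using natural_generators_sub by (rule sets.sigma_sets_subset)

lemma sets_noise_filtration: "sets (noise_filtration M W t) = sigma_sets (space M) (\<Inter>s\<in>{t<..}. sets (natural_filtration M W s))"
proof -
  have "(\<Inter>s\<in>{t<..}. sets (natural_filtration M W s)) \<subseteq> sets (natural_filtration M W (t + 1))"
    by (rule INF_lower) simp
  also have "\<dots> \<subseteq> Pow (space M)" using sets.space_closed[of "natural_filtration M W (t + 1)"] by simp
  finally show ?thesis unfolding noise_filtration_def by (rule sets_measure_of)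
qed

lemma sets_noise_filtration_natural: "t < s \<Longrightarrow> sets (noise_filtration M W t) \<subseteq> sets (natural_filtration M W s)"
  unfolding sets_noise_filtration
  using sets.sigma_sets_subset[of "\<Inter>s\<in>{t<..}. sets (natural_filtration M W s)" "natural_filtration M W s"] by auto

lemma measurable_noise_filtration_natural:
  assumes "X \<in> borel_measurable (noise_filtration M W t)" "t < s"
  shows "X \<in> borel_measurable (natural_filtration M W s)"
  using measurable_mono[OF subset_refl refl sets_noise_filtration_natural[OF assms(2)], of borel] assms(1) by auto

lemma measurable_natural_M:
  assumes "X \<in> borel_measurable (natural_filtration M W t)"
  shows "X \<in> borel_measurable M"
  using measurable_mono[OF subset_refl refl sets_natural_events[of t], of borel] assms by auto

lemma measurable_noise_filtration_M:
  assumes "X \<in> borel_measurable (noise_filtration M W t)"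
  shows "X \<in> borel_measurable M"
  by (rule measurable_natural_M[OF measurable_noise_filtration_natural[OF assms, of "t + 1"]]) simp

lemma noise_filtration_mono:
  assumes X: "X \<in> borel_measurable (noise_filtration M W s)" and "s \<le> t"
  shows "X \<in> borel_measurable (noise_filtration M W t)"
proof -
  have "sets (noise_filtration M W s) \<subseteq> sets (noise_filtration M W t)"
    unfolding sets_noise_filtration using \<open>s \<le> t\<close> by (intro sigma_sets_mono') auto
  from measurable_mono[OF subset_refl refl this, of borel] X show ?thesis by auto
qed

lemma noise_at_adapted:
  assumes "0 \<le> r" "r \<le> t" "A \<in> finite_measure_sets"
  shows "noise_at W r A \<in> borel_measurable (noise_filtration M W t)"
proof (rule measurableI)
  fix B :: "real set" assume B: "B \<in> sets borel"
  have "noise_at W r A -` B \<inter> space M \<in> sets (natural_filtration M W s)" if "t < s" for s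
    unfolding sets_natural
    by (rule sigma_sets.Basic, rule UnI1, intro CollectI exI conjI, rule refl)
      (use assms B that in auto)
  then show "noise_at W r A -` B \<inter> space (noise_filtration M W t) \<in> sets (noise_filtration M W t)"
    unfolding sets_noise_filtration by (auto intro: sigma_sets.Basic)
qed simp

definition innovation :: "real \<Rightarrow> ('a \<Rightarrow> real) \<Rightarrow> bool" where
  "innovation s N \<longleftrightarrow> N \<in> noise_span \<and>
    (\<forall>r A. 0 \<le> r \<longrightarrow> r \<le> s \<longrightarrow> A \<in> finite_measure_sets \<longrightarrow> expectation (\<lambda>x. noise_at W r A x * N x) = 0)"

text \<open>The cylinder events together with the null sets form a generator that is stable under intersections.\<close>

lemma innovation_indep_set:
  assumes "innovation s N"
  shows "indep_set (sets (natural_filtration M W s)) {N -` B \<inter> space M | B. B \<in> sets borel}"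
proof -
  let ?cyl = "\<lambda>ps. {x\<in>space M. \<forall>(Y, B)\<in>set ps. Y x \<in> B}"
  let ?good = "\<lambda>ps. \<forall>(Y, B)\<in>set ps. (\<exists>r A. Y = noise_at W r A \<and> 0 \<le> r \<and> r \<le> s \<and> A \<in> finite_measure_sets) \<and> B \<in> sets borel"
  let ?P = "{?cyl ps | ps. ?good ps}"
  let ?N = "{N -` B \<inter> space M | B. B \<in> sets borel}"
  have N: "N \<in> noise_span" using assms by (simp add: innovation_def)
  have [measurable]: "N \<in> borel_measurable M" using noise_span_measurable[OF N] .
  have ok: "Y \<in> noise_span \<and> B \<in> sets borel \<and> expectation (\<lambda>x. Y x * N x) = 0"
    if "?good ps"
      "(Y, B) \<in> set ps" for ps Y B
    using that assms noise_at_span unfolding innovation_def by fastforce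
  have cyl_ev: "?cyl ps \<in> events"
    if "?good ps" for ps
  proof -
    have "{x\<in>space M. \<forall>p\<in>set ps. fst p x \<in> snd p} \<in> events"
    proof (rule sets.sets_Collect_finite_All)
      fix p assume p: "p \<in> set ps"
      then have "fst p \<in> noise_span" "snd p \<in> sets borel" using ok[OF that, of "fst p" "snd p"] by auto
      then have [measurable]: "fst p \<in> borel_measurable M" "snd p \<in> sets borel" using noise_span_measurable by auto
      show "{x\<in>space M. fst p x \<in> snd p} \<in> events" by measurable
    qed simp
    then show ?thesis by (simp add: case_prod_unfold)
  qed
  have "indep_set (?P \<union> null_sets M) ?N"
  proof (rule indep_setI)
    show "?P \<union> null_sets M \<subseteq> events" using cyl_ev by auto
    show "?N \<subseteq> events" by (auto intro: measurable_sets[OF \<open>N \<in> borel_measurable M\<close>])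
    fix a b assume a: "a \<in> ?P \<union> null_sets M" and b: "b \<in> ?N"
    from b obtain B where B: "b = N -` B \<inter> space M" "B \<in> sets borel" by auto
    show "prob (a \<inter> b) = prob a * prob b"
    proof (cases "a \<in> null_sets M")
      case True
      have "b \<in> events" using B by simp
      with True have "a \<inter> b \<in> null_sets M" by (rule null_set_Int2)
      then show ?thesis using True by (simp add: measure_eq_0_null_sets)
    next
      case False
      then obtain ps where "a = ?cyl ps" "?good ps"
        using a by auto
      then show ?thesis using cyl_indep[OF N _ B(2), of ps] ok[of ps] B by auto
    qed
  qed
  moreover have "Int_stable (?P \<union> null_sets M)"
  proof (rule Int_stableI)
    fix a b assume a: "a \<in> ?P \<union> null_sets M" and b: "b \<in> ?P \<union> null_sets M"
    have ev: "a \<in> events" "b \<in> events" using a b cyl_ev by auto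
    show "a \<inter> b \<in> ?P \<union> null_sets M"
    proof (cases "a \<in> null_sets M \<or> b \<in> null_sets M")
      case True
      then have "a \<inter> b \<in> null_sets M" using ev null_set_Int1 null_set_Int2 by blast
      then show ?thesis by simp
    next
      case False
      then obtain ps qs where "a = ?cyl ps" "?good ps"
        "b = ?cyl qs" "?good qs"
        using a b by auto
      then have "a \<inter> b = ?cyl (ps @ qs)" "?good (ps @ qs)"
        by auto
      then show ?thesis by blast
    qed
  qed
  moreover have "Int_stable ?N"
  proof (rule Int_stableI)
    fix a b assume "a \<in> ?N" "b \<in> ?N"
    then obtain A B where "a = N -` A \<inter> space M" "A \<in> sets borel" "b = N -` B \<inter> space M" "B \<in> sets borel" by auto
    then have "a \<inter> b = N -` (A \<inter> B) \<inter> space M" "A \<inter> B \<in> sets borel" by auto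
    then show "a \<inter> b \<in> ?N" by blast
  qed
  ultimately have ind: "indep_set (sigma_sets (space M) (?P \<union> null_sets M)) (sigma_sets (space M) ?N)"
    by (rule indep_set_sigma_sets)
  have gen: "sets (natural_filtration M W s) \<subseteq> sigma_sets (space M) (?P \<union> null_sets M)"
    unfolding sets_natural
  proof (rule sigma_sets_mono', rule Un_mono)
    show "{noise_at W r A -` B \<inter> space M | r A B. 0 \<le> r \<and> r \<le> s \<and> A \<in> finite_measure_sets \<and> B \<in> sets borel} \<subseteq> ?P"
    proof safe
      fix r A and B :: "real set" assume "0 \<le> r" "r \<le> s" "A \<in> finite_measure_sets" "B \<in> sets borel"
      then show "\<exists>ps. noise_at W r A -` B \<inter> space M = ?cyl ps \<and>
        (?good ps)"
        by (intro exI[of _ "[(noise_at W r A, B)]"]) auto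
    qed
  qed simp
  show ?thesis
  proof (rule indep_setI)
    show "sets (natural_filtration M W s) \<subseteq> events" by (rule sets_natural_events)
    show "?N \<subseteq> events" by (auto intro: measurable_sets[OF \<open>N \<in> borel_measurable M\<close>])
    fix a b assume "a \<in> sets (natural_filtration M W s)" "b \<in> ?N"
    then show "prob (a \<inter> b) = prob a * prob b"
      using gen by (intro indep_setD[OF ind]) auto
  qed
qed

lemma innovation_indep:
  assumes N: "innovation s N" and X: "X \<in> borel_measurable (natural_filtration M W s)"
  shows "indep_var borel X borel N"
proof -
  have XM: "X \<in> borel_measurable M" using X by (rule measurable_natural_M)
  have NM: "N \<in> borel_measurable M" using N noise_span_measurable by (simp add: innovation_def)
  have stable: "Int_stable {Y -` B \<inter> space M | B. B \<in> sets borel}" for Y :: "'a \<Rightarrow> real"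
  proof (rule Int_stableI)
    fix a b assume "a \<in> {Y -` B \<inter> space M | B. B \<in> sets borel}" "b \<in> {Y -` B \<inter> space M | B. B \<in> sets borel}"
    then obtain A B where "a = Y -` A \<inter> space M" "A \<in> sets borel" "b = Y -` B \<inter> space M" "B \<in> sets borel" by auto
    then have "a \<inter> b = Y -` (A \<inter> B) \<inter> space M" "A \<inter> B \<in> sets borel" by auto
    then show "a \<inter> b \<in> {Y -` B \<inter> space M | B. B \<in> sets borel}" by blast
  qed
  have "indep_set {X -` B \<inter> space M | B. B \<in> sets borel} {N -` B \<inter> space M | B. B \<in> sets borel}"
  proof (rule indep_setI)
    fix a b assume a: "a \<in> {X -` B \<inter> space M | B. B \<in> sets borel}" and b: "b \<in> {N -` B \<inter> space M | B. B \<in> sets borel}"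
    have "a \<in> sets (natural_filtration M W s)"
      using a measurable_sets[OF X] by auto
    then show "prob (a \<inter> b) = prob a * prob b"
      by (rule indep_setD[OF innovation_indep_set[OF N] _ b])
  qed (use measurable_sets[OF XM] measurable_sets[OF NM] in auto)
  from indep_set_sigma_sets[OF this stable stable] show ?thesis
    unfolding indep_var_eq using XM NM by auto
qed

end


section \<open>The isometry of the Walsh integral\<close>

context white_noise_space begin

lemma incr_innovation:
  assumes "0 \<le> s" "s \<le> b" "b \<le> c" "A \<in> finite_measure_sets"
  shows "innovation s (incr b c A)"
  unfolding innovation_def
proof (intro conjI allI impI)
  show "incr b c A \<in> noise_span" using assms by (intro incr_span) auto
  fix r A0 assume r: "0 \<le> r" "r \<le> s" "A0 \<in> finite_measure_sets"
  note i = noise_span_mult_integrable[OF noise_at_span noise_at_span]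
  have "expectation (\<lambda>x. noise_at W r A0 x * incr b c A x) =
    expectation (\<lambda>x. noise_at W r A0 x * noise_at W c A x - noise_at W r A0 x * noise_at W b A x)"
    by (simp add: incr_def right_diff_distrib)
  also have "\<dots> = min r c * measure lborel (A0 \<inter> A) - min r b * measure lborel (A0 \<inter> A)"
    using assms r by (simp add: i noise_at_cov)
  also have "\<dots> = 0" using r assms by simp
  finally show "expectation (\<lambda>x. noise_at W r A0 x * incr b c A x) = 0" .
qed

text \<open>The independence statement concerns the natural filtration. To apply it to the right-continuous
filtration at time \<open>a\<close>, an increment has to start strictly after \<open>a\<close>; the clamped increment used here
starts at \<open>a + 1/(n+1)\<close> at the earliest, and the error has variance of order \<open>1/n\<close>.\<close>

lemma incr_delay_tendsto:
  assumes "0 \<le> a" "a \<le> b" "b \<le> c" and A: "A \<in> finite_measure_sets"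
  defines "s \<equiv> \<lambda>n::nat. a + inverse (real (Suc n))"
  shows "(\<lambda>n. expectation (\<lambda>x. (incr (max b (s n)) (max c (s n)) A x - incr b c A x)\<^sup>2)) \<longlonglongrightarrow> 0"
proof (rule Lim_null_comparison[OF always_eventually[OF allI]])
  fix n
  have s: "a < s n" by (simp add: s_def)
  have cov: "expectation (\<lambda>x. (incr r (max r (s n)) A x)\<^sup>2) \<le> inverse (real (Suc n)) * measure lborel A"
    if "a \<le> r" for r
  proof -
    have "expectation (\<lambda>x. (incr r (max r (s n)) A x)\<^sup>2) = (max r (s n) - r) * measure lborel A"
      using incr_cov[of r "max r (s n)" A r "max r (s n)" A] that assms s by (simp add: power2_eq_square)
    also have "\<dots> \<le> inverse (real (Suc n)) * measure lborel A"
      using that by (intro mult_right_mono) (simp_all add: s_def max_def)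
    finally show ?thesis .
  qed
  let ?U = "incr c (max c (s n)) A" and ?V = "incr b (max b (s n)) A"
  have UV: "?U \<in> noise_span" "?V \<in> noise_span" using assms by (auto intro!: incr_span)
  have "expectation (\<lambda>x. (incr (max b (s n)) (max c (s n)) A x - incr b c A x)\<^sup>2) =
      expectation (\<lambda>x. (?U x - ?V x)\<^sup>2)"
    by (intro Bochner_Integration.integral_cong) (simp_all add: incr_def algebra_simps)
  also have "\<dots> \<le> expectation (\<lambda>x. 2 * (?U x)\<^sup>2 + 2 * (?V x)\<^sup>2)"
  proof (rule integral_mono)
    show "integrable M (\<lambda>x. (?U x - ?V x)\<^sup>2)"
      using UV by (intro square_integrable_power2 square_integrable_diff noise_span_L2)
    show "integrable M (\<lambda>x. 2 * (?U x)\<^sup>2 + 2 * (?V x)\<^sup>2)"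
      using UV[THEN noise_span_L2, THEN square_integrable_power2] by simp
    fix x
    have "0 \<le> (?U x + ?V x)\<^sup>2" by simp
    then show "(?U x - ?V x)\<^sup>2 \<le> 2 * (?U x)\<^sup>2 + 2 * (?V x)\<^sup>2"
      unfolding power2_sum power2_diff by linarith
  qed
  also have "\<dots> = 2 * expectation (\<lambda>x. (?U x)\<^sup>2) + 2 * expectation (\<lambda>x. (?V x)\<^sup>2)"
    using UV[THEN noise_span_L2, THEN square_integrable_power2] by simp
  also have "\<dots> \<le> 4 * (inverse (real (Suc n)) * measure lborel A)"
    using cov[of b] cov[of c] assms by simp
  finally show "norm (expectation (\<lambda>x. (incr (max b (s n)) (max c (s n)) A x - incr b c A x)\<^sup>2)) \<le>
      4 * (inverse (real (Suc n)) * measure lborel A)" by simp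
next
  show "(\<lambda>n. 4 * (inverse (real (Suc n)) * measure lborel A)) \<longlonglongrightarrow> 0"
    using tendsto_mult[OF tendsto_const[of 4] tendsto_mult[OF LIMSEQ_inverse_real_of_nat tendsto_const[of "measure lborel A"]]]
    by simp
qed

lemma adapted_times_incr:
  assumes X: "X \<in> borel_measurable (noise_filtration M W a)" "square_integrable M X"
    and t: "0 \<le> a" "a \<le> b" "b \<le> c" and A: "A \<in> finite_measure_sets"
  shows "expectation (\<lambda>x. X x * incr b c A x) = 0"
proof -
  define s where "s n = a + inverse (real (Suc n))" for n
  have s: "a < s n" for n by (simp add: s_def)
  have zero: "expectation (\<lambda>x. X x * incr (max b (s n)) (max c (s n)) A x) = 0" for n
  proof -
    let ?N = "incr (max b (s n)) (max c (s n)) A"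
    have N: "innovation (s n) ?N"
      using s[of n] t A by (intro incr_innovation) auto
    then have sp: "?N \<in> noise_span" by (simp add: innovation_def)
    have "indep_var borel X borel ?N"
      by (rule innovation_indep[OF N measurable_noise_filtration_natural[OF X(1) s]])
    then have "expectation (\<lambda>x. X x * ?N x) = expectation X * expectation ?N"
      using X(2) noise_span_L2[OF sp] by (intro indep_var_lebesgue_integral square_integrable_integrable)
    then show ?thesis using noise_span_mean[OF sp] by simp
  qed
  have "(\<lambda>n. expectation (\<lambda>x. X x * incr (max b (s n)) (max c (s n)) A x)) \<longlonglongrightarrow> expectation (\<lambda>x. X x * incr b c A x)"
  proof (rule tendsto_L2_inner[where fs="\<lambda>_. X"])
    show "square_integrable M (incr (max b (s n)) (max c (s n)) A)" for n
      using t A by (intro noise_span_L2 incr_span) auto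
    show "square_integrable M (incr b c A)" using t A by (intro noise_span_L2 incr_span) auto
    show "(\<lambda>n. expectation (\<lambda>x. (incr (max b (s n)) (max c (s n)) A x - incr b c A x)\<^sup>2)) \<longlonglongrightarrow> 0"
      unfolding s_def by (rule incr_delay_tendsto[OF t A])
  qed (use X in auto)
  then show ?thesis unfolding zero by (simp add: LIMSEQ_const_iff)
qed

lemma square_integrable_bounded_mult:
  assumes [measurable]: "X \<in> borel_measurable M" and bd: "\<forall>x\<in>space M. \<bar>X x\<bar> \<le> C"
    and Y: "square_integrable M Y"
  shows "square_integrable M (\<lambda>x. X x * Y x)"
    and "expectation (\<lambda>x. (X x * Y x)\<^sup>2) \<le> C\<^sup>2 * expectation (\<lambda>x. (Y x)\<^sup>2)"
proof -
  have [measurable]: "Y \<in> borel_measurable M" using Y by (rule square_integrable_measurable)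
  have le: "(X x * Y x)\<^sup>2 \<le> C\<^sup>2 * (Y x)\<^sup>2" if "x \<in> space M" for x
    unfolding power_mult_distrib using power_mono[OF bspec[OF bd that] abs_ge_zero, of 2] by (intro mult_right_mono) auto
  have i: "integrable M (\<lambda>x. C\<^sup>2 * (Y x)\<^sup>2)" using square_integrable_power2[OF Y] by simp
  have j: "integrable M (\<lambda>x. (X x * Y x)\<^sup>2)"
    by (rule Bochner_Integration.integrable_bound[OF i]) (use le in auto)
  then show "square_integrable M (\<lambda>x. X x * Y x)" by (simp add: square_integrable_def)
  have "expectation (\<lambda>x. (X x * Y x)\<^sup>2) \<le> expectation (\<lambda>x. C\<^sup>2 * (Y x)\<^sup>2)"
    by (rule integral_mono[OF j i le])
  then show "expectation (\<lambda>x. (X x * Y x)\<^sup>2) \<le> C\<^sup>2 * expectation (\<lambda>x. (Y x)\<^sup>2)" by simp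
qed

lemma adapted_times_innovation_square:
  assumes X: "X \<in> borel_measurable (natural_filtration M W s)" "\<forall>x\<in>space M. \<bar>X x\<bar> \<le> C"
    and N: "innovation s N"
  shows "expectation (\<lambda>x. X x * (N x)\<^sup>2) = expectation X * expectation (\<lambda>x. (N x)\<^sup>2)"
proof -
  have "indep_var borel X borel (\<lambda>x. (N x)\<^sup>2)"
    using indep_var_compose[OF innovation_indep[OF N X(1)], of "\<lambda>x. x" borel "\<lambda>x. x\<^sup>2" borel]
    by (simp add: comp_def)
  moreover have "integrable M X"
    using X(2) measurable_natural_M[OF X(1)] by (intro integrable_const_bound[where B=C]) auto
  moreover have "integrable M (\<lambda>x. (N x)\<^sup>2)"
    using N by (intro square_integrable_power2 noise_span_L2) (simp add: innovation_def)
  ultimately show ?thesis by (rule indep_var_lebesgue_integral)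
qed

lemma innovation_add: "innovation s N \<Longrightarrow> innovation s N' \<Longrightarrow> innovation s (\<lambda>x. N x + N' x)"
  unfolding innovation_def
  by (auto intro!: noise_span_add simp: distrib_left noise_span_mult_integrable noise_at_span)

text \<open>Polarization of the statement for squares: the sum of two innovations is an innovation.\<close>

lemma adapted_times_innovations:
  assumes X: "X \<in> borel_measurable (natural_filtration M W s)" "\<forall>x\<in>space M. \<bar>X x\<bar> \<le> C"
    and N: "innovation s N" "innovation s N'"
  shows "expectation (\<lambda>x. X x * N x * N' x) = expectation X * expectation (\<lambda>x. N x * N' x)"
proof -
  have L: "square_integrable M N" "square_integrable M N'"
    using N by (auto simp: innovation_def intro: noise_span_L2)
  have XM: "X \<in> borel_measurable M" using measurable_natural_M[OF X(1)] .
  note i = square_integrable_mult[OF square_integrable_bounded_mult(1)[OF XM X(2)]]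
  have sq: "integrable M (\<lambda>x. X x * (Y x)\<^sup>2)" if "square_integrable M Y" for Y
    using i[OF that that] by (simp add: power2_eq_square mult.assoc)
  note L2 = square_integrable_add[OF L]
  have "expectation (\<lambda>x. X x * (N x + N' x)\<^sup>2) = expectation (\<lambda>x. X x * (N x)\<^sup>2 + X x * (N' x)\<^sup>2 + 2 * (X x * N x * N' x))"
    by (intro Bochner_Integration.integral_cong) (auto simp: power2_sum algebra_simps)
  also have "\<dots> = expectation (\<lambda>x. X x * (N x)\<^sup>2) + expectation (\<lambda>x. X x * (N' x)\<^sup>2) + 2 * expectation (\<lambda>x. X x * N x * N' x)"
    using sq[OF L(1)] sq[OF L(2)] i[OF L] by simp
  finally have 1: "expectation (\<lambda>x. X x * (N x + N' x)\<^sup>2) = \<dots>" .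
  have "expectation (\<lambda>x. (N x + N' x)\<^sup>2) = expectation (\<lambda>x. (N x)\<^sup>2 + (N' x)\<^sup>2 + 2 * (N x * N' x))"
    by (intro Bochner_Integration.integral_cong) (auto simp: power2_sum)
  also have "\<dots> = expectation (\<lambda>x. (N x)\<^sup>2) + expectation (\<lambda>x. (N' x)\<^sup>2) + 2 * expectation (\<lambda>x. N x * N' x)"
    using L[THEN square_integrable_power2] square_integrable_mult[OF L] by simp
  finally have 2: "expectation (\<lambda>x. (N x + N' x)\<^sup>2) = \<dots>" .
  show ?thesis
    using adapted_times_innovation_square[OF X innovation_add[OF N]] 1 2
      adapted_times_innovation_square[OF X N(1)] adapted_times_innovation_square[OF X N(2)]
    by (simp add: algebra_simps)
qed

text \<open>Bounded multipliers preserve \<open>L\<^sup>2\<close> convergence, so the delay can be removed from both increments.\<close>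

lemma adapted_times_incrs:
  assumes X: "X \<in> borel_measurable (noise_filtration M W a)" and bd: "\<forall>x\<in>space M. \<bar>X x\<bar> \<le> C"
    and t: "0 \<le> a" "a \<le> b" "b \<le> c" and A: "A \<in> finite_measure_sets"
    and t': "a \<le> b'" "b' \<le> c'" and A': "A' \<in> finite_measure_sets"
  shows "expectation (\<lambda>x. X x * incr b c A x * incr b' c' A' x) =
    expectation X * expectation (\<lambda>x. incr b c A x * incr b' c' A' x)"
proof -
  define s where "s n = a + inverse (real (Suc n))" for n
  have s: "a < s n" for n by (simp add: s_def)
  let ?N = "\<lambda>n. incr (max b (s n)) (max c (s n)) A" and ?N' = "\<lambda>n. incr (max b' (s n)) (max c' (s n)) A'"
  have XM: "X \<in> borel_measurable M" using X by (rule measurable_noise_filtration_M)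
  have sq: "square_integrable M (?N n)" "square_integrable M (?N' n)" "square_integrable M (incr b c A)" "square_integrable M (incr b' c' A')" for n
    using t A t' A' by (auto intro!: noise_span_L2 incr_span simp: le_max_iff_disj)
  note XN = square_integrable_bounded_mult[OF XM bd]
  have eq: "expectation (\<lambda>x. X x * ?N n x * ?N' n x) = expectation X * expectation (\<lambda>x. ?N n x * ?N' n x)" for n
    by (rule adapted_times_innovations[OF measurable_noise_filtration_natural[OF X s[of n]] bd])
      (use s[of n] t A t' A' in \<open>auto intro!: incr_innovation\<close>)
  have l: "(\<lambda>n. expectation (\<lambda>x. (?N n x - incr b c A x)\<^sup>2)) \<longlonglongrightarrow> 0"
    unfolding s_def by (rule incr_delay_tendsto[OF t A])
  have l': "(\<lambda>n. expectation (\<lambda>x. (?N' n x - incr b' c' A' x)\<^sup>2)) \<longlonglongrightarrow> 0"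
    unfolding s_def by (rule incr_delay_tendsto[OF t(1) t' A'])
  have lX: "(\<lambda>n. expectation (\<lambda>x. (X x * ?N n x - X x * incr b c A x)\<^sup>2)) \<longlonglongrightarrow> 0"
  proof (rule Lim_null_comparison[OF always_eventually[OF allI]])
    fix n
    have "expectation (\<lambda>x. (X x * (?N n x - incr b c A x))\<^sup>2) \<le> C\<^sup>2 * expectation (\<lambda>x. (?N n x - incr b c A x)\<^sup>2)"
      by (rule XN(2)) (intro square_integrable_diff sq)
    then show "norm (expectation (\<lambda>x. (X x * ?N n x - X x * incr b c A x)\<^sup>2)) \<le> C\<^sup>2 * expectation (\<lambda>x. (?N n x - incr b c A x)\<^sup>2)"
      by (simp add: right_diff_distrib)
    show "(\<lambda>n. C\<^sup>2 * expectation (\<lambda>x. (?N n x - incr b c A x)\<^sup>2)) \<longlonglongrightarrow> 0"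
      by (rule tendsto_mult_right_zero[OF l])
  qed
  have "(\<lambda>n. expectation (\<lambda>x. X x * ?N n x * ?N' n x)) \<longlonglongrightarrow> expectation (\<lambda>x. X x * incr b c A x * incr b' c' A' x)"
    by (rule tendsto_L2_inner[OF XN(1)[OF sq(1)] XN(1)[OF sq(3)] sq(2) sq(4) lX l'])
  moreover have "(\<lambda>n. expectation X * expectation (\<lambda>x. ?N n x * ?N' n x)) \<longlonglongrightarrow> expectation X * expectation (\<lambda>x. incr b c A x * incr b' c' A' x)"
    by (intro tendsto_mult tendsto_const tendsto_L2_inner[OF sq(1) sq(3) sq(2) sq(4) l l'])
  ultimately show ?thesis unfolding eq by (rule LIMSEQ_unique)
qed

text \<open>Only the part of the earlier increment that lies after \<open>a'\<close> contributes: the part before \<open>a'\<close> is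
measurable at time \<open>a'\<close> together with \<open>X\<close> and \<open>X'\<close>, and the later increment is centred given
that information.\<close>

lemma elementary_covariance_ordered:
  assumes X: "X \<in> borel_measurable (noise_filtration M W a)" "\<forall>x\<in>space M. \<bar>X x\<bar> \<le> C"
    and X': "X' \<in> borel_measurable (noise_filtration M W a')" "\<forall>x\<in>space M. \<bar>X' x\<bar> \<le> C'"
    and ab: "0 \<le> a" "a < b" "a' < b'" "a \<le> a'" and A: "A \<in> finite_measure_sets" "A' \<in> finite_measure_sets"
    and t: "0 < t"
  shows "expectation (\<lambda>x. (X x * incr (min t a) (min t b) A x) * (X' x * incr (min t a') (min t b') A' x)) =
    expectation (\<lambda>x. X x * X' x) * (max 0 (min (min b b') t - a') * measure lborel (A \<inter> A'))"
proof (cases "t \<le> a'")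
  case True
  then have "min t a' = t" "min t b' = t" using ab by auto
  then show ?thesis using True by (simp add: incr_def)
next
  case False
  define c where "c = min t b"
  define c' where "c' = min t b'"
  define m where "m = min c a'"
  have mins: "min t a = a" "min t a' = a'" using False ab by auto
  have c: "a < c" "a' < c'" using False ab by (auto simp: c_def c'_def)
  have XX_adapted: "(\<lambda>x. X x * X' x) \<in> borel_measurable (noise_filtration M W a')"
    using X' noise_filtration_mono[OF X(1) ab(4)] by measurable
  have XX_bound: "\<forall>x\<in>space M. \<bar>X x * X' x\<bar> \<le> \<bar>C\<bar> * \<bar>C'\<bar>"
    using X(2) X'(2) unfolding abs_mult by (intro ballI mult_mono) (auto intro: order_trans[OF _ abs_ge_self])
  note XX_mult = square_integrable_bounded_mult(1)[OF measurable_noise_filtration_M[OF XX_adapted] XX_bound]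
  have sq: "square_integrable M (incr a m A)" "square_integrable M (incr m c A)" "square_integrable M (incr a' c' A')"
    using ab c A by (auto intro!: noise_span_L2 incr_span simp: m_def)
  have "expectation (\<lambda>x. (X x * incr a c A x) * (X' x * incr a' c' A' x)) =
    expectation (\<lambda>x. (X x * X' x * incr a m A x) * incr a' c' A' x + (X x * X' x * incr m c A x) * incr a' c' A' x)"
    by (intro Bochner_Integration.integral_cong) (auto simp: incr_def algebra_simps)
  also have "\<dots> = expectation (\<lambda>x. (X x * X' x * incr a m A x) * incr a' c' A' x) +
      expectation (\<lambda>x. (X x * X' x * incr m c A x) * incr a' c' A' x)"
    by (intro Bochner_Integration.integral_add square_integrable_mult XX_mult sq)
  also have "expectation (\<lambda>x. (X x * X' x * incr a m A x) * incr a' c' A' x) = 0"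
  proof (rule adapted_times_incr)
    have "noise_at W r A \<in> borel_measurable (noise_filtration M W a')" if "0 \<le> r" "r \<le> a'" for r
      using noise_at_adapted[OF that A(1)] .
    then have "incr a m A \<in> borel_measurable (noise_filtration M W a')"
      unfolding incr_def[abs_def] using ab c by (intro borel_measurable_diff) (auto simp: m_def)
    then show "(\<lambda>x. X x * X' x * incr a m A x) \<in> borel_measurable (noise_filtration M W a')"
      by (intro borel_measurable_times[OF XX_adapted])
    show "square_integrable M (\<lambda>x. X x * X' x * incr a m A x)" by (intro XX_mult sq)
  qed (use ab c A in auto)
  also have "expectation (\<lambda>x. (X x * X' x * incr m c A x) * incr a' c' A' x) =
    expectation (\<lambda>x. X x * X' x) * (max 0 (min (min b b') t - a') * measure lborel (A \<inter> A'))"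
  proof (cases "c \<le> a'")
    case True
    then have "m = c" by (simp add: m_def)
    moreover have "min (min b b') t \<le> a'" using True by (auto simp: c_def)
    ultimately show ?thesis by (simp add: incr_def)
  next
    case False
    then have m: "m = a'" by (simp add: m_def)
    have "expectation (\<lambda>x. (X x * X' x * incr a' c A x) * incr a' c' A' x) =
      expectation (\<lambda>x. X x * X' x) * expectation (\<lambda>x. incr a' c A x * incr a' c' A' x)"
      by (rule adapted_times_incrs[OF XX_adapted XX_bound]) (use ab c A False in auto)
    also have "expectation (\<lambda>x. incr a' c A x * incr a' c' A' x) = (min c c' - a') * measure lborel (A \<inter> A')"
      using incr_cov[of a' c A a' c' A'] ab c A False by simp
    also have "min c c' - a' = max 0 (min (min b b') t - a')"
      using False c by (auto simp: c_def c'_def)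
    finally show ?thesis unfolding m .
  qed
  finally show ?thesis unfolding mins c_def c'_def by simp
qed

lemma measure_Ioc_overlap:
  fixes a b a' b' t :: real
  assumes "0 \<le> a" "a \<le> a'"
  shows "measure lborel ({a<..b} \<inter> {a'<..b'} \<inter> {0<..t}) = max 0 (min (min b b') t - a')"
proof -
  have "{a<..b} \<inter> {a'<..b'} \<inter> {0<..t} = {a'<..min (min b b') t}" using assms by auto
  moreover have "measure lborel {x<..y} = max 0 (y - x)" for x y :: real
    by (cases "x \<le> y") simp_all
  ultimately show ?thesis by simp
qed

lemma elementary_covariance:
  assumes X: "X \<in> borel_measurable (noise_filtration M W a)" "\<forall>x\<in>space M. \<bar>X x\<bar> \<le> C"
    and X': "X' \<in> borel_measurable (noise_filtration M W a')" "\<forall>x\<in>space M. \<bar>X' x\<bar> \<le> C'"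
    and ab: "0 \<le> a" "a < b" "0 \<le> a'" "a' < b'" and A: "A \<in> finite_measure_sets" "A' \<in> finite_measure_sets"
    and t: "0 < t"
  shows "expectation (\<lambda>x. (X x * incr (min t a) (min t b) A x) * (X' x * incr (min t a') (min t b') A' x)) =
    expectation (\<lambda>x. X x * X' x) * (measure lborel ({a<..b} \<inter> {a'<..b'} \<inter> {0<..t}) * measure lborel (A \<inter> A'))"
proof (cases "a \<le> a'")
  case True
  then show ?thesis
    using elementary_covariance_ordered[OF X X' ab(1,2,4) True A t]
    unfolding measure_Ioc_overlap[OF ab(1) True] by blast
next
  case False
  then have "a' \<le> a" by simp
  have sw: "{a<..b} \<inter> {a'<..b'} \<inter> {0<..t} = {a'<..b'} \<inter> {a<..b} \<inter> {0<..t}" "A \<inter> A' = A' \<inter> A" by auto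
  have sw': "(X x * incr (min t a) (min t b) A x) * (X' x * incr (min t a') (min t b') A' x) =
      (X' x * incr (min t a') (min t b') A' x) * (X x * incr (min t a) (min t b) A x)"
    "X x * X' x = X' x * X x" for x
    by (rule mult.commute)+
  show ?thesis
    unfolding sw' sw measure_Ioc_overlap[OF ab(3) \<open>a' \<le> a\<close>]
    by (rule elementary_covariance_ordered[OF X' X ab(3,4,2) \<open>a' \<le> a\<close> A(2,1) t])
qed

definition el_integral :: "real \<Rightarrow> real \<times> real \<times> real set \<times> ('a \<Rightarrow> real) \<Rightarrow> 'a \<Rightarrow> real" where
  "el_integral t e x = (case e of (a, b, A, X) \<Rightarrow> X x * incr (min t a) (min t b) A x)"

definition el_value :: "real \<times> real \<times> real set \<times> ('a \<Rightarrow> real) \<Rightarrow> (real \<times> real) \<times> 'a \<Rightarrow> real" where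
  "el_value e z = (case e of (a, b, A, X) \<Rightarrow> X (snd z) * indicator ({a<..b} \<times> A) (fst z))"

lemma simple_integral_eq: "simple_integral W t p x = (\<Sum>e\<leftarrow>p. el_integral t e x)"
  unfolding simple_integral_def by (intro arg_cong[where f=sum_list] map_cong) (auto simp: el_integral_def incr_def)

lemma simple_value_eq: "case_prod (case_prod (simple_value p)) = (\<lambda>z. \<Sum>e\<leftarrow>p. el_value e z)"
  unfolding simple_value_def[abs_def] case_prod_unfold
  by (intro ext arg_cong[where f=sum_list] map_cong) (auto simp: el_value_def indicator_times case_prod_unfold)

lemma integrand_space_product:
  assumes R [measurable]: "R \<in> sets borel" and fin: "emeasure lborel R < \<infinity>" and Z: "integrable M Z"
  shows "integrable (integrand_space M t) (\<lambda>z. Z (snd z) * indicator R (fst z))"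
    and "(\<integral>z. Z (snd z) * indicator R (fst z) \<partial>integrand_space M t) = expectation Z * measure lborel (R \<inter> ({0<..t} \<times> UNIV))"
proof -
  let ?S = "{0<..t} \<times> (UNIV :: real set)"
  have S [measurable]: "?S \<in> sets borel" by (subst borel_prod[symmetric]) auto
  let ?L = "restrict_space lborel ?S"
  interpret L: sigma_finite_measure ?L
    by (rule sigma_finite_measure_restrict_space) (use S in \<open>auto intro: sigma_finite_lborel\<close>)
  interpret P: pair_sigma_finite ?L M ..
  have [measurable]: "Z \<in> borel_measurable M" using Z by simp
  have RL [measurable]: "(\<lambda>x. indicator R x :: real) \<in> borel_measurable ?L"
    by (rule measurable_restrict_space1) (use R in measurable)
  have f [measurable]: "(\<lambda>z. Z (snd z) * indicator R (fst z)) \<in> borel_measurable (?L \<Otimes>\<^sub>M M)"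
    by measurable
  have ind: "integrable ?L (indicator R :: _ \<Rightarrow> real)" "(\<integral>x. indicator R x \<partial>?L) = measure lborel (R \<inter> ?S)"
  proof -
    have "emeasure lborel (R \<inter> ?S) \<le> emeasure lborel R" by (rule emeasure_mono) auto
    then have "emeasure lborel (R \<inter> ?S) < \<infinity>" using fin by (rule le_less_trans)
    then have i: "integrable lborel (indicator (R \<inter> ?S) :: _ \<Rightarrow> real)" by (intro integrable_real_indicator) auto
    have eq: "(\<lambda>x. indicator ?S x *\<^sub>R indicator R x :: real) = indicator (R \<inter> ?S)" by (auto simp: indicator_def)
    show "integrable ?L (indicator R :: _ \<Rightarrow> real)"
      by (subst integrable_restrict_space) (use S i eq in auto)
    show "(\<integral>x. indicator R x \<partial>?L) = measure lborel (R \<inter> ?S)"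
      by (subst integral_restrict_space) (use S eq in auto)
  qed
  show int: "integrable (integrand_space M t) (\<lambda>z. Z (snd z) * indicator R (fst z))"
    unfolding integrand_space_def
  proof (rule P.Fubini_integrable[OF f])
    have "integrable ?L (\<lambda>x. expectation (\<lambda>x. \<bar>Z x\<bar>) * indicator R x)" using ind by simp
    then show "integrable ?L (\<lambda>x. \<integral>y. norm (Z (snd (x, y)) * indicator R (fst (x, y))) \<partial>M)"
      by (simp add: abs_mult)
  qed (use Z in auto)
  have "(\<integral>z. Z (snd z) * indicator R (fst z) \<partial>integrand_space M t) = (\<integral>x. \<integral>y. Z y * indicator R x \<partial>M \<partial>?L)"
    using P.integral_fst'[OF int[unfolded integrand_space_def]] by (simp add: integrand_space_def)
  also have "\<dots> = expectation Z * measure lborel (R \<inter> ?S)"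
    using ind by simp
  finally show "(\<integral>z. Z (snd z) * indicator R (fst z) \<partial>integrand_space M t) = expectation Z * measure lborel (R \<inter> ?S)" .
qed

lemma integral_bounded_integrable:
  fixes X :: "'a \<Rightarrow> real"
  assumes "X \<in> borel_measurable M" "\<forall>x\<in>space M. \<bar>X x\<bar> \<le> C" shows "integrable M X"
  by (rule integrable_const_bound[where B=C]) (use assms in auto)

lemma el_isometry:
  assumes e: "is_simple_process M W [e]" and e': "is_simple_process M W [e']" and t: "0 < t"
  shows "integrable (integrand_space M t) (\<lambda>z. el_value e z * el_value e' z)"
    and "(\<integral>z. el_value e z * el_value e' z \<partial>integrand_space M t) = expectation (\<lambda>x. el_integral t e x * el_integral t e' x)"
proof -
  obtain a b A X where ee: "e = (a, b, A, X)" by (cases e)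
  obtain a' b' A' X' where ee': "e' = (a', b', A', X')" by (cases e')
  from e ee obtain C where h: "0 \<le> a" "a < b" "A \<in> finite_measure_sets" "X \<in> borel_measurable (noise_filtration M W a)"
    "\<forall>x\<in>space M. \<bar>X x\<bar> \<le> C" by (auto simp: is_simple_process_def)
  from e' ee' obtain C' where h': "0 \<le> a'" "a' < b'" "A' \<in> finite_measure_sets" "X' \<in> borel_measurable (noise_filtration M W a')"
    "\<forall>x\<in>space M. \<bar>X' x\<bar> \<le> C'" by (auto simp: is_simple_process_def)
  let ?R = "({a<..b} \<inter> {a'<..b'}) \<times> (A \<inter> A')"
  have XM: "X \<in> borel_measurable M" "X' \<in> borel_measurable M"
    using h h' measurable_noise_filtration_M by auto
  have A: "A \<in> sets borel" "A' \<in> sets borel" "emeasure lborel A < \<infinity>" using h h' by (auto simp: finite_measure_sets_def)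
  have em: "emeasure lborel (I \<times> B) = emeasure lborel I * emeasure lborel B" if "I \<in> sets borel" "B \<in> sets borel" for I B :: "real set"
    using that unfolding lborel_prod[symmetric] by (subst lborel.emeasure_pair_measure_Times) auto
  have R: "?R \<in> sets borel" using A by (subst borel_prod[symmetric]) auto
  have "emeasure lborel (A \<inter> A') < \<infinity>"
    using A(3) by (rule le_less_trans[rotated]) (use A in \<open>auto intro: emeasure_mono\<close>)
  moreover have I: "emeasure lborel ({a<..b} \<inter> {a'<..b'}) < \<infinity>"
    by (rule le_less_trans[OF emeasure_mono[of _ "{a<..b}"]]) (use h in auto)
  ultimately have fin: "emeasure lborel ?R < \<infinity>"
    using A by (subst em) (auto simp: ennreal_mult_less_top)
  have int: "integrable M (\<lambda>x. X x * X' x)"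
  proof (rule integral_bounded_integrable)
    show "\<forall>x\<in>space M. \<bar>X x * X' x\<bar> \<le> \<bar>C\<bar> * \<bar>C'\<bar>"
      using h h' unfolding abs_mult by (intro ballI mult_mono) (auto intro: order_trans[OF _ abs_ge_self])
  qed (use XM in measurable)
  have eq: "(\<lambda>z. el_value e z * el_value e' z) = (\<lambda>z. X (snd z) * X' (snd z) * indicator ?R (fst z))"
    by (auto simp: ee ee' el_value_def indicator_def)
  show "integrable (integrand_space M t) (\<lambda>z. el_value e z * el_value e' z)"
    unfolding eq by (rule integrand_space_product(1)[OF R fin int])
  have "?R \<inter> ({0<..t} \<times> UNIV) = ({a<..b} \<inter> {a'<..b'} \<inter> {0<..t}) \<times> (A \<inter> A')" by auto
  then have "measure lborel (?R \<inter> ({0<..t} \<times> UNIV)) = measure lborel ({a<..b} \<inter> {a'<..b'} \<inter> {0<..t}) * measure lborel (A \<inter> A')"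
    using A by (simp add: measure_def em enn2real_mult)
  then show "(\<integral>z. el_value e z * el_value e' z \<partial>integrand_space M t) = expectation (\<lambda>x. el_integral t e x * el_integral t e' x)"
    unfolding eq integrand_space_product(2)[OF R fin int]
    unfolding ee ee' el_integral_def using elementary_covariance[OF h(4,5) h'(4,5) h(1,2) h'(1,2) h(3) h'(3) t]
    by simp
qed

lemma el_square_integrable:
  assumes e: "is_simple_process M W [e]" and t: "0 < t"
  shows "square_integrable (integrand_space M t) (el_value e)" "square_integrable M (el_integral t e)"
    "expectation (el_integral t e) = 0"
proof -
  obtain a b A X where ee: "e = (a, b, A, X)" by (cases e)
  from e ee obtain C where *: "0 \<le> a" "a < b" "A \<in> finite_measure_sets" "X \<in> borel_measurable (noise_filtration M W a)"
    "\<forall>x\<in>space M. \<bar>X x\<bar> \<le> C" by (auto simp: is_simple_process_def)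
  have XM [measurable]: "X \<in> borel_measurable M" using measurable_noise_filtration_M[OF *(4)] .
  have R: "{a<..b} \<times> A \<in> sets borel" using * by (subst borel_prod[symmetric]) (auto simp: finite_measure_sets_def)
  have [measurable]: "(\<lambda>x. indicator ({a<..b} \<times> A) x :: real) \<in> borel_measurable (restrict_space lborel ({0<..t} \<times> UNIV))"
    by (rule measurable_restrict_space1) (use R in measurable)
  have "el_value e \<in> borel_measurable (integrand_space M t)"
    unfolding ee el_value_def[abs_def] integrand_space_def by simp
  then show "square_integrable (integrand_space M t) (el_value e)"
    using el_isometry(1)[OF e e t] by (simp add: square_integrable_def power2_eq_square)
  have incr: "square_integrable M (incr (min t a) (min t b) A)"
    using * t by (intro noise_span_L2 incr_span) auto
  show sq: "square_integrable M (el_integral t e)"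
    unfolding ee el_integral_def[abs_def] using square_integrable_bounded_mult(1)[OF XM *(5) incr] by simp
  have sX: "square_integrable M X" using square_integrable_bounded_mult(1)[OF XM *(5) square_integrable_const[of 1]] by simp
  show "expectation (el_integral t e) = 0"
  proof (cases "t \<le> a")
    case True
    then show ?thesis using * by (simp add: ee el_integral_def[abs_def] incr_def)
  next
    case False
    then show ?thesis
      unfolding ee el_integral_def[abs_def] using adapted_times_incr[OF *(4) sX, of a "min t b" A] * by simp
  qed
qed

lemma is_simple_process_mem: "is_simple_process M W p \<Longrightarrow> e \<in> set p \<Longrightarrow> is_simple_process M W [e]"
  by (auto simp: is_simple_process_def)

lemma simple_square_integrable:
  assumes p: "is_simple_process M W p" and t: "0 < t"
  shows "square_integrable (integrand_space M t) (\<lambda>((s, y), x). simple_value p s y x)"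
    "square_integrable M (simple_integral W t p)" "expectation (simple_integral W t p) = 0"
proof -
  note e = el_square_integrable[OF is_simple_process_mem[OF p] t]
  show "square_integrable (integrand_space M t) (\<lambda>((s, y), x). simple_value p s y x)"
    unfolding simple_value_eq by (intro square_integrable_sum_list e)
  show "square_integrable M (simple_integral W t p)"
    unfolding simple_integral_eq[abs_def] by (intro square_integrable_sum_list e)
  show "expectation (simple_integral W t p) = 0"
    using integral_sum_list_mult[of p M "el_integral t" "[()]" "\<lambda>_ _. 1"] e square_integrable_const
    by (simp add: simple_integral_eq[abs_def] cong: map_cong)
qed

lemma simple_isometry:
  assumes p: "is_simple_process M W p" and q: "is_simple_process M W q" and t: "0 < t"
  shows "expectation (\<lambda>x. simple_integral W t p x * simple_integral W t q x) =
    (\<integral>z. case_prod (case_prod (simple_value p)) z * case_prod (case_prod (simple_value q)) z \<partial>integrand_space M t)"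
proof -
  note ep = el_square_integrable[OF is_simple_process_mem[OF p] t]
  note eq = el_square_integrable[OF is_simple_process_mem[OF q] t]
  have "expectation (\<lambda>x. simple_integral W t p x * simple_integral W t q x) =
      (\<Sum>e\<leftarrow>p. \<Sum>e'\<leftarrow>q. expectation (\<lambda>x. el_integral t e x * el_integral t e' x))"
    unfolding simple_integral_eq by (rule integral_sum_list_mult, erule ep(2), erule eq(2))
  also have "\<dots> = (\<Sum>e\<leftarrow>p. \<Sum>e'\<leftarrow>q. \<integral>z. el_value e z * el_value e' z \<partial>integrand_space M t)"
    by (intro arg_cong[where f=sum_list] map_cong refl)
      (simp add: el_isometry(2)[OF is_simple_process_mem[OF p] is_simple_process_mem[OF q] t])
  also have "\<dots> = (\<integral>z. case_prod (case_prod (simple_value p)) z * case_prod (case_prod (simple_value q)) z \<partial>integrand_space M t)"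
    unfolding simple_value_eq by (rule integral_sum_list_mult[symmetric], erule ep(1), erule eq(1))
  finally show ?thesis .
qed

text \<open>The isometry and the mean zero property pass to limits. Square integrability of the integrand and of the
integral follows from that of any simple approximation at finite distance.\<close>

lemma walsh_L2:
  assumes f: "has_walsh_integral M W t f J" and t: "0 < t"
  shows "square_integrable (integrand_space M t) (\<lambda>((s, y), x). f s y x)" "square_integrable M J" "expectation J = 0"
    and "has_walsh_integral M W t g K \<Longrightarrow> expectation (\<lambda>x. J x * K x) =
      (\<integral>z. case_prod (case_prod f) z * case_prod (case_prod g) z \<partial>integrand_space M t)"
proof -
  have *: "\<exists>p. (\<forall>n. is_simple_process M W (p n)) \<and> square_integrable (integrand_space M t) (\<lambda>((s, y), x). f s y x) \<and> square_integrable M J \<and>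
     (\<lambda>n. \<integral>z. (case_prod (case_prod (simple_value (p n))) z - case_prod (case_prod f) z)\<^sup>2 \<partial>integrand_space M t) \<longlonglongrightarrow> 0 \<and>
     (\<lambda>n. expectation (\<lambda>x. (simple_integral W t (p n) x - J x)\<^sup>2)) \<longlonglongrightarrow> 0"
    if "has_walsh_integral M W t f J" for f J
  proof -
    from that obtain p where fm: "(\<lambda>((s, y), x). f s y x) \<in> borel_measurable (integrand_space M t)" and Jm: "J \<in> borel_measurable M"
      and p: "\<And>n. is_simple_process M W (p n)"
      and 1: "(\<lambda>n. L2_norm_sq (integrand_space M t) (\<lambda>((s, y), x). simple_value (p n) s y x - f s y x)) \<longlonglongrightarrow> 0"
      and 2: "(\<lambda>n. L2_norm_sq M (\<lambda>x. simple_integral W t (p n) x - J x)) \<longlonglongrightarrow> 0"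
      unfolding has_walsh_integral_def by blast
    have "(\<lambda>((s, y), x). simple_value (p n) s y x - f s y x) =
        (\<lambda>z. case_prod (case_prod (simple_value (p n))) z - case_prod (case_prod f) z)" for n
      by auto
    with 1 have 1: "(\<lambda>n. L2_norm_sq (integrand_space M t) (\<lambda>z. case_prod (case_prod (simple_value (p n))) z - case_prod (case_prod f) z)) \<longlonglongrightarrow> 0"
      by simp
    from L2_limit[OF simple_square_integrable(1)[OF p t] fm 1] L2_limit[OF simple_square_integrable(2)[OF p t] Jm 2] p
    show ?thesis by blast
  qed
  from *[OF f] obtain p where p: "\<And>n. is_simple_process M W (p n)"
    and sqf: "square_integrable (integrand_space M t) (\<lambda>((s, y), x). f s y x)" and sqJ: "square_integrable M J"
    and pf: "(\<lambda>n. \<integral>z. (case_prod (case_prod (simple_value (p n))) z - case_prod (case_prod f) z)\<^sup>2 \<partial>integrand_space M t) \<longlonglongrightarrow> 0"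
    and pJ: "(\<lambda>n. expectation (\<lambda>x. (simple_integral W t (p n) x - J x)\<^sup>2)) \<longlonglongrightarrow> 0"
    by blast
  show "square_integrable (integrand_space M t) (\<lambda>((s, y), x). f s y x)" by (rule sqf)
  show "square_integrable M J" by (rule sqJ)
  have "(\<lambda>n. expectation (\<lambda>x. simple_integral W t (p n) x * 1)) \<longlonglongrightarrow> expectation (\<lambda>x. J x * 1)"
    by (rule tendsto_L2_inner[where gs="\<lambda>_ _. 1", OF simple_square_integrable(2)[OF p t] sqJ square_integrable_const square_integrable_const pJ]) simp
  then show "expectation J = 0"
    using simple_square_integrable(3)[OF p t] by (simp add: LIMSEQ_const_iff)
  assume "has_walsh_integral M W t g K"
  from *[OF this] obtain q where q: "\<And>n. is_simple_process M W (q n)"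
    and sqg: "square_integrable (integrand_space M t) (\<lambda>((s, y), x). g s y x)" and sqK: "square_integrable M K"
    and qg: "(\<lambda>n. \<integral>z. (case_prod (case_prod (simple_value (q n))) z - case_prod (case_prod g) z)\<^sup>2 \<partial>integrand_space M t) \<longlonglongrightarrow> 0"
    and qK: "(\<lambda>n. expectation (\<lambda>x. (simple_integral W t (q n) x - K x)\<^sup>2)) \<longlonglongrightarrow> 0"
    by blast
  note 1 = tendsto_L2_inner[OF simple_square_integrable(2)[OF p t] sqJ simple_square_integrable(2)[OF q t] sqK pJ qK]
  note 2 = tendsto_L2_inner[OF simple_square_integrable(1)[OF p t] sqf simple_square_integrable(1)[OF q t] sqg pf qg]
  show "expectation (\<lambda>x. J x * K x) =
      (\<integral>z. case_prod (case_prod f) z * case_prod (case_prod g) z \<partial>integrand_space M t)"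
    using LIMSEQ_unique[OF 1 2[folded simple_isometry[OF p q t]]] .
qed

end


section \<open>The second moments of the solution\<close>

text \<open>The average of a field over space at time \<open>s\<close>, seen from the later point \<open>(T, X)\<close>. It vanishes outside
\<open>(0,T)\<close>, so that it can enter a convolution in time.\<close>

definition kernel_average :: "real \<Rightarrow> real \<Rightarrow> real \<Rightarrow> (real \<Rightarrow> real \<Rightarrow> ennreal) \<Rightarrow> real \<Rightarrow> ennreal" where
  "kernel_average \<nu> T X v s =
     (\<integral>\<^sup>+z. ennreal (heat_kernel (\<nu> / 2) (T - s) (X - z)) * v s z \<partial>lborel) * indicator {0<..} s"

lemma borel_measurable_kernel_average:
  assumes [measurable]: "(\<lambda>(s, z). v s z) \<in> borel_measurable (borel \<Otimes>\<^sub>M borel)"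
  shows "kernel_average \<nu> T X v \<in> borel_measurable borel"
  unfolding kernel_average_def[abs_def] by measurable

text \<open>The semigroup property turns an average of averages into a single average. This is where the
spatial variable disappears from the moment equation.\<close>

lemma kernel_average_semigroup:
  assumes [measurable]: "(\<lambda>(s, z). v s z) \<in> borel_measurable (borel \<Otimes>\<^sub>M borel)"
    and \<nu>: "0 < \<nu>" and s: "s < T"
  shows "(\<integral>\<^sup>+z. ennreal (heat_kernel (\<nu> / 2) (T - s) (X - z)) * conv (pulse \<nu> a 0) (kernel_average \<nu> s z v) s \<partial>lborel)
    = conv (pulse \<nu> a 0) (kernel_average \<nu> T X v) s"
proof -
  have [measurable]: "(\<lambda>(r, z). kernel_average \<nu> s z v r) \<in> borel_measurable (borel \<Otimes>\<^sub>M borel)"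
    unfolding kernel_average_def by measurable
  let ?K = "\<lambda>t x. ennreal (heat_kernel (\<nu> / 2) t x)"
  have "(\<integral>\<^sup>+z. ?K (T - s) (X - z) * conv (pulse \<nu> a 0) (kernel_average \<nu> s z v) s \<partial>lborel)
    = (\<integral>\<^sup>+z. \<integral>\<^sup>+r. pulse \<nu> a 0 (s - r) * (?K (T - s) (X - z) * kernel_average \<nu> s z v r) \<partial>lborel \<partial>lborel)"
    unfolding conv_def by (subst nn_integral_cmult[symmetric]) (auto simp: ac_simps)
  also have "\<dots> = (\<integral>\<^sup>+r. \<integral>\<^sup>+z. pulse \<nu> a 0 (s - r) * (?K (T - s) (X - z) * kernel_average \<nu> s z v r) \<partial>lborel \<partial>lborel)"
    by (rule lborel_pair.Fubini') measurable
  also have "\<dots> = (\<integral>\<^sup>+r. pulse \<nu> a 0 (s - r) * kernel_average \<nu> T X v r \<partial>lborel)"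
  proof (rule nn_integral_cong)
    fix r
    show "(\<integral>\<^sup>+z. pulse \<nu> a 0 (s - r) * (?K (T - s) (X - z) * kernel_average \<nu> s z v r) \<partial>lborel) =
       pulse \<nu> a 0 (s - r) * kernel_average \<nu> T X v r"
    proof (cases "0 < r \<and> r < s")
      case True
      have "(\<integral>\<^sup>+z. ?K (T - s) (X - z) * kernel_average \<nu> s z v r \<partial>lborel) =
        (\<integral>\<^sup>+z. \<integral>\<^sup>+z'. ?K (T - s) (X - z) * (?K (s - r) (z - z') * v r z') \<partial>lborel \<partial>lborel)"
        using True by (simp add: kernel_average_def nn_integral_cmult)
      also have "\<dots> = (\<integral>\<^sup>+z'. \<integral>\<^sup>+z. ?K (T - s) (X - z) * (?K (s - r) (z - z') * v r z') \<partial>lborel \<partial>lborel)"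
        by (rule lborel_pair.Fubini') measurable
      also have "\<dots> = (\<integral>\<^sup>+z'. (\<integral>\<^sup>+z. ?K (T - s) (X - z) * ?K (s - r) (z - z') \<partial>lborel) * v r z' \<partial>lborel)"
        by (subst nn_integral_multc[symmetric]) (auto simp: ac_simps)
      also have "\<dots> = (\<integral>\<^sup>+z'. ?K (T - r) (X - z') * v r z' \<partial>lborel)"
        using True s \<nu> by (subst heat_kernel_semigroup) auto
      finally show ?thesis using True by (simp add: nn_integral_cmult kernel_average_def)
    qed (auto simp: kernel_average_def)
  qed
  finally show ?thesis by (simp add: conv_def)
qed

context white_noise_space begin

text \<open>The value \<open>0\<close> for \<open>s \<le> 0\<close> makes this a Borel function on the whole plane, although \<open>u\<close> is measurable only
for positive times.\<close>

definition second_moment :: "(real \<Rightarrow> real \<Rightarrow> 'a \<Rightarrow> real) \<Rightarrow> real \<Rightarrow> real \<Rightarrow> ennreal" where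
  "second_moment u s z = (if 0 < s then \<integral>\<^sup>+\<omega>. ennreal ((u s z \<omega>)\<^sup>2) \<partial>M else 0)"

lemma borel_measurable_second_moment:
  assumes u: "(\<lambda>((t, x), \<omega>). u t x \<omega>) \<in> borel_measurable (restrict_space borel ({0<..} \<times> UNIV) \<Otimes>\<^sub>M M)"
  shows "(\<lambda>(s, z). second_moment u s z) \<in> borel_measurable (borel \<Otimes>\<^sub>M borel)"
proof -
  let ?S = "{0<..} \<times> (UNIV :: real set)"
  have S: "?S \<in> sets (borel :: (real \<times> real) measure)" by (subst borel_prod[symmetric]) auto
  have "(\<lambda>p. \<integral>\<^sup>+\<omega>. ennreal ((case (p, \<omega>) of ((t, x), \<omega>) \<Rightarrow> u t x \<omega>)\<^sup>2) \<partial>M) \<in> borel_measurable (restrict_space borel ?S)"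
    using u by (intro borel_measurable_nn_integral) (simp add: case_prod_unfold)
  then have "(\<lambda>p. if p \<in> ?S then \<integral>\<^sup>+\<omega>. ennreal ((case (p, \<omega>) of ((t, x), \<omega>) \<Rightarrow> u t x \<omega>)\<^sup>2) \<partial>M else 0) \<in> borel_measurable borel"
    using S by (subst (asm) measurable_restrict_space_iff[where c=0]) auto
  moreover have "(\<lambda>p. if p \<in> ?S then \<integral>\<^sup>+\<omega>. ennreal ((case (p, \<omega>) of ((t, x), \<omega>) \<Rightarrow> u t x \<omega>)\<^sup>2) \<partial>M else 0) =
      (\<lambda>(s, z). second_moment u s z)"
    by (auto simp: second_moment_def)
  ultimately show ?thesis by (simp add: borel_prod)
qed

text \<open>The isometry expresses the covariance as a space-time integral of the product of the kernels times
\<open>E[\<rho>(u)\<^sup>2] = a (\<sigma>2 + E[u\<^sup>2])\<close>. Splitting that product by \<open>heat_kernel_product\<close> leaves a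
kernel that depends on time alone, convolved with an average over space.\<close>

lemma walsh_covariance:
  assumes \<nu>: "0 < \<nu>" and a: "0 < a" and \<sigma>2: "0 \<le> \<sigma>2" and t: "0 < t"
    and \<rho>: "\<And>x. (\<rho> x)\<^sup>2 = a * (\<sigma>2 + x\<^sup>2)"
    and um: "(\<lambda>((t, x), \<omega>). u t x \<omega>) \<in> borel_measurable (restrict_space borel ({0<..} \<times> UNIV) \<Otimes>\<^sub>M M)"
    and u: "\<And>s z. 0 < s \<Longrightarrow> u s z \<in> borel_measurable M"
    and I: "has_walsh_integral M W t (\<lambda>s z \<omega>. heat_kernel \<nu> (t - s) (x - z) * \<rho> (u s z \<omega>)) I"
    and J: "has_walsh_integral M W t (\<lambda>s z \<omega>. heat_kernel \<nu> (t - s) (y - z) * \<rho> (u s z \<omega>)) J"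
  shows "0 \<le> expectation (\<lambda>\<omega>. I \<omega> * J \<omega>)"
    and "ennreal (expectation (\<lambda>\<omega>. I \<omega> * J \<omega>)) =
      conv (pulse \<nu> a \<bar>x - y\<bar>) (kernel_average \<nu> t ((x + y) / 2) (\<lambda>s z. ennreal \<sigma>2 + second_moment u s z)) t"
proof -
  let ?f = "\<lambda>s z \<omega>. heat_kernel \<nu> (t - s) (x - z) * \<rho> (u s z \<omega>)"
  let ?g = "\<lambda>s z \<omega>. heat_kernel \<nu> (t - s) (y - z) * \<rho> (u s z \<omega>)"
  let ?k = "\<lambda>s z. a * (heat_kernel \<nu> (t - s) (x - z) * heat_kernel \<nu> (t - s) (y - z))"
  let ?S = "{0<..t} \<times> (UNIV :: real set)"
  let ?L = "restrict_space lborel ?S"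
  have S: "?S \<in> sets (borel :: (real \<times> real) measure)" by (subst borel_prod[symmetric]) auto
  let ?H = "\<lambda>q. (\<lambda>((s, z), \<omega>). ?f s z \<omega>) q * (\<lambda>((s, z), \<omega>). ?g s z \<omega>) q"
  have fg: "?f s z \<omega> * ?g s z \<omega> = ?k s z * (\<sigma>2 + (u s z \<omega>)\<^sup>2)" for s z \<omega>
  proof -
    have "?f s z \<omega> * ?g s z \<omega> = heat_kernel \<nu> (t - s) (x - z) * heat_kernel \<nu> (t - s) (y - z) * (\<rho> (u s z \<omega>))\<^sup>2"
      by (simp add: power2_eq_square)
    then show ?thesis unfolding \<rho> by simp
  qed
  have k: "0 \<le> ?k s z" for s z using a \<nu> by simp
  have H0: "0 \<le> ?H q" for q
    by (cases q) (auto simp: fg case_prod_unfold intro!: mult_nonneg_nonneg k add_nonneg_nonneg \<sigma>2)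
  note F = walsh_L2(1)[OF I t] and G = walsh_L2(1)[OF J t]
  have E: "expectation (\<lambda>\<omega>. I \<omega> * J \<omega>) = (\<integral>q. ?H q \<partial>integrand_space M t)"
    by (rule walsh_L2(4)[OF I t J])
  then show "0 \<le> expectation (\<lambda>\<omega>. I \<omega> * J \<omega>)"
    using H0 by (simp add: Bochner_Integration.integral_nonneg)
  have Hm: "(\<lambda>q. ennreal (?H q)) \<in> borel_measurable (?L \<Otimes>\<^sub>M M)"
    using square_integrable_measurable[OF F] square_integrable_measurable[OF G]
    unfolding integrand_space_def by measurable
  have vm: "(\<lambda>(s, z). second_moment u s z) \<in> borel_measurable (borel \<Otimes>\<^sub>M borel)"
    by (rule borel_measurable_second_moment[OF um])
  have [measurable]: "(\<lambda>p. second_moment u (fst p) (snd p)) \<in> borel_measurable (borel \<Otimes>\<^sub>M borel)"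
    using vm by (simp add: case_prod_unfold)
  have [measurable]: "(\<lambda>z. second_moment u s z) \<in> borel_measurable borel" for s
    using measurable_compose[OF measurable_Pair[OF measurable_const[of s borel borel] measurable_ident_sets[OF refl]] vm] by simp
  have "ennreal (expectation (\<lambda>\<omega>. I \<omega> * J \<omega>)) = (\<integral>\<^sup>+q. ennreal (?H q) \<partial>(?L \<Otimes>\<^sub>M M))"
    unfolding E integrand_space_def[symmetric]
    by (rule nn_integral_eq_integral[symmetric, OF square_integrable_mult[OF F G]]) (use H0 in auto)
  also have "\<dots> = (\<integral>\<^sup>+p. \<integral>\<^sup>+\<omega>. ennreal (?H (p, \<omega>)) \<partial>M \<partial>?L)"
    by (rule nn_integral_fst[OF Hm, symmetric])
  also have "\<dots> = (\<integral>\<^sup>+p. ennreal (?k (fst p) (snd p)) * (ennreal \<sigma>2 + second_moment u (fst p) (snd p)) \<partial>?L)"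
  proof (rule nn_integral_cong)
    fix p assume "p \<in> space ?L"
    then have s: "0 < fst p" by (auto simp: space_restrict_space)
    obtain s z where p: "p = (s, z)" by (cases p)
    have [measurable]: "u s z \<in> borel_measurable M" using u s p by simp
    have "(\<integral>\<^sup>+\<omega>. ennreal (?H (p, \<omega>)) \<partial>M) = (\<integral>\<^sup>+\<omega>. ennreal (?k s z) * (ennreal \<sigma>2 + ennreal ((u s z \<omega>)\<^sup>2)) \<partial>M)"
      unfolding p using k \<sigma>2 by (simp add: fg ennreal_mult del: ennreal_plus add: ennreal_plus[symmetric])
    also have "\<dots> = ennreal (?k s z) * (ennreal \<sigma>2 + second_moment u s z)"
      using s p by (simp add: nn_integral_cmult nn_integral_add second_moment_def emeasure_space_1)
    finally show "(\<integral>\<^sup>+\<omega>. ennreal (?H (p, \<omega>)) \<partial>M) = ennreal (?k (fst p) (snd p)) * (ennreal \<sigma>2 + second_moment u (fst p) (snd p))"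
      unfolding p by simp
  qed
  also have "\<dots> = (\<integral>\<^sup>+p. ennreal (?k (fst p) (snd p)) * (ennreal \<sigma>2 + second_moment u (fst p) (snd p)) * indicator ?S p \<partial>(lborel \<Otimes>\<^sub>M lborel))"
    unfolding lborel_prod using S by (subst nn_integral_restrict_space) auto
  also have "\<dots> = (\<integral>\<^sup>+s. \<integral>\<^sup>+z. ennreal (?k s z) * (ennreal \<sigma>2 + second_moment u s z) * indicator ?S (s, z) \<partial>lborel \<partial>lborel)"
    by (subst lborel.nn_integral_fst[symmetric]) auto
  also have "\<dots> = conv (pulse \<nu> a \<bar>x - y\<bar>) (kernel_average \<nu> t ((x + y) / 2) (\<lambda>s z. ennreal \<sigma>2 + second_moment u s z)) t"
    unfolding conv_def
  proof (rule nn_integral_cong)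
    fix s
    show "(\<integral>\<^sup>+z. ennreal (?k s z) * (ennreal \<sigma>2 + second_moment u s z) * indicator ?S (s, z) \<partial>lborel) =
      pulse \<nu> a \<bar>x - y\<bar> (t - s) * kernel_average \<nu> t ((x + y) / 2) (\<lambda>s z. ennreal \<sigma>2 + second_moment u s z) s"
    proof (cases "0 < s \<and> s < t")
      case True
      have "?k s z = a * heat_kernel (2 * \<nu>) (t - s) \<bar>x - y\<bar> * heat_kernel (\<nu> / 2) (t - s) ((x + y) / 2 - z)" for z
        using heat_kernel_product[OF \<nu>, of "t - s" "x - z" "y - z"] by (simp add: heat_kernel_abs field_simps)
      then have "ennreal (?k s z) = pulse \<nu> a \<bar>x - y\<bar> (t - s) * ennreal (heat_kernel (\<nu> / 2) (t - s) ((x + y) / 2 - z))" for z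
        using a \<nu> by (simp add: pulse_def ennreal_mult mult.assoc)
      then show ?thesis
        using True by (simp add: kernel_average_def mult.assoc nn_integral_cmult)
    qed (auto simp: kernel_average_def)
  qed
  finally show "ennreal (expectation (\<lambda>\<omega>. I \<omega> * J \<omega>)) =
      conv (pulse \<nu> a \<bar>x - y\<bar>) (kernel_average \<nu> t ((x + y) / 2) (\<lambda>s z. ennreal \<sigma>2 + second_moment u s z)) t" .
qed

text \<open>The Volterra equation for \<open>w = kernel_average \<nu> T X (\<sigma>2 + E[u\<^sup>2])\<close> is derived from the mild form of the
equation at all earlier points, and its solution is inserted into \<open>walsh_covariance\<close> at the point \<open>(T, X)\<close>
with \<open>X = (x + y) / 2\<close>.\<close>

theorem two_point_moment:
  assumes \<nu>: "0 < \<nu>" and a: "0 < a" and \<sigma>2: "0 \<le> \<sigma>2" and T: "0 < T"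
    and \<rho>: "\<And>x. (\<rho> x)\<^sup>2 = a * (\<sigma>2 + x\<^sup>2)"
    and sol: "random_field_solution M W \<nu> \<rho> (return borel 0) u"
  shows "integrable M (\<lambda>\<omega>. u T x \<omega> * u T y \<omega>)"
    and "expectation (\<lambda>\<omega>. u T x \<omega> * u T y \<omega>) = heat_kernel \<nu> T x * heat_kernel \<nu> T y
      + (a / (4 * \<nu>) * heat_kernel (\<nu> / 2) T ((x + y) / 2) + \<sigma>2) * erfc_exp \<nu> a \<bar>x - y\<bar> T
      - \<sigma>2 * erfc (\<bar>x - y\<bar> / (2 * sqrt (\<nu> * T)))"
proof -
  have um: "(\<lambda>((t, x), \<omega>). u t x \<omega>) \<in> borel_measurable (restrict_space borel ({0<..} \<times> UNIV) \<Otimes>\<^sub>M M)"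
    using sol by (simp add: random_field_solution_def)
  have u: "u s z \<in> borel_measurable M" if "0 < s" for s z
    using sol[unfolded random_field_solution_def, THEN conjunct1] that
    by (auto intro: measurable_noise_filtration_M)
  obtain I where I': "\<forall>t>0. \<forall>x. has_walsh_integral M W t
      (\<lambda>s y \<omega>. heat_kernel \<nu> (t - s) (x - y) * \<rho> (u s y \<omega>)) (I t x)"
    and uI': "\<forall>t>0. \<forall>x. AE \<omega> in M. u t x \<omega> = heat_kernel \<nu> t x + I t x \<omega>"
    using sol[unfolded random_field_solution_def J0_dirac, THEN conjunct2, THEN conjunct2, THEN conjunct2]
    by (elim exE conjE) (rule that)
  note I = I'[rule_format] and uI = uI'[rule_format]
  let ?v = "\<lambda>s z. ennreal \<sigma>2 + second_moment u s z"
  have vm: "(\<lambda>(s, z). second_moment u s z) \<in> borel_measurable (borel \<Otimes>\<^sub>M borel)"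
    by (rule borel_measurable_second_moment[OF um])
  then have vm' [measurable]: "(\<lambda>(s, z). ?v s z) \<in> borel_measurable (borel \<Otimes>\<^sub>M borel)"
    by (simp add: case_prod_unfold)
  have cov: "0 \<le> expectation (\<lambda>\<omega>. I t x \<omega> * I t y \<omega>)"
    "ennreal (expectation (\<lambda>\<omega>. I t x \<omega> * I t y \<omega>)) = conv (pulse \<nu> a \<bar>x - y\<bar>) (kernel_average \<nu> t ((x + y) / 2) ?v) t"
    if t: "0 < t" for t x y
    using walsh_covariance[where u=u and \<rho>=\<rho>, OF \<nu> a \<sigma>2 t \<rho> um u I[OF t, of x] I[OF t, of y]] by auto
  have uu: "integrable M (\<lambda>\<omega>. u t x \<omega> * u t y \<omega>)"
    "expectation (\<lambda>\<omega>. u t x \<omega> * u t y \<omega>) = heat_kernel \<nu> t x * heat_kernel \<nu> t y + expectation (\<lambda>\<omega>. I t x \<omega> * I t y \<omega>)"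
    if t: "0 < t" for t x y
  proof -
    let ?r = "\<lambda>\<omega>. heat_kernel \<nu> t x * heat_kernel \<nu> t y + heat_kernel \<nu> t x * I t y \<omega> + heat_kernel \<nu> t y * I t x \<omega> + I t x \<omega> * I t y \<omega>"
    have sq: "square_integrable M (I t z)" and mean: "expectation (I t z) = 0" for z
      using walsh_L2[OF I[OF t, of z] t] by auto
    have [measurable]: "I t z \<in> borel_measurable M" "u t z \<in> borel_measurable M" for z
      using square_integrable_measurable[OF sq] u[OF t] by auto
    have eq: "AE \<omega> in M. u t x \<omega> * u t y \<omega> = ?r \<omega>"
      using uI[OF t, of x] uI[OF t, of y] by eventually_elim (simp add: algebra_simps)
    have ints: "integrable M (I t z)" "integrable M (\<lambda>\<omega>. I t x \<omega> * I t y \<omega>)" for z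
      using square_integrable_integrable[OF sq] square_integrable_mult[OF sq sq] by auto
    then have r: "integrable M ?r" by simp
    show "integrable M (\<lambda>\<omega>. u t x \<omega> * u t y \<omega>)"
      by (rule integrable_cong_AE_imp[OF r]) (use eq in \<open>auto elim: eventually_mono\<close>)
    have "expectation (\<lambda>\<omega>. u t x \<omega> * u t y \<omega>) = expectation ?r"
      using eq by (intro integral_cong_AE) auto
    also have "\<dots> = heat_kernel \<nu> t x * heat_kernel \<nu> t y + expectation (\<lambda>\<omega>. I t x \<omega> * I t y \<omega>)"
      using ints mean by (simp add: prob_space)
    finally show "expectation (\<lambda>\<omega>. u t x \<omega> * u t y \<omega>) = \<dots>" .
  qed
  have v_eq: "second_moment u t z = ennreal (heat_kernel (\<nu> / 2) t z * heat_kernel (2 * \<nu>) t 0)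
      + conv (pulse \<nu> a 0) (kernel_average \<nu> t z ?v) t" if t: "0 < t" for t z
  proof -
    have "second_moment u t z = (\<integral>\<^sup>+\<omega>. ennreal (u t z \<omega> * u t z \<omega>) \<partial>M)"
      using t by (simp add: second_moment_def power2_eq_square)
    also have "\<dots> = ennreal (expectation (\<lambda>\<omega>. u t z \<omega> * u t z \<omega>))"
      by (intro nn_integral_eq_integral uu(1)[OF t]) auto
    also have "\<dots> = ennreal (heat_kernel \<nu> t z * heat_kernel \<nu> t z) + ennreal (expectation (\<lambda>\<omega>. I t z \<omega> * I t z \<omega>))"
      unfolding uu(2)[OF t] using cov(1)[OF t, of z z] \<nu> by (intro ennreal_plus) auto
    finally show ?thesis
      using cov(2)[OF t, of z z] heat_kernel_product[OF \<nu>, of t z z] by simp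
  qed
  define X where "X = (x + y) / 2"
  define p where "p = heat_kernel (\<nu> / 2) T X"
  define w where "w = kernel_average \<nu> T X ?v"
  have p: "0 \<le> p" unfolding p_def using \<nu> by simp
  have wm [measurable]: "w \<in> borel_measurable borel"
    unfolding w_def by (rule borel_measurable_kernel_average[OF vm'])
  have w0: "w s = 0" if "s \<le> 0" for s using that by (simp add: w_def kernel_average_def)
  have [measurable]: "(\<lambda>z. second_moment u s z) \<in> borel_measurable borel" for s
    using measurable_compose[OF measurable_Pair[OF measurable_const[of s borel borel] measurable_ident_sets[OF refl]] vm] by simp
  have [measurable]: "(\<lambda>(z, r). kernel_average \<nu> s z ?v r) \<in> borel_measurable (borel \<Otimes>\<^sub>M borel)" for s
    unfolding kernel_average_def by measurable
  have [measurable]: "(\<lambda>z. conv (pulse \<nu> a 0) (kernel_average \<nu> s z ?v) s) \<in> borel_measurable borel" for s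
    unfolding conv_def by measurable
  have w_eq: "w s = ennreal \<sigma>2 + ennreal (p / a) * pulse \<nu> a 0 s + conv (pulse \<nu> a 0) w s" if s: "0 < s" "s < T" for s
  proof -
    let ?K = "\<lambda>z. ennreal (heat_kernel (\<nu> / 2) (T - s) (X - z))"
    let ?g = "\<lambda>z. ennreal (heat_kernel (\<nu> / 2) s (z - 0))"
    have \<nu>2: "0 < \<nu> / 2" "0 < T - s" using \<nu> s by auto
    have "w s = (\<integral>\<^sup>+z. ?K z * ?v s z \<partial>lborel)" using s by (simp add: w_def kernel_average_def)
    also have "\<dots> = (\<integral>\<^sup>+z. ennreal \<sigma>2 * ?K z + ennreal (heat_kernel (2 * \<nu>) s 0) * (?K z * ?g z)
        + ?K z * conv (pulse \<nu> a 0) (kernel_average \<nu> s z ?v) s \<partial>lborel)"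
      unfolding v_eq[OF s(1)] using \<nu>
      by (intro nn_integral_cong) (simp add: distrib_left ennreal_mult ac_simps)
    also have "\<dots> = ennreal \<sigma>2 * (\<integral>\<^sup>+z. ?K z \<partial>lborel) + ennreal (heat_kernel (2 * \<nu>) s 0) * (\<integral>\<^sup>+z. ?K z * ?g z \<partial>lborel)
        + (\<integral>\<^sup>+z. ?K z * conv (pulse \<nu> a 0) (kernel_average \<nu> s z ?v) s \<partial>lborel)"
      by (simp add: nn_integral_add nn_integral_cmult)
    also have "(\<integral>\<^sup>+z. ?K z \<partial>lborel) = 1" by (rule heat_kernel_mass[OF \<nu>2])
    also have "(\<integral>\<^sup>+z. ?K z * ?g z \<partial>lborel) = ennreal p"
      using heat_kernel_semigroup[OF \<nu>2 s(1), of X 0] by (simp add: p_def)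
    also have "(\<integral>\<^sup>+z. ?K z * conv (pulse \<nu> a 0) (kernel_average \<nu> s z ?v) s \<partial>lborel) = conv (pulse \<nu> a 0) w s"
      unfolding w_def by (rule kernel_average_semigroup[OF vm' \<nu> s(2)])
    also have "ennreal (heat_kernel (2 * \<nu>) s 0) * ennreal p = ennreal (p / a) * pulse \<nu> a 0 s"
      using a p \<nu> by (simp add: pulse_def ennreal_mult'[symmetric] mult.commute)
    finally show ?thesis by simp
  qed
  have fin: "(\<integral>\<^sup>+s\<in>{0<..<T}. w s \<partial>lborel) < \<infinity>"
  \<comment> \<open>on \<open>(0,T)\<close> the kernel is at least its value \<open>?c\<close> at time \<open>T\<close>, and \<open>(b * w)(T)\<close> is finite\<close>
  proof -
    let ?c = "a * heat_kernel (2 * \<nu>) T 0"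
    have c: "0 < ?c" using a \<nu> T by (simp add: heat_kernel_def)
    have "ennreal ?c * (\<integral>\<^sup>+s\<in>{0<..<T}. w s \<partial>lborel) = (\<integral>\<^sup>+s. ennreal ?c * (w s * indicator {0<..<T} s) \<partial>lborel)"
      by (rule nn_integral_cmult[symmetric]) auto
    also have "\<dots> \<le> conv (pulse \<nu> a 0) w T"
      unfolding conv_def
    proof (rule nn_integral_mono)
      fix s
      show "ennreal ?c * (w s * indicator {0<..<T} s) \<le> pulse \<nu> a 0 (T - s) * w s"
      proof (cases "s \<in> {0<..<T}")
        case True
        have "sqrt (2 * pi * (2 * \<nu>) * (T - s)) \<le> sqrt (2 * pi * (2 * \<nu>) * T)"
          using \<nu> True by (intro real_sqrt_le_mono mult_left_mono) auto
        then have "heat_kernel (2 * \<nu>) T 0 \<le> heat_kernel (2 * \<nu>) (T - s) 0"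
          using \<nu> T True by (auto simp: heat_kernel_def intro!: divide_left_mono mult_pos_pos)
        then have "ennreal ?c \<le> pulse \<nu> a 0 (T - s)"
          unfolding pulse_def using a by (intro ennreal_leI mult_left_mono) auto
        then show ?thesis using True by (auto intro: mult_right_mono)
      qed simp
    qed
    also have "\<dots> < \<infinity>"
    proof -
      have "conv (pulse \<nu> a 0) w T = ennreal (expectation (\<lambda>\<omega>. I T X \<omega> * I T X \<omega>))"
        using cov(2)[OF T, of X X] by (simp add: w_def)
      then show ?thesis by simp
    qed
    finally show ?thesis using c by (auto simp: ennreal_mult_less_top)
  qed
  let ?d = "\<bar>x - y\<bar>"
  let ?R = "p / a * growth_rate \<nu> a * erfc_exp \<nu> a ?d T + \<sigma>2 * (erfc_exp \<nu> a ?d T - erfc (?d / (2 * sqrt (\<nu> * T))))"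
  have "0 \<le> p / a" using p a by simp
  note vol = volterra_moment[OF \<nu> a this \<sigma>2 abs_ge_zero[of "x - y"] T wm w0 w_eq fin]
  have R0: "0 \<le> ?R"
  proof -
    have "erfc (?d / (2 * sqrt (\<nu> * T))) \<le> erfc_exp \<nu> a ?d T"
      using erfc_exp_resolvent[OF \<nu> a abs_ge_zero[of "x - y"] T] erfc_exp_nonneg[of \<nu> a ?d T]
      by (metis ennreal_le_iff le_iff_add)
    then show ?thesis
      using \<open>0 \<le> p / a\<close> growth_rate_nonneg[OF \<nu>] erfc_exp_nonneg \<sigma>2 by (intro add_nonneg_nonneg mult_nonneg_nonneg) auto
  qed
  have "ennreal (expectation (\<lambda>\<omega>. I T x \<omega> * I T y \<omega>)) = ennreal ?R"
    using cov(2)[OF T, of x y] vol by (simp add: w_def X_def)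
  then have EI: "expectation (\<lambda>\<omega>. I T x \<omega> * I T y \<omega>) = ?R"
    using cov(1)[OF T] R0 by (subst (asm) ennreal_inj) auto
  have "p / a * growth_rate \<nu> a = a / (4 * \<nu>) * p"
    using a by (simp add: growth_rate_def power2_eq_square)
  then show "expectation (\<lambda>\<omega>. u T x \<omega> * u T y \<omega>) = heat_kernel \<nu> T x * heat_kernel \<nu> T y
      + (a / (4 * \<nu>) * heat_kernel (\<nu> / 2) T ((x + y) / 2) + \<sigma>2) * erfc_exp \<nu> a ?d T
      - \<sigma>2 * erfc (?d / (2 * sqrt (\<nu> * T)))"
    unfolding uu(2)[OF T] EI by (simp add: p_def X_def algebra_simps)
  show "integrable M (\<lambda>\<omega>. u T x \<omega> * u T y \<omega>)" by (rule uu(1)[OF T])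
qed

end

text \<open>On the diagonal \<open>erfc\<close> has a negative argument and is \<open>2 \<Phi>\<close> at the rescaled positive one, and
\<open>G\<^bsub>\<nu>\<^esub>(t,x)\<^sup>2\<close> factors as \<open>G\<^bsub>\<nu>/2\<^esub>(t,x) / sqrt (4 \<pi> \<nu> t)\<close>.\<close>

lemma one_point_closed_form:
  assumes \<nu>: "0 < \<nu>" and l: "l \<noteq> 0" and t: "0 < t"
  shows "heat_kernel \<nu> t x * heat_kernel \<nu> t x
      + (l\<^sup>2 / (4 * \<nu>) * heat_kernel (\<nu> / 2) t x + \<sigma>\<^sup>2) * erfc_exp \<nu> (l\<^sup>2) 0 t - \<sigma>\<^sup>2 =
    1 / l\<^sup>2 * K_fun \<nu> l t x + \<sigma>\<^sup>2 * H_fun \<nu> l t"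
proof -
  define P where "P = Phi (l\<^sup>2 * sqrt (t / (2 * \<nu>)))"
  have l4: "(l\<^sup>2)\<^sup>2 = l ^ 4" by (simp add: power_mult[symmetric])
  have "l\<^sup>2 * sqrt (t / (2 * \<nu>)) / sqrt 2 = l\<^sup>2 * t / (2 * sqrt (\<nu> * t))"
  proof -
    have "sqrt (t / (2 * \<nu>)) / sqrt 2 = sqrt (t\<^sup>2 / (2\<^sup>2 * (\<nu> * t)))"
      unfolding real_sqrt_divide[symmetric] using t \<nu> by (intro arg_cong[where f=sqrt]) (simp add: power2_eq_square)
    also have "\<dots> = t / (2 * sqrt (\<nu> * t))"
      using t by (simp add: real_sqrt_divide real_sqrt_mult[of "4"] real_sqrt_mult[of "2\<^sup>2"])
    finally show ?thesis by (simp flip: times_divide_eq_right)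
  qed
  then have P: "erfc ((0 - l\<^sup>2 * t) / (2 * sqrt (\<nu> * t))) = 2 * P"
    by (simp add: P_def Phi_eq_erfc)
  have E: "erfc_exp \<nu> (l\<^sup>2) 0 t = 2 * (exp (l ^ 4 * t / (4 * \<nu>)) * P)"
    unfolding erfc_exp_def P by (simp add: l4)
  have "heat_kernel (2 * \<nu>) t 0 = 1 / sqrt (4 * pi * \<nu> * t)"
    using t by (simp add: heat_kernel_def ac_simps)
  then have G: "heat_kernel \<nu> t x * heat_kernel \<nu> t x = heat_kernel (\<nu> / 2) t x * (1 / sqrt (4 * pi * \<nu> * t))"
    using heat_kernel_product[OF \<nu>, of t x x] by simp
  show ?thesis
    unfolding G E K_fun_def H_fun_def P_def[symmetric]
  proof -
    have "g * r + (l\<^sup>2 / (4 * \<nu>) * g + s) * (2 * e) - s =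
       1 / l\<^sup>2 * (g * (l\<^sup>2 * r + l ^ 4 / (2 * \<nu>) * e)) + s * (2 * e - 1)" for g r e s
      using l by (simp add: l4[symmetric] power2_eq_square field_simps)
    from this[of "heat_kernel (\<nu> / 2) t x" "1 / sqrt (4 * pi * \<nu> * t)" "\<sigma>\<^sup>2" "exp (l ^ 4 * t / (4 * \<nu>)) * P"]
    show "heat_kernel (\<nu> / 2) t x * (1 / sqrt (4 * pi * \<nu> * t)) + (l\<^sup>2 / (4 * \<nu>) * heat_kernel (\<nu> / 2) t x + \<sigma>\<^sup>2) * (2 * (exp (l ^ 4 * t / (4 * \<nu>)) * P)) - \<sigma>\<^sup>2 =
      1 / l\<^sup>2 * (heat_kernel (\<nu> / 2) t x * (l\<^sup>2 / sqrt (4 * pi * \<nu> * t) + l ^ 4 / (2 * \<nu>) * exp (l ^ 4 * t / (4 * \<nu>)) * P)) + \<sigma>\<^sup>2 * (2 * exp (l ^ 4 * t / (4 * \<nu>)) * P - 1)"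
      by (simp add: mult.assoc)
  qed
qed

theorem corollary2p6:
  fixes M :: "'a measure" and W :: "(real \<times> real) set \<Rightarrow> 'a \<Rightarrow> real"
    and u :: "real \<Rightarrow> real \<Rightarrow> 'a \<Rightarrow> real" and \<rho> :: "real \<Rightarrow> real" and \<nu> l \<sigma> :: real
  assumes "prob_space M" and "white_noise M W"
    and "\<nu> > 0" and "l \<noteq> 0" and "\<sigma> \<ge> 0"
    and "\<exists>L. L-lipschitz_on UNIV \<rho>"
    and "\<And>x. \<bar>\<rho> x\<bar>\<^sup>2 = l\<^sup>2 * (\<sigma>\<^sup>2 + x\<^sup>2)"
    and "random_field_solution M W \<nu> \<rho> (return borel 0) u"
  shows "(\<forall>t>0. \<forall>x y.
      integrable M (\<lambda>\<omega>. u t x \<omega> * u t y \<omega>) \<and>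
      integral\<^sup>L M (\<lambda>\<omega>. u t x \<omega> * u t y \<omega>) =
        heat_kernel \<nu> t x * heat_kernel \<nu> t y
        - \<sigma>\<^sup>2 * erfc (\<bar>x - y\<bar> / (2 * sqrt (\<nu> * t)))
        + (l\<^sup>2 / (4 * \<nu>) * heat_kernel (\<nu> / 2) t ((x + y) / 2) + \<sigma>\<^sup>2)
          * exp ((l ^ 4 * t - 2 * l\<^sup>2 * \<bar>x - y\<bar>) / (4 * \<nu>))
          * erfc ((\<bar>x - y\<bar> - l\<^sup>2 * t) / (2 * sqrt (\<nu> * t)))) \<and>
    (\<forall>t>0. \<forall>x.
      integral\<^sup>L M (\<lambda>\<omega>. \<bar>u t x \<omega>\<bar>\<^sup>2) = 1 / l\<^sup>2 * K_fun \<nu> l t x + \<sigma>\<^sup>2 * H_fun \<nu> l t)"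
proof -
  interpret prob_space M by fact
  interpret white_noise_space M W by unfold_locales fact
  have a: "0 < l\<^sup>2" using \<open>l \<noteq> 0\<close> by simp
  have \<rho>: "(\<rho> x)\<^sup>2 = l\<^sup>2 * (\<sigma>\<^sup>2 + x\<^sup>2)" for x using assms(7)[of x] by simp
  note moment = two_point_moment[OF \<open>\<nu> > 0\<close> a zero_le_power2[of \<sigma>] _ \<rho> assms(8)]
  have l4: "(l\<^sup>2)\<^sup>2 = l ^ 4" by (simp add: power_mult[symmetric])
  show ?thesis
  proof (intro conjI allI impI)
    fix t x y :: real assume t: "0 < t"
    show "integrable M (\<lambda>\<omega>. u t x \<omega> * u t y \<omega>)" by (rule moment(1)[OF t])
    show "integral\<^sup>L M (\<lambda>\<omega>. u t x \<omega> * u t y \<omega>) =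
        heat_kernel \<nu> t x * heat_kernel \<nu> t y
        - \<sigma>\<^sup>2 * erfc (\<bar>x - y\<bar> / (2 * sqrt (\<nu> * t)))
        + (l\<^sup>2 / (4 * \<nu>) * heat_kernel (\<nu> / 2) t ((x + y) / 2) + \<sigma>\<^sup>2)
          * exp ((l ^ 4 * t - 2 * l\<^sup>2 * \<bar>x - y\<bar>) / (4 * \<nu>))
          * erfc ((\<bar>x - y\<bar> - l\<^sup>2 * t) / (2 * sqrt (\<nu> * t)))"
      unfolding moment(2)[OF t] erfc_exp_def l4 by (simp add: mult.assoc)
  next
    fix t x :: real assume t: "0 < t"
    have "integral\<^sup>L M (\<lambda>\<omega>. \<bar>u t x \<omega>\<bar>\<^sup>2) = integral\<^sup>L M (\<lambda>\<omega>. u t x \<omega> * u t x \<omega>)"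
      by (simp add: power2_eq_square)
    also have "\<dots> = 1 / l\<^sup>2 * K_fun \<nu> l t x + \<sigma>\<^sup>2 * H_fun \<nu> l t"
      using moment(2)[OF t, of x x] one_point_closed_form[OF \<open>\<nu> > 0\<close> \<open>l \<noteq> 0\<close> t, of x \<sigma>] by simp
    finally show "integral\<^sup>L M (\<lambda>\<omega>. \<bar>u t x \<omega>\<bar>\<^sup>2) = 1 / l\<^sup>2 * K_fun \<nu> l t x + \<sigma>\<^sup>2 * H_fun \<nu> l t" .
  qed
qed

end
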